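(* Let $\Gamma$ be a non-elementary hyperbolic group equipped with a word metric, let $\mu$ be a finitely supported admissible probability measure on $\Gamma$, and let $\{x_n\}_{n\ge0}$ be the associated random walk starting at the identity. Let $\hat h=h/l$, let $\tau_n=\min\{k\ge0\mid x_k\in[S_n]\}$, and let $\nu_{[n]}$ be the distribution of $x_{\tau_n}$. Then: (1) $\displaystyle\lim_{n\to\infty}-\frac1n\log\nu_{[n]}(x_{\tau_n})=\hat h$, $\mathbb{P}$-almost surely. (2) For every $a>0$, $\displaystyle\lim_{n\to\infty}\nu_{[n]}\Big(\big\{x\in[S_n]\ \big|\ e^{-n(\hat h+a)}\le\nu_{[n]}(x)\le e^{-n(\hat h-a)}\big\}\Big)=1$. (3) For every $a\in(0,1)$, let $K_n(a)$ be the minimal number of points which form a set of $\nu_{[n]}$-measure at least $a$. Then $\displaystyle\lim_{n\to\infty}\frac1n\log K_n(a)=\hat h$.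
   Context: $\Gamma$ is a finitely generated group, hyperbolic in the sense of Gromov and non-elementary (hence non-amenable). Fix a finite symmetric generating set; $|x|$ is the word length, $d(x,y)=|x^{-1}y|$ the word metric, $S_n$ the set of elements of word length exactly $n$. $\mu$ is admissible if its support generates $\Gamma$ as a semigroup; $\mu$ is not assumed symmetric. The random walk is $x_0=1$, $x_n=X_1\cdots X_n$, with $X_i$ independent of law $\mu$, and $\mathbb{P}$ is its law on path space; $\mu^{*n}$ is the law of $x_n$. The entropy and drift are $h=\lim_{n}-\frac1n\sum_{x}\mu^{*n}(x)\log\mu^{*n}(x)$ and $l=\lim_n\frac1n\sum_x|x|\mu^{*n}(x)$ (here $l>0$). $r$ denotes the diameter of the support of $\mu$, and $[S_n]$ denotes the $r$-neighbourhood of the sphere $S_n$ in $\Gamma$ (the annulus). The paper's standing convention is that $\tau_n$ is $\mathbb{P}$-a.s. finite (the walk is transient and the annulus is thick enough for the range of the step), so $\nu_{[n]}$ is a probability measure supported on $[S_n]$. *)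

theory Defs
  imports "HOL-Probability.Probability" "HOL-Algebra.Coset" "HOL-Algebra.Generated_Groups"
begin

section \<open>Word metrics and hyperbolic groups\<close>

definition sym_generating_set :: "('a, 'b) monoid_scheme \<Rightarrow> 'a set \<Rightarrow> bool" where
  "sym_generating_set G S \<longleftrightarrow>
     finite S \<and> S \<subseteq> carrier G \<and> (\<forall>s\<in>S. inv\<^bsub>G\<^esub> s \<in> S) \<and> generate G S = carrier G"

definition word_prod :: "('a, 'b) monoid_scheme \<Rightarrow> 'a list \<Rightarrow> 'a" where
  "word_prod G ws = foldr (mult G) ws (one G)"

definition word_length :: "('a, 'b) monoid_scheme \<Rightarrow> 'a set \<Rightarrow> 'a \<Rightarrow> nat" where
  "word_length G S x = (LEAST n. \<exists>ws. set ws \<subseteq> S \<and> length ws = n \<and> word_prod G ws = x)"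

definition word_dist :: "('a, 'b) monoid_scheme \<Rightarrow> 'a set \<Rightarrow> 'a \<Rightarrow> 'a \<Rightarrow> nat" where
  "word_dist G S x y = word_length G S (inv\<^bsub>G\<^esub> x \<otimes>\<^bsub>G\<^esub> y)"

definition gromov_product :: "('a, 'b) monoid_scheme \<Rightarrow> 'a set \<Rightarrow> 'a \<Rightarrow> 'a \<Rightarrow> 'a \<Rightarrow> real" where
  "gromov_product G S w x y =
     (real (word_dist G S w x) + real (word_dist G S w y) - real (word_dist G S x y)) / 2"

definition hyperbolic_group :: "('a, 'b) monoid_scheme \<Rightarrow> bool" where
  "hyperbolic_group G \<longleftrightarrow> group G \<and>
     (\<exists>S. sym_generating_set G S \<and>
       (\<exists>\<delta>\<ge>0. \<forall>w\<in>carrier G. \<forall>x\<in>carrier G. \<forall>y\<in>carrier G. \<forall>z\<in>carrier G.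
          gromov_product G S w x z
            \<ge> min (gromov_product G S w x y) (gromov_product G S w y z) - \<delta>))"

text \<open>Elementary means virtually cyclic; finite groups are included, via the trivial subgroup.\<close>

definition elementary_group :: "('a, 'b) monoid_scheme \<Rightarrow> bool" where
  "elementary_group G \<longleftrightarrow> (\<exists>g\<in>carrier G. finite (rcosets\<^bsub>G\<^esub> (generate G {g})))"

section \<open>Random walks\<close>

definition admissible :: "('a, 'b) monoid_scheme \<Rightarrow> 'a pmf \<Rightarrow> bool" where
  "admissible G \<mu> \<longleftrightarrow> set_pmf \<mu> \<subseteq> carrier G \<and>
     (\<forall>x\<in>carrier G. \<exists>ws. ws \<noteq> [] \<and> set ws \<subseteq> set_pmf \<mu> \<and> word_prod G ws = x)"

text \<open>The increments are indexed from 0, so \<open>walk G X n\<close> is the product of the first \<open>n\<close> increments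
  \<open>X 0, \<dots>, X (n - 1)\<close>.\<close>

definition walk :: "('a, 'b) monoid_scheme \<Rightarrow> (nat \<Rightarrow> 'a) \<Rightarrow> nat \<Rightarrow> 'a" where
  "walk G X n = word_prod G (map X [0..<n])"

text \<open>The law of the walk on path space.  The increments are restricted to \<open>carrier G\<close>, which is
  countable for a finitely generated group: on an uncountable ambient type, multiplication need not
  be measurable for the product of the discrete sigma-algebras.\<close>

definition walk_measure :: "('a, 'b) monoid_scheme \<Rightarrow> 'a pmf \<Rightarrow> (nat \<Rightarrow> 'a) measure" where
  "walk_measure G \<mu> =
     distr (\<Pi>\<^sub>M i\<in>UNIV. restrict_space (measure_pmf \<mu>) (carrier G))
           (\<Pi>\<^sub>M i\<in>UNIV. count_space (carrier G))
           (walk G)"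

text \<open>The law of \<open>x\<^sub>n\<close>, that is, the \<open>n\<close>-fold convolution power of \<open>\<mu>\<close>.\<close>

definition walk_law :: "('a, 'b) monoid_scheme \<Rightarrow> 'a pmf \<Rightarrow> nat \<Rightarrow> 'a \<Rightarrow> real" where
  "walk_law G \<mu> n x = measure (walk_measure G \<mu>) {p \<in> space (walk_measure G \<mu>). p n = x}"

definition walk_entropy :: "('a, 'b) monoid_scheme \<Rightarrow> 'a pmf \<Rightarrow> real" where
  "walk_entropy G \<mu> =
     lim (\<lambda>n. - (1 / real n) * (\<Sum>\<^sub>\<infinity>x\<in>carrier G. walk_law G \<mu> n x * ln (walk_law G \<mu> n x)))"

definition walk_drift :: "('a, 'b) monoid_scheme \<Rightarrow> 'a set \<Rightarrow> 'a pmf \<Rightarrow> real" where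
  "walk_drift G S \<mu> =
     lim (\<lambda>n. 1 / real n * (\<Sum>\<^sub>\<infinity>x\<in>carrier G. real (word_length G S x) * walk_law G \<mu> n x))"

section \<open>Hitting distributions of annuli\<close>

definition sphere_in_group :: "('a, 'b) monoid_scheme \<Rightarrow> 'a set \<Rightarrow> nat \<Rightarrow> 'a set" where
  "sphere_in_group G S n = {x \<in> carrier G. word_length G S x = n}"

definition support_diameter :: "('a, 'b) monoid_scheme \<Rightarrow> 'a set \<Rightarrow> 'a pmf \<Rightarrow> nat" where
  "support_diameter G S \<mu> = Max {word_dist G S x y | x y. x \<in> set_pmf \<mu> \<and> y \<in> set_pmf \<mu>}"

definition annulus :: "('a, 'b) monoid_scheme \<Rightarrow> 'a set \<Rightarrow> 'a pmf \<Rightarrow> nat \<Rightarrow> 'a set" where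
  "annulus G S \<mu> n =
     {x \<in> carrier G. \<exists>y\<in>sphere_in_group G S n. word_dist G S x y \<le> support_diameter G S \<mu>}"

text \<open>For a path which never meets the annulus, the hitting time has an arbitrary value.\<close>

definition hitting_time :: "('a, 'b) monoid_scheme \<Rightarrow> 'a set \<Rightarrow> 'a pmf \<Rightarrow> nat \<Rightarrow> (nat \<Rightarrow> 'a) \<Rightarrow> nat" where
  "hitting_time G S \<mu> n p = (LEAST k. p k \<in> annulus G S \<mu> n)"

definition hitting_measure :: "('a, 'b) monoid_scheme \<Rightarrow> 'a set \<Rightarrow> 'a pmf \<Rightarrow> nat \<Rightarrow> 'a measure" where
  "hitting_measure G S \<mu> n =
     distr (walk_measure G \<mu>) (count_space (carrier G)) (\<lambda>p. p (hitting_time G S \<mu> n p))"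

definition min_points :: "('a, 'b) monoid_scheme \<Rightarrow> 'a set \<Rightarrow> 'a pmf \<Rightarrow> nat \<Rightarrow> real \<Rightarrow> nat" where
  "min_points G S \<mu> n a =
     (LEAST k. \<exists>A\<subseteq>carrier G. finite A \<and> card A = k \<and> measure (hitting_measure G S \<mu> n) A \<ge> a)"

end

theory Submission
  imports Defs
begin

text \<open>
  Write \<open>u\<^sub>k\<close> for the law of \<open>x\<^sub>k\<close>, \<open>\<tau>\<close> for the hitting time of the \<open>n\<close>-th annulus, \<open>\<nu>\<^sub>n\<close> for the law of
  \<open>x\<^sub>\<tau>\<close>, and \<open>h\<close>, \<open>l\<close> for entropy and drift.

  The point \<open>x\<^sub>\<tau>\<close> is a sample of \<open>\<nu>\<^sub>n\<close>, and on the event \<open>\<tau> = k\<close> it is also the point \<open>x\<^sub>k\<close>, a sample of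
  \<open>u\<^sub>k\<close>.  A sample of a probability law \<open>P\<close> on a countable set falls with probability at most \<open>c\<close> into the
  set where the mass of \<open>P\<close> is below \<open>c\<close> times that of another law (\<open>prob_le_of_atoms\<close>).  Only
  linearly many values of \<open>\<tau>\<close> matter, so with \<open>c = exp (- \<epsilon> n)\<close> the Borel-Cantelli lemma shows that
  \<open>\<nu>\<^sub>n(x\<^sub>\<tau>)\<close> and \<open>u\<^sub>\<tau>(x\<^sub>\<tau>)\<close> eventually agree up to a factor \<open>exp (\<epsilon> n)\<close>, in both directions
  (\<open>hitting_mass_comparable\<close>).  Hence \<open>- (1/n) ln \<nu>\<^sub>n(x\<^sub>\<tau>)\<close> has the same limit as
  \<open>(\<tau>/n) * (- (1/\<tau>) ln u\<^sub>\<tau>(x\<^sub>\<tau>))\<close>.  The second factor tends to \<open>h\<close>.  The first tends to \<open>1/l\<close>,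
  because \<open>|x\<^sub>\<tau>|\<close> differs from \<open>n\<close> by a bounded amount and \<open>|x\<^sub>k| / k\<close> tends to \<open>l > 0\<close>
  (\<open>hitting_time_asymptotics\<close>).  This is (1).  Statement (2) is (1) in
  probability, and (3) follows from (2) by counting atoms of comparable mass.

  The almost sure limits of \<open>|x\<^sub>k| / k\<close> and of \<open>- (1/k) ln u\<^sub>k(x\<^sub>k)\<close> are instances of the subadditive ergodic
  theorem on the space of increments: lengths are subadditive, and
  \<open>u\<^sub>m\<^sub>+\<^sub>k(x y) \<ge> u\<^sub>m(x) u\<^sub>k(y)\<close>.  For processes between \<open>0\<close> and \<open>C k\<close> the theorem
  (\<open>subadditive_ergodic\<close>) is proved by a covering argument for the lower limit.  The upper limit comes from
  the same argument, applied to a complementary additive process.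

  Hyperbolicity is used for \<open>l > 0\<close>.  A finitely generated group that is not virtually cyclic has
  superlinear growth (\<open>superlinear_growth\<close>).  Seen from its median, at least a third of a large ball
  \<open>Y\<close> lies away from any given direction, so from every \<open>x\<close> at least a third of the steps
  \<open>x \<mapsto> x y\<close> essentially lead away from the identity; and \<open>x\<close> is determined by its endpoint \<open>x y\<close> and
  the length of \<open>y\<close>, up to bounded ambiguity.  By superlinear growth many steps leave each point while
  comparatively few arrive (\<open>branching_map\<close>), which gives an isoperimetric inequality in
  \<open>L\<^sup>2\<close> (\<open>l2_expansion\<close>).  It forces the convolution powers of a suitable average of the powers of \<open>\<mu>\<close> to decay
  exponentially at every point (\<open>conv_pow_decay\<close>), so that this averaged walk leaves balls of linear radius, and
  therefore so does the original one (\<open>drift_not_sublinear\<close>).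
\<close>

section \<open>Words with linearly few factors\<close>

text \<open>
  Koenig's lemma: keep to those prefixes that have arbitrarily long continuations in the language.
  As the alphabet is finite, such a prefix always extends by one letter to another one.
\<close>

lemma infinite_word_of_language:
  fixes P :: "'c list \<Rightarrow> bool"
  assumes "finite A" and alph: "\<And>w. P w \<Longrightarrow> set w \<subseteq> A"
    and pref: "\<And>u v. P (u @ v) \<Longrightarrow> P u"
    and long: "\<And>n. \<exists>w. P w \<and> length w \<ge> n"
  shows "\<exists>s. \<forall>n. P (map s [0..<n])"
proof -
  define E where "E u \<longleftrightarrow> (\<forall>n. \<exists>v. P (u @ v) \<and> length v \<ge> n)" for u
  have E_nil: "E []" using long by (simp add: E_def)
  have E_step: "\<exists>a. E (u @ [a])" if "E u" for u
  proof (rule ccontr)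
    assume "\<not> ?thesis"
    then have "\<forall>a. \<exists>n. \<forall>v. P (u @ [a] @ v) \<longrightarrow> length v < n"
      by (auto simp: E_def not_le)
    then obtain n where n: "\<And>a v. P (u @ [a] @ v) \<Longrightarrow> length v < n a" by metis
    from \<open>E u\<close> obtain v where v: "P (u @ v)" "length v \<ge> Suc (\<Sum>a\<in>A. n a)"
      unfolding E_def by blast
    then obtain a v' where av: "v = a # v'" by (cases v) auto
    have "a \<in> A" using alph[OF v(1)] av by auto
    then have "n a \<le> (\<Sum>a\<in>A. n a)" using \<open>finite A\<close> by (simp add: member_le_sum)
    moreover have "length v' < n a" using n[of a v'] v(1) av by simp
    ultimately show False using v(2) av by simp
  qed
  define w where "w = rec_nat [] (\<lambda>_ u. u @ [SOME a. E (u @ [a])])"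
  define s where "s n = (SOME a. E (w n @ [a]))" for n
  have w: "w 0 = []" "w (Suc n) = w n @ [s n]" for n
    by (auto simp: w_def s_def)
  have "E (w n)" for n
  proof (induction n)
    case (Suc n)
    then show ?case using someI_ex[OF E_step[OF Suc]] by (simp add: w s_def)
  qed (simp add: w E_nil)
  moreover have "w n = map s [0..<n]" for n by (induction n) (auto simp: w)
  ultimately have "P (map s [0..<n])" for n
    unfolding E_def by (metis pref)
  then show ?thesis by blast
qed

text \<open>
  The theorem of Morse and Hedlund.  The number of factors of length \<open>j\<close> cannot grow strictly with
  \<open>j\<close> all the way up to \<open>n\<close>, so for some \<open>j\<close> each factor of length \<open>j\<close> determines the next letter;
  two occurrences of one factor then continue identically for ever.
\<close>

lemma few_factors_eventually_periodic:
  fixes s :: "nat \<Rightarrow> 'c"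
  assumes "finite (range s)" and few: "card (range (\<lambda>i. map s [i..<i+n])) \<le> n"
  shows "\<exists>p>0. \<exists>i0. \<forall>i\<ge>i0. s (i + p) = s i"
proof -
  define F where "F j = range (\<lambda>i. map s [i..<i+j])" for j
  have finF: "finite (F j)" for j
  proof (rule finite_subset)
    show "F j \<subseteq> {w. set w \<subseteq> range s \<and> length w = j}" by (auto simp: F_def)
    show "finite {w. set w \<subseteq> range s \<and> length w = j}"
      using assms(1) by (rule finite_lists_length_eq)
  qed
  have "\<exists>j. card (F (Suc j)) \<le> card (F j)"
  proof (rule ccontr)
    assume a: "\<not> ?thesis"
    have "j < card (F j)" for j
    proof (induction j)
      case 0
      then show ?case by (simp add: F_def)
    next
      case (Suc j)
      then show ?case using a by (metis Suc_leI le_less_trans not_le)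
    qed
    from this[of n] few show False by (simp add: F_def)
  qed
  then obtain j where j: "card (F (Suc j)) \<le> card (F j)" by blast
  \<comment> \<open>Truncation maps the longer factors onto the shorter ones; with no more of the former than of the
    latter it is injective, and the last letter is a function of the others.\<close>
  have img: "butlast ` F (Suc j) = F j"
    unfolding F_def image_image by (rule image_cong) auto
  have inj: "inj_on butlast (F (Suc j))"
    by (rule eq_card_imp_inj_on[OF finF]) (use j img card_image_le[OF finF] in \<open>metis le_antisym\<close>)
  have next_eq: "map s [i..<i + Suc j] = map s [i'..<i' + Suc j]"
    if "map s [i..<i+j] = map s [i'..<i'+j]" for i i'
  proof -
    have "butlast (map s [i..<i + Suc j]) = butlast (map s [i'..<i' + Suc j])"
      using that by simp
    moreover have "map s [k..<k + Suc j] \<in> F (Suc j)" for k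
      unfolding F_def by (rule rangeI)
    ultimately show ?thesis using inj_onD[OF inj] by blast
  qed
  obtain i i' where ii: "i < i'" "map s [i..<i+j] = map s [i'..<i'+j]"
  proof -
    have "\<not> inj (\<lambda>i. map s [i..<i+j])"
      using finF[of j] unfolding F_def by (metis finite_imageD infinite_UNIV_nat)
    then show ?thesis using that unfolding inj_def by (metis linorder_neqE_nat)
  qed
  have shift: "map s [Suc k..<Suc k + l] = tl (map s [k..<k + Suc l])" for k l
    by (subst upt_conv_Cons[of k]) auto
  have win: "map s [i+k..<i+k+j] = map s [i'+k..<i'+k+j]" for k
  proof (induction k)
    case 0 then show ?case using ii by simp
  next
    case (Suc k)
    show ?case using next_eq[OF Suc] shift[of "i+k" j] shift[of "i'+k" j] by simp
  qed
  have eq: "s (i + k + j) = s (i' + k + j)" for k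
  proof -
    have "last (map s [i+k..<i+k+Suc j]) = last (map s [i'+k..<i'+k+Suc j])"
      using next_eq[OF win[of k]] by simp
    then show ?thesis by simp
  qed
  have "\<forall>m\<ge>i + j. s (m + (i' - i)) = s m"
  proof (intro allI impI)
    fix m assume "i + j \<le> m"
    then obtain k where m: "m = i + k + j" by (metis add.assoc add.commute le_iff_add)
    then have "m + (i' - i) = i' + k + j" using ii(1) by simp
    then have "s (m + (i' - i)) = s (i' + k + j)" by (rule arg_cong)
    then show "s (m + (i' - i)) = s m" using eq[of k] m by (simp only:)
  qed
  moreover have "i' - i > 0" using ii(1) by simp
  ultimately show ?thesis by blast
qed

section \<open>The word metric\<close>

locale word_metric = group G for G (structure) +
  fixes S :: "'a set"
  assumes gen: "sym_generating_set G S"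
begin

abbreviation len :: "'a \<Rightarrow> nat" where "len \<equiv> word_length G S"

definition gball :: "nat \<Rightarrow> 'a set" where "gball n = {x \<in> carrier G. len x \<le> n}"

lemma finite_S: "finite S" and S_sub: "S \<subseteq> carrier G" and S_inv: "s \<in> S \<Longrightarrow> inv s \<in> S"
  and S_gen: "generate G S = carrier G"
  using gen by (auto simp: sym_generating_set_def)

lemma word_prod_Nil [simp]: "word_prod G [] = \<one>"
  and word_prod_Cons [simp]: "word_prod G (a # w) = a \<otimes> word_prod G w"
  by (simp_all add: word_prod_def)

lemma word_prod_closed [simp]: "set w \<subseteq> carrier G \<Longrightarrow> word_prod G w \<in> carrier G"
  by (induction w) auto

lemma word_prod_append:
  "set u \<subseteq> carrier G \<Longrightarrow> set v \<subseteq> carrier G \<Longrightarrow> word_prod G (u @ v) = word_prod G u \<otimes> word_prod G v"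
  by (induction u) (auto simp: m_assoc)

lemma word_prod_rev_inv:
  "set w \<subseteq> carrier G \<Longrightarrow> word_prod G (rev (map (m_inv G) w)) = inv (word_prod G w)"
proof (induction w)
  case (Cons a w)
  have "set (rev (map (m_inv G) w)) \<subseteq> carrier G" using Cons.prems by auto
  then show ?case
    using Cons word_prod_append[of "rev (map (m_inv G) w)" "[inv a]"] by (simp add: inv_mult_group)
qed simp

lemma exists_word:
  assumes "x \<in> carrier G" shows "\<exists>w. set w \<subseteq> S \<and> word_prod G w = x"
proof -
  have "x \<in> generate G S" using assms S_gen by simp
  then show ?thesis
  proof (induction rule: generate.induct)
    case one
    then show ?case by (intro exI[of _ "[]"]) auto
  next
    case (incl h)
    then show ?case using S_sub by (intro exI[of _ "[h]"]) auto
  next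
    case (inv h)
    then show ?case using S_sub S_inv by (intro exI[of _ "[inv h]"]) auto
  next
    case (eng h1 h2)
    then obtain u v where "set u \<subseteq> S" "word_prod G u = h1" "set v \<subseteq> S" "word_prod G v = h2" by blast
    then show ?case using S_sub
      by (intro exI[of _ "u @ v"]) (auto simp: word_prod_append dest!: subset_trans)
  qed
qed

lemma len_word_le: "set w \<subseteq> S \<Longrightarrow> len (word_prod G w) \<le> length w"
  unfolding word_length_def by (rule Least_le) blast

lemma len_word:
  assumes "x \<in> carrier G" shows "\<exists>w. set w \<subseteq> S \<and> length w = len x \<and> word_prod G w = x"
proof -
  from exists_word[OF assms] obtain w where "set w \<subseteq> S" "word_prod G w = x" by blast
  then have "\<exists>n ws. set ws \<subseteq> S \<and> length ws = n \<and> word_prod G ws = x" by blast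
  from LeastI_ex[OF this] show ?thesis unfolding word_length_def .
qed

lemma len_one [simp]: "len \<one> = 0"
  using len_word_le[of "[]"] by simp

lemma len_eq_0: "x \<in> carrier G \<Longrightarrow> len x = 0 \<longleftrightarrow> x = \<one>"
  using len_word[of x] by auto

lemma len_mult: "x \<in> carrier G \<Longrightarrow> y \<in> carrier G \<Longrightarrow> len (x \<otimes> y) \<le> len x + len y"
proof -
  assume "x \<in> carrier G" "y \<in> carrier G"
  then obtain u v where "set u \<subseteq> S" "length u = len x" "word_prod G u = x"
      "set v \<subseteq> S" "length v = len y" "word_prod G v = y" using len_word by metis
  then show ?thesis using len_word_le[of "u @ v"] S_sub by (auto simp: word_prod_append dest!: subset_trans)
qed

lemma len_inv_le: "x \<in> carrier G \<Longrightarrow> len (inv x) \<le> len x"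
proof -
  assume "x \<in> carrier G"
  then obtain u where u: "set u \<subseteq> S" "length u = len x" "word_prod G u = x" using len_word by metis
  have "set (rev (map (m_inv G) u)) \<subseteq> S" using u(1) S_inv by auto
  from len_word_le[OF this] show ?thesis
    using u S_sub by (subst (asm) word_prod_rev_inv) auto
qed

lemma len_inv [simp]: "x \<in> carrier G \<Longrightarrow> len (inv x) = len x"
  using len_inv_le[of x] len_inv_le[of "inv x"] by auto

text \<open>
  A geodesic word can be cut anywhere.
\<close>

lemma len_split:
  assumes "x \<in> carrier G" "k \<le> len x"
  shows "\<exists>u\<in>carrier G. \<exists>v\<in>carrier G. x = u \<otimes> v \<and> len u = k \<and> len v = len x - k"
proof -
  from len_word[OF assms(1)] obtain w where w: "set w \<subseteq> S" "length w = len x" "word_prod G w = x" by blast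
  define u v where "u = word_prod G (take k w)" and "v = word_prod G (drop k w)"
  have sub: "set (take k w) \<subseteq> S" "set (drop k w) \<subseteq> S"
    using w(1) set_take_subset set_drop_subset by fast+
  have uv: "u \<in> carrier G" "v \<in> carrier G" using sub S_sub by (auto simp: u_def v_def)
  have x: "x = u \<otimes> v"
    using word_prod_append[of "take k w" "drop k w"] sub S_sub w(3) by (auto simp: u_def v_def)
  have "len u \<le> k" "len v \<le> len x - k"
    using len_word_le[OF sub(1)] len_word_le[OF sub(2)] w(2) assms(2) by (auto simp: u_def v_def)
  moreover have "len x \<le> len u + len v" using len_mult[OF uv] x by simp
  ultimately show ?thesis using uv x assms(2) by (intro bexI[of _ u] bexI[of _ v]) auto
qed

lemma finite_gball: "finite (gball n)"
proof (rule finite_surj)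
  show "finite {w. set w \<subseteq> S \<and> length w \<le> n}" using finite_S by (rule finite_lists_length_le)
  show "gball n \<subseteq> word_prod G ` {w. set w \<subseteq> S \<and> length w \<le> n}"
    using len_word by (fastforce simp: gball_def)
qed

lemma card_gball_le: "card (gball n) \<le> (Suc (card S)) ^ n"
proof (induction n)
  case 0
  have "gball 0 = {\<one>}" using len_eq_0 by (auto simp: gball_def)
  then show ?case by simp
next
  case (Suc n)
  have "gball (Suc n) \<subseteq> (\<lambda>(x,s). x \<otimes> s) ` (gball n \<times> insert \<one> S)"
  proof
    fix x assume x: "x \<in> gball (Suc n)"
    show "x \<in> (\<lambda>(x,s). x \<otimes> s) ` (gball n \<times> insert \<one> S)"
    proof (cases "len x \<le> n")
      case True
      then show ?thesis using x by (intro image_eqI[of _ _ "(x,\<one>)"]) (auto simp: gball_def)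
    next
      case False
      then have l: "len x = Suc n" using x by (auto simp: gball_def)
      with x obtain u v where uv: "u \<in> carrier G" "v \<in> carrier G" "x = u \<otimes> v" "len u = n" "len v = 1"
        using len_split[of x n] by (auto simp: gball_def)
      from len_word[OF uv(2)] uv(5) obtain w where w: "set w \<subseteq> S" "length w = 1" "word_prod G w = v" by metis
      then have "v \<in> S" using S_sub by (cases w) auto
      then show ?thesis using uv by (intro image_eqI[of _ _ "(u,v)"]) (auto simp: gball_def)
    qed
  qed
  then have "card (gball (Suc n)) \<le> card (gball n \<times> insert \<one> S)"
    using finite_gball finite_S by (meson card_image_le card_mono finite.insertI finite_SigmaI finite_imageI le_trans)
  also have "\<dots> \<le> (Suc (card S)) ^ n * Suc (card S)"
    unfolding card_cartesian_product using Suc card_insert_le_m1 finite_S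
    by (intro mult_le_mono) (auto simp: card_insert_if)
  finally show ?case by (simp add: mult.commute)
qed

section \<open>Superlinear growth\<close>

text \<open>
  Every element is represented by exactly one shortlex-minimal word, and the minimal words form a
  factor-closed language, so Koenig's lemma gives an infinite word all of whose factors are minimal.
  If there are at most \<open>n\<close> minimal words of length \<open>n\<close> for some \<open>n\<close>, this word is eventually
  periodic; its period has infinite order, since minimal words of positive length do not represent the
  identity.  Otherwise there are more than \<open>n\<close> minimal words of each length \<open>n\<close>, and balls grow
  quadratically.
\<close>

lemma exists_infinite_order_or_quadratic:
  assumes inf: "infinite (carrier G)"
  shows "(\<exists>v\<in>carrier G. \<forall>k>0. v [^] (k::nat) \<noteq> \<one>) \<or> (\<forall>n. n * n \<le> 2 * card (gball n))"
proof -
  obtain e where e: "bij_betw e {0..<card S} S" using ex_bij_betw_nat_finite[OF finite_S] by blast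
  define A where "A = {0..<card S}"
  define ev where "ev w = word_prod G (map e w)" for w
  define SL where "SL w \<longleftrightarrow> set w \<subseteq> A \<and>
      (\<forall>w'. set w' \<subseteq> A \<and> ev w' = ev w \<longrightarrow> w' = w \<or> (w, w') \<in> lenlex less_than)" for w
  have eA: "e ` A = S" using e by (simp add: A_def bij_betw_def)
  have mapS: "set (map e w) \<subseteq> S" "set (map e w) \<subseteq> carrier G" if "set w \<subseteq> A" for w
    using that eA S_sub by auto
  have ev_append: "ev (u @ v) = ev u \<otimes> ev v" if "set u \<subseteq> A" "set v \<subseteq> A" for u v
    using mapS(2)[OF that(1)] mapS(2)[OF that(2)] by (simp add: ev_def word_prod_append)
  have ev_closed: "ev w \<in> carrier G" if "set w \<subseteq> A" for w
    using mapS(2)[OF that] by (simp add: ev_def)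
  have irr: "(w, w) \<notin> lenlex less_than" for w :: "nat list"
    by (rule lenlex_irreflexive) auto
  have asy: "(w, w') \<in> lenlex less_than \<Longrightarrow> (w', w) \<notin> lenlex less_than" for w w' :: "nat list"
    using lenlex_trans[of w w' less_than w] irr[of w] trans_less_than by blast
  have tot: "w = w' \<or> (w, w') \<in> lenlex less_than \<or> (w', w) \<in> lenlex less_than" for w w' :: "nat list"
    using total_lenlex[OF total_less_than] by (auto simp: total_on_def)
  have SL_ex: "\<exists>w. SL w \<and> ev w = x" if "x \<in> carrier G" for x
  proof -
    from exists_word[OF that] obtain u where u: "set u \<subseteq> S" "word_prod G u = x" by blast
    define w where "w = map (inv_into A e) u"
    have inA: "a \<in> e ` A" if "a \<in> set u" for a using that u(1) eA by blast
    have "set w \<subseteq> A" unfolding w_def using inv_into_into[OF inA] by auto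
    moreover have "map e w = u"
      unfolding w_def map_map by (rule map_idI) (simp add: f_inv_into_f[OF inA])
    ultimately have wQ: "w \<in> {w. set w \<subseteq> A \<and> ev w = x}" using u by (simp add: ev_def)
    obtain z where z: "z \<in> {w. set w \<subseteq> A \<and> ev w = x}"
        "\<And>y. (y, z) \<in> lenlex less_than \<Longrightarrow> y \<notin> {w. set w \<subseteq> A \<and> ev w = x}"
      by (rule wfE_min[OF wf_lenlex[OF wf_less_than] wQ]) blast
    then have "SL z" unfolding SL_def using tot by blast
    with z show ?thesis by blast
  qed
  have SL_inj: "w = w'" if "SL w" "SL w'" "ev w = ev w'" for w w'
    using that asy unfolding SL_def by metis
  \<comment> \<open>A smaller representative of the factor would give a smaller representative of the whole word.\<close>
  have SL_factor: "SL w" if "SL (a @ w @ b)" for a w b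
    unfolding SL_def
  proof (intro conjI allI impI)
    from that have sub: "set a \<subseteq> A" "set w \<subseteq> A" "set b \<subseteq> A" by (auto simp: SL_def)
    then show "set w \<subseteq> A" by simp
    fix w' assume w': "set w' \<subseteq> A \<and> ev w' = ev w"
    have "ev (a @ w' @ b) = ev (a @ w @ b)"
      using sub w' by (simp add: ev_append)
    moreover have "set (a @ w' @ b) \<subseteq> A" using sub w' by auto
    ultimately have "a @ w' @ b = a @ w @ b \<or> (a @ w @ b, a @ w' @ b) \<in> lenlex less_than"
      using that unfolding SL_def by blast
    moreover have "(a @ w' @ b, a @ w @ b) \<in> lenlex less_than" if "(w', w) \<in> lenlex less_than"
      using lenlex_append1[OF that refl] by (simp add: irrefl_def)
    ultimately show "w' = w \<or> (w, w') \<in> lenlex less_than"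
      using tot[of w w'] asy by auto
  qed
  have SL_ball: "ev ` {w. SL w \<and> length w \<le> n} \<subseteq> gball n" for n
  proof clarify
    fix w assume "SL w" "length w \<le> n"
    then have "set w \<subseteq> A" by (simp add: SL_def)
    then show "ev w \<in> gball n"
      using len_word_le[OF mapS(1)] ev_closed \<open>length w \<le> n\<close>
      unfolding gball_def ev_def by fastforce
  qed
  have finSL: "finite {w. SL w \<and> length w \<le> n}" for n
    by (rule finite_subset[OF _ finite_lists_length_le[of A n]]) (auto simp: SL_def A_def)
  have long: "\<exists>w. SL w \<and> length w \<ge> n" for n
  proof (rule ccontr)
    assume "\<not> ?thesis"
    then have "length w \<le> n" if "SL w" for w using that nat_le_linear by blast
    then have "carrier G \<subseteq> ev ` {w. SL w \<and> length w \<le> n}" using SL_ex by blast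
    then show False using inf finSL finite_surj by blast
  qed
  show ?thesis
  proof (cases "\<exists>n. card {w. SL w \<and> length w = n} \<le> n")
    case True
    then obtain n where n: "card {w. SL w \<and> length w = n} \<le> n" by blast
    have "\<exists>s. \<forall>n. SL (map s [0..<n])"
    proof (rule infinite_word_of_language[where A = A])
      show "SL u" if "SL (u @ v)" for u v using SL_factor[of "[]" u v] that by simp
    qed (use long in \<open>auto simp: A_def SL_def\<close>)
    then obtain s where s: "\<And>n. SL (map s [0..<n])" by blast
    have sij: "SL (map s [i..<j])" if "i \<le> j" for i j
    proof -
      have "map s [0..<j] = map s [0..<i] @ map s [i..<j] @ []"
        using upt_add_eq_append[of 0 i "j - i"] that by simp
      with s[of j] SL_factor show ?thesis by metis
    qed
    have "range s \<subseteq> A"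
    proof
      fix a assume "a \<in> range s"
      then obtain i where "a = s i" by blast
      then show "a \<in> A" using sij[of i "Suc i"] by (simp add: SL_def)
    qed
    then have fin: "finite (range s)" by (rule finite_subset) (simp add: A_def)
    have "card (range (\<lambda>i. map s [i..<i+n])) \<le> card {w. SL w \<and> length w = n}"
    proof (rule card_mono)
      show "finite {w. SL w \<and> length w = n}" by (rule finite_subset[OF _ finSL[of n]]) auto
    qed (use sij in auto)
    with n have "card (range (\<lambda>i. map s [i..<i+n])) \<le> n" by simp
    from few_factors_eventually_periodic[OF fin this] obtain p i0 where
      p: "p > 0" "\<And>i. i \<ge> i0 \<Longrightarrow> s (i + p) = s i" by blast
    have per: "s (i + k * p) = s i" if "i \<ge> i0" for i k
    proof (induction k)
      case (Suc k)
      have "s (i + Suc k * p) = s ((i + k * p) + p)" by (simp add: algebra_simps)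
      also have "\<dots> = s (i + k * p)" using that by (intro p(2)) simp
      finally show ?case using Suc by simp
    qed simp
    define v where "v = ev (map s [i0..<i0+p])"
    have setA: "set (map s [i..<j]) \<subseteq> A" for i j using \<open>range s \<subseteq> A\<close> by auto
    have v: "v \<in> carrier G" unfolding v_def by (rule ev_closed[OF setA])
    \<comment> \<open>Powers of the period are read off from longer and longer minimal words.\<close>
    have pow: "ev (map s [i0..<i0 + k * p]) = v [^] k" for k :: nat
    proof (induction k)
      case 0 then show ?case by (simp add: ev_def)
    next
      case (Suc k)
      have "map s [i0 + k * p..<i0 + k * p + p] = map s [i0..<i0+p]"
      proof (rule nth_equalityI)
        fix q assume "q < length (map s [i0 + k * p..<i0 + k * p + p])"
        then have "q < p" by simp
        moreover have "s (i0 + k * p + q) = s (i0 + q)"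
          using per[of "i0 + q" k] by (simp add: ac_simps)
        ultimately show "map s [i0 + k * p..<i0 + k * p + p] ! q = map s [i0..<i0+p] ! q" by simp
      qed simp
      moreover have "[i0..<i0 + Suc k * p] = [i0..<i0 + k * p] @ [i0 + k * p..<i0 + k * p + p]"
        using upt_add_eq_append[of i0 "i0 + k * p" p] by (simp add: algebra_simps)
      ultimately have "ev (map s [i0..<i0 + Suc k * p]) = ev (map s [i0..<i0 + k * p]) \<otimes> v"
        using ev_append[OF setA setA] by (simp add: v_def)
      then show ?case using Suc by simp
    qed
    have "v [^] k \<noteq> \<one>" if "k > 0" for k :: nat
    proof
      assume "v [^] k = \<one>"
      then have "ev [] = ev (map s [i0..<i0 + k * p])" using pow by (simp add: ev_def)
      moreover have "SL (map s [i0..<i0 + k * p])" by (rule sij) simp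
      ultimately have "[] = map s [i0..<i0 + k * p] \<or> (map s [i0..<i0 + k * p], []) \<in> lenlex less_than"
        unfolding SL_def by (metis empty_set empty_subsetI)
      then show False using that p(1) by simp
    qed
    then show ?thesis using v by blast
  next
    case False
    then have F: "n < card {w. SL w \<and> length w = n}" for n by (simp add: not_le)
    have "n * n \<le> 2 * card (gball n)" for n
    proof -
      have "n * n \<le> 2 * (\<Sum>j\<le>n. Suc j)" by (induction n) auto
      also have "(\<Sum>j\<le>n. Suc j) \<le> (\<Sum>j\<le>n. card {w. SL w \<and> length w = j})"
        using F by (intro sum_mono) (simp add: Suc_leI)
      also have "\<dots> = card (\<Union>j\<in>{..n}. {w. SL w \<and> length w = j})"
        by (subst card_UN_disjoint) (auto intro: finite_subset[OF _ finSL])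
      also have "(\<Union>j\<in>{..n}. {w. SL w \<and> length w = j}) = {w. SL w \<and> length w \<le> n}" by auto
      also have "card \<dots> = card (ev ` {w. SL w \<and> length w \<le> n})"
        by (rule card_image[symmetric]) (use SL_inj in \<open>auto simp: inj_on_def\<close>)
      also have "\<dots> \<le> card (gball n)" by (rule card_mono[OF finite_gball SL_ball])
      finally show ?thesis by simp
    qed
    then show ?thesis by blast
  qed
qed

text \<open>
  The Schreier graph of the cosets of \<open>\<langle>v\<rangle>\<close> is infinite and connected, so its ball of radius \<open>R\<close>
  has more than \<open>R\<close> vertices.  Each of these cosets contributes the \<open>R + 1\<close> elements
  \<open>v\<^sup>i g\<close> with \<open>i \<le> R\<close>.
\<close>

lemma quadratic_growth_of_infinite_index:
  assumes v: "v \<in> carrier G" and ord: "\<And>k::nat. k > 0 \<Longrightarrow> v [^] k \<noteq> \<one>"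
    and inf: "infinite (rcosets (generate G {v}))"
  shows "(R + 1) * (R + 1) \<le> card (gball ((1 + len v) * R))"
proof -
  define H where "H = generate G {v}"
  have H: "subgroup H G" using v by (simp add: H_def generate_is_subgroup)
  have Hsub: "H \<subseteq> carrier G" using H subgroup.subset by blast
  define C where "C n = (\<lambda>g. H #> g) ` gball n" for n
  have finC: "finite (C n)" for n by (simp add: C_def finite_gball)
  have mono: "C n \<subseteq> C (Suc n)" for n by (auto simp: C_def gball_def)
  \<comment> \<open>If the ball in the coset graph stopped growing once, it would already be the whole graph.\<close>
  have strict: "C n \<noteq> C (Suc n)" for n
  proof
    assume eq: "C n = C (Suc n)"
    have "C (n + m) \<subseteq> C n" for m
    proof (induction m)
      case (Suc m)
      show ?case
      proof
        fix X assume "X \<in> C (n + Suc m)"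
        then obtain g where g: "g \<in> carrier G" "len g \<le> n + Suc m" "X = H #> g"
          by (auto simp: C_def gball_def)
        show "X \<in> C n"
        proof (cases "len g \<le> n + m")
          case True
          then have "X \<in> C (n + m)" using g by (auto simp: C_def gball_def)
          then show ?thesis using Suc by blast
        next
          case False
          then obtain a b where ab: "a \<in> carrier G" "b \<in> carrier G" "g = a \<otimes> b" "len a = n + m" "len b = 1"
            using len_split[of g "n + m"] g by (auto simp: le_Suc_eq)
          then have "H #> a \<in> C (n + m)" by (auto simp: C_def gball_def)
          then obtain a' where a': "a' \<in> carrier G" "len a' \<le> n" "H #> a = H #> a'"
            using Suc by (auto simp: C_def gball_def)
          have "X = H #> a #> b" using g ab Hsub by (simp add: coset_mult_assoc)
          also have "\<dots> = H #> (a' \<otimes> b)" using a' ab Hsub by (simp add: coset_mult_assoc)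
          also have "\<dots> \<in> C (Suc n)"
            using len_mult[of a' b] a' ab by (auto simp: C_def gball_def)
          finally show ?thesis using eq by simp
        qed
      qed
    qed simp
    then have "rcosets H \<subseteq> C n"
    proof -
      assume all: "\<And>m. C (n + m) \<subseteq> C n"
      show ?thesis
      proof
        fix X assume "X \<in> rcosets H"
        then obtain g where g: "g \<in> carrier G" "X = H #> g" by (auto simp: RCOSETS_def)
        then have "X \<in> C (n + len g)" by (auto simp: C_def gball_def)
        then show "X \<in> C n" using all by blast
      qed
    qed
    then show False using inf finC finite_subset unfolding H_def by blast
  qed
  have cardC: "R + 1 \<le> card (C R)"
  proof (induction R)
    case 0
    have "\<one> \<in> gball 0" by (simp add: gball_def)
    then have "C 0 \<noteq> {}" by (auto simp: C_def)
    then show ?case using finC by (simp add: Suc_le_eq card_gt_0_iff)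
  next
    case (Suc R)
    have "card (C R) < card (C (Suc R))"
      using mono strict finC by (intro psubset_card_mono) auto
    then show ?case using Suc by simp
  qed
  have "C R \<subseteq> (\<lambda>g. H #> g) ` gball R" by (simp add: C_def)
  then obtain X where X0: "X \<subseteq> gball R \<and> inj_on (\<lambda>g. H #> g) X \<and> C R = (\<lambda>g. H #> g) ` X"
    unfolding subset_image_inj by (rule exE)
  then have X: "X \<subseteq> gball R" "inj_on (\<lambda>g. H #> g) X" "(\<lambda>g. H #> g) ` X = C R" by simp_all
  have vinj: "i = j" if "v [^] i = v [^] j" for i j :: nat
  proof (rule ccontr)
    have *: False if "a < b" "v [^] a = v [^] b" for a b :: nat
    proof -
      have "v [^] b = v [^] a \<otimes> v [^] (b - a)" 
        using nat_pow_mult[OF v, of a "b - a"] that(1) by simp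
      then have "v [^] (b - a) = \<one>" using that(2) v by (metis l_cancel_one' nat_pow_closed)
      then show False using ord[of "b - a"] that(1) by simp
    qed
    assume "i \<noteq> j" then show False using *[of i j] *[of j i] that by (auto simp: neq_iff)
  qed
  have powlen: "len (v [^] i) \<le> i * len v" for i :: nat
  proof (induction i)
    case (Suc i)
    then show ?case using len_mult[of "v [^] i" v] v by simp
  qed simp
  have powH: "v [^] i \<in> H" for i :: nat
  proof (induction i)
    case 0 then show ?case using H by (simp add: subgroup.one_closed)
  next
    case (Suc i)
    have "v \<in> H" unfolding H_def by (rule generate.incl) simp
    then show ?case using Suc H by (simp add: subgroup.m_closed)
  qed
  let ?f = "\<lambda>(i::nat, g). v [^] i \<otimes> g"
  have Xc: "g \<in> carrier G" if "g \<in> X" for g using X(1) that by (auto simp: gball_def)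
  have finX: "finite X" using X(1) finite_gball finite_subset by blast
  have injf: "inj_on ?f ({0..R} \<times> X)"
  proof (rule inj_onI, clarify)
    fix i g j h assume *: "g \<in> X" "h \<in> X" "v [^] i \<otimes> g = v [^] j \<otimes> (h::'a)" "i \<in> {0..R}" "j \<in> {0..R}"
    have co: "H #> (v [^] k \<otimes> y) = H #> y" if "y \<in> X" for k :: nat and y
      using H Hsub powH[of k] Xc[OF that] v
      by (metis coset_join2 coset_mult_assoc nat_pow_closed)
    have "H #> g = H #> h" using co[OF *(1), of i] co[OF *(2), of j] *(3) by simp
    then have "g = h" using X(2) * by (auto simp: inj_on_def)
    moreover from this have "v [^] i = v [^] j" using *(3) Xc[OF *(2)] v by simp
    ultimately show "i = j \<and> g = h" using vinj by blast
  qed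
  have sub: "?f ` ({0..R} \<times> X) \<subseteq> gball ((1 + len v) * R)"
  proof clarify
    fix i g assume *: "i \<in> {0..R}" "g \<in> X"
    have "len (v [^] i \<otimes> g) \<le> i * len v + len g"
      using len_mult[of "v [^] i" g] powlen[of i] Xc[OF *(2)] v by simp
    also have "\<dots> \<le> R * len v + R"
      using * X(1) by (intro add_mono mult_right_mono) (auto simp: gball_def)
    finally show "v [^] i \<otimes> g \<in> gball ((1 + len v) * R)"
      using Xc[OF *(2)] v by (simp add: gball_def algebra_simps)
  qed
  have "card X = card (C R)" using card_image[OF X(2)] X(3) by simp
  then have "(R + 1) * (R + 1) \<le> card ({0..R} \<times> X)"
    using mult_le_mono2[OF cardC, of "R + 1"] by (simp add: card_cartesian_product)
  also have "\<dots> \<le> card (gball ((1 + len v) * R))"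
    using card_image[OF injf] card_mono[OF finite_gball sub] by simp
  finally show ?thesis .
qed

text \<open>
  If the first alternative above yields an element of infinite order, it generates a subgroup of infinite
  index because \<open>G\<close> is not virtually cyclic; growth is then at least quadratic in either case.
\<close>

lemma superlinear_growth:
  assumes "\<not> elementary_group G"
  shows "\<exists>R\<ge>1. K * R \<le> card (gball R)"
proof -
  have inf_index: "infinite (rcosets (generate G {g}))" if "g \<in> carrier G" for g
    using assms that by (auto simp: elementary_group_def)
  have "infinite (carrier G)"
  proof
    assume "finite (carrier G)"
    then have "finite (rcosets (generate G {\<one>}))" unfolding RCOSETS_def by auto
    then show False using inf_index by blast
  qed
  from exists_infinite_order_or_quadratic[OF this] show ?thesis
  proof
    assume "\<forall>n. n * n \<le> 2 * card (gball n)"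
    from this[rule_format, of "2 * Suc K"] show ?thesis
      by (intro exI[of _ "2 * Suc K"]) (auto simp: algebra_simps)
  next
    assume "\<exists>v\<in>carrier G. \<forall>k>0. v [^] (k::nat) \<noteq> \<one>"
    then obtain v where v: "v \<in> carrier G" "\<And>k::nat. k > 0 \<Longrightarrow> v [^] k \<noteq> \<one>" by blast
    define R where "R = Suc K * (1 + len v)"
    have "K * ((1 + len v) * R) \<le> R * R" unfolding R_def by (intro order_trans[OF _ mult_right_mono[of "K * (1 + len v)" "Suc K * (1 + len v)"]]) (auto simp: algebra_simps)
    also have "\<dots> \<le> (R + 1) * (R + 1)" by simp
    also have "\<dots> \<le> card (gball ((1 + len v) * R))"
      by (rule quadratic_growth_of_infinite_index[OF v inf_index[OF v(1)]])
    finally show ?thesis by (intro exI[of _ "(1 + len v) * R"]) (auto simp: R_def)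
  qed
qed

end

section \<open>Expansion in hyperbolic groups\<close>

lemma (in group) cancel_inv:
  assumes "x \<in> carrier G" "y \<in> carrier G"
  shows "x \<otimes> (inv x \<otimes> y) = y" "inv x \<otimes> (x \<otimes> y) = y"
    "y \<otimes> x \<otimes> inv x = y" "y \<otimes> inv x \<otimes> x = y"
  using assms by (simp_all add: m_assoc[symmetric]) (simp_all add: m_assoc)

context word_metric begin

abbreviation d :: "'a \<Rightarrow> 'a \<Rightarrow> nat" where "d \<equiv> word_dist G S"

lemma d_one [simp]: "x \<in> carrier G \<Longrightarrow> d \<one> x = len x"
  by (simp add: word_dist_def)

lemma d_sym: "x \<in> carrier G \<Longrightarrow> y \<in> carrier G \<Longrightarrow> d x y = d y x"
  using len_inv[of "inv x \<otimes> y"] by (simp add: word_dist_def inv_mult_group)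

lemma d_translate:
  "g \<in> carrier G \<Longrightarrow> x \<in> carrier G \<Longrightarrow> y \<in> carrier G \<Longrightarrow> d (g \<otimes> x) (g \<otimes> y) = d x y"
  by (simp add: word_dist_def inv_mult_group inv_solve_left m_assoc[symmetric])
     (simp add: m_assoc)

lemma d_triangle:
  assumes "x \<in> carrier G" "y \<in> carrier G" "z \<in> carrier G"
  shows "d x z \<le> d x y + d y z"
proof -
  have "inv x \<otimes> z = (inv x \<otimes> y) \<otimes> (inv y \<otimes> z)"
    using assms by (simp add: m_assoc) (simp add: m_assoc[symmetric])
  then show ?thesis using assms len_mult[of "inv x \<otimes> y" "inv y \<otimes> z"] by (simp add: word_dist_def)
qed

lemma gp_translate:
  assumes "g \<in> carrier G" "w \<in> carrier G" "x \<in> carrier G" "y \<in> carrier G"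
  shows "gromov_product G S (g \<otimes> w) (g \<otimes> x) (g \<otimes> y) = gromov_product G S w x y"
  using assms by (simp add: gromov_product_def d_translate)

lemma point_between:
  assumes "p \<in> carrier G" "q \<in> carrier G" "t \<le> d p q"
  shows "\<exists>z\<in>carrier G. d p z = t \<and> d z q = d p q - t"
proof -
  obtain u v where uv: "u \<in> carrier G" "v \<in> carrier G" "inv p \<otimes> q = u \<otimes> v" "len u = t"
      "len v = d p q - t"
    using len_split[of "inv p \<otimes> q" t] assms by (auto simp: word_dist_def)
  have "inv (p \<otimes> u) \<otimes> q = v"
  proof -
    have "inv (p \<otimes> u) \<otimes> q = inv u \<otimes> (inv p \<otimes> q)"
      using assms uv(1) by (simp add: inv_mult_group m_assoc)
    also have "\<dots> = v" using uv(1,2) by (simp add: uv(3) m_assoc[symmetric])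
    finally show ?thesis .
  qed
  moreover have "inv p \<otimes> (p \<otimes> u) = u" using assms uv(1) by (simp add: m_assoc[symmetric])
  ultimately show ?thesis using assms uv
    by (intro bexI[of _ "p \<otimes> u"]) (auto simp: word_dist_def)
qed

end

text \<open>
  \<open>E x\<close> is a set of preferred steps at \<open>x\<close>, containing at least a third of all steps in \<open>Y\<close>, such that at
  most \<open>m\<close> preferred steps \<open>x \<mapsto> x y\<close> end at any given point.  The factor \<open>6\<close> makes the number of preferred steps
  leaving a point exceed twice the number of those arriving.
\<close>

locale branching = group G for G (structure) +
  fixes Y :: "'a set" and E :: "'a \<Rightarrow> 'a set" and m :: nat
  assumes Y: "finite Y" "Y \<subseteq> carrier G" "6 * m < card Y"
    and E: "\<And>x. x \<in> carrier G \<Longrightarrow> E x \<subseteq> Y \<and> card Y \<le> 3 * card (E x)"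
    and src: "\<And>w. w \<in> carrier G \<Longrightarrow> finite {x \<in> carrier G. inv x \<otimes> w \<in> E x} \<and>
        card {x \<in> carrier G. inv x \<otimes> w \<in> E x} \<le> m"

locale hyperbolic_word_metric = word_metric +
  fixes \<delta> :: real
  assumes \<delta>_nonneg: "\<delta> \<ge> 0"
    and four_point: "\<lbrakk>w \<in> carrier G; x \<in> carrier G; y \<in> carrier G; z \<in> carrier G\<rbrakk> \<Longrightarrow>
       min (gromov_product G S w x y) (gromov_product G S w y z) - \<delta> \<le> gromov_product G S w x z"
begin

text \<open>
  The scale at which directions are told apart: a Gromov product above \<open>tol\<close> means that two points
  lie in the same direction.  The median argument needs \<open>tol \<ge> 4 \<delta>\<close> and \<open>tol > 0\<close>.
\<close>

definition tol :: nat where "tol = nat \<lceil>4 * \<delta>\<rceil> + 1"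

lemma tol: "4 * \<delta> \<le> real tol" "0 < tol"
  unfolding tol_def by linarith+

text \<open>
  If more than two thirds of \<open>Y\<close> were in the direction of \<open>q\<close>, moving the median \<open>p\<close> by \<open>tol\<close>
  towards \<open>q\<close> would decrease the sum of distances: these points come closer by at least
  \<open>tol / 2\<close>, the others recede by at most \<open>tol\<close>.
\<close>

lemma median_sees_one_third:
  assumes Y: "finite Y" "Y \<subseteq> carrier G" and p: "p \<in> carrier G" and q: "q \<in> carrier G"
    and min: "\<And>z. z \<in> carrier G \<Longrightarrow> (\<Sum>y\<in>Y. d p y) \<le> (\<Sum>y\<in>Y. d z y)"
  shows "card Y \<le> 3 * card {y \<in> Y. gromov_product G S p y q \<le> tol}"
proof -
  define A where "A = {y \<in> Y. \<not> gromov_product G S p y q \<le> tol}"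
  have YA: "Y - A = {y \<in> Y. gromov_product G S p y q \<le> tol}" by (auto simp: A_def)
  have AY: "A \<subseteq> Y" by (auto simp: A_def)
  have "card A \<le> 2 * card (Y - A)"
  proof (cases "A = {}")
    case False
    then obtain y0 where y0: "y0 \<in> Y" "gromov_product G S p y0 q > tol" by (auto simp: A_def)
    have "real (d p y0) \<le> d p q + d q y0" using d_triangle[OF p q] y0 Y by (metis of_nat_add of_nat_le_iff subsetD)
    then have "tol \<le> d p q" using y0 d_sym[OF q, of y0] Y by (auto simp: gromov_product_def)
    then obtain z where z: "z \<in> carrier G" "d p z = tol" "d z q = d p q - tol"
      using point_between[OF p q] by blast
    have qz: "gromov_product G S p q z = tol"
      using z \<open>tol \<le> d p q\<close> d_sym[OF q z(1)] by (simp add: gromov_product_def)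
    have inA: "real (d z y) \<le> real (d p y) - tol / 2" if "y \<in> A" for y
    proof -
      have yc: "y \<in> carrier G" using that Y AY by blast
      have "real tol - \<delta> \<le> gromov_product G S p y z"
        using four_point[OF p yc q z(1)] qz that by (simp add: A_def)
      then show ?thesis using tol z d_sym[OF yc z(1)] by (simp add: gromov_product_def)
    qed
    have notA: "real (d z y) \<le> real (d p y) + tol" if "y \<in> Y - A" for y
      using d_triangle[OF z(1) p, of y] d_sym[OF z(1) p] z(2) that Y by fastforce
    have "(\<Sum>y\<in>Y. real (d p y)) \<le> (\<Sum>y\<in>Y. real (d z y))"
      using min[OF z(1)] by (metis of_nat_le_iff of_nat_sum)
    also have "\<dots> = (\<Sum>y\<in>A. real (d z y)) + (\<Sum>y\<in>Y-A. real (d z y))"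
      using Y AY by (metis add.commute sum.subset_diff)
    also have "\<dots> \<le> (\<Sum>y\<in>A. real (d p y) - tol / 2) + (\<Sum>y\<in>Y-A. real (d p y) + tol)"
      by (intro add_mono sum_mono inA notA) auto
    also have "\<dots> = ((\<Sum>y\<in>A. real (d p y)) + (\<Sum>y\<in>Y-A. real (d p y))) + (card (Y - A) * real tol - card A * (real tol / 2))"
      by (simp add: sum.distrib sum_subtractf)
    also have "(\<Sum>y\<in>A. real (d p y)) + (\<Sum>y\<in>Y-A. real (d p y)) = (\<Sum>y\<in>Y. real (d p y))"
      using Y AY by (metis add.commute sum.subset_diff)
    finally have "(real (card A) / 2) * real tol \<le> card (Y - A) * real tol" by simp
    then have "real (card A) / 2 \<le> card (Y - A)" using tol(2) by (simp del: times_divide_eq_left)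
    then show ?thesis by linarith
  qed simp
  moreover have "card Y = card A + card (Y - A)"
    using Y AY by (metis card_Diff_subset card_mono finite_subset le_add_diff_inverse)
  ultimately show ?thesis unfolding YA[symmetric] by simp
qed

text \<open>
  If \<open>w\<close> was reached from \<open>x\<close> by a step leading away from \<open>\<one>\<close>, then \<open>x\<close> lies near the
  geodesic from \<open>w\<close> to \<open>\<one>\<close>, at distance \<open>d x w\<close> from \<open>w\<close>.  So for each value of this distance
  \<open>x\<close> varies in a ball of bounded radius.
\<close>

lemma sources_bounded:
  assumes w: "w \<in> carrier G"
  shows "card {x \<in> carrier G. d x w \<le> r \<and> gromov_product G S x w \<one> \<le> tol}
    \<le> (r + 1) * card (gball (3 * tol))"
proof -
  define X where "X k = {x \<in> carrier G. d x w = k \<and> gromov_product G S x w \<one> \<le> tol}" for k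
  have close: "d x x' \<le> 3 * tol" if "x \<in> X k" "x' \<in> X k" for x x' k
  proof -
    have c: "x \<in> carrier G" "x' \<in> carrier G" using that by (auto simp: X_def)
    have 1: "gromov_product G S w x \<one> \<ge> real k - tol" if "x \<in> X k" for x
      using that w d_sym[of x w] by (simp add: X_def gromov_product_def field_simps)
    have 2: "gromov_product G S w \<one> x' = gromov_product G S w x' \<one>"
      using c w d_sym[of "\<one>" x'] by (simp add: gromov_product_def)
    have "gromov_product G S w x x' \<ge> real k - tol - \<delta>"
      using four_point[OF w c(1) one_closed c(2)] 1[OF that(1)] 1[OF that(2)] 2 by linarith
    then have "real (d x x') \<le> 2 * tol + 2 * \<delta>"
      using that c w d_sym[of w x] d_sym[of w x'] by (simp add: X_def gromov_product_def)
    then show ?thesis using tol by linarith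
  qed
  have cX: "card (X k) \<le> card (gball (3 * tol))" and finX: "finite (X k)" for k
  proof -
    have *: "card (X k) \<le> card (gball (3 * tol)) \<and> finite (X k)"
    proof (cases "X k = {}")
      case False
      then obtain x where x: "x \<in> X k" by blast
      have xc: "x \<in> carrier G" using x by (simp add: X_def)
      have "X k \<subseteq> (\<lambda>g. x \<otimes> g) ` gball (3 * tol)"
      proof
        fix x' assume x': "x' \<in> X k"
        then have "x' \<in> carrier G" by (simp add: X_def)
        then have "x' = x \<otimes> (inv x \<otimes> x')" "inv x \<otimes> x' \<in> gball (3 * tol)"
          using close[OF x x'] xc by (simp_all add: gball_def word_dist_def cancel_inv)
        then show "x' \<in> (\<lambda>g. x \<otimes> g) ` gball (3 * tol)" by blast
      qed
      moreover have "card ((\<lambda>g. x \<otimes> g) ` gball (3 * tol)) \<le> card (gball (3 * tol))"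
        by (rule card_image_le[OF finite_gball])
      ultimately show ?thesis
        using card_mono[OF finite_imageI[OF finite_gball]] finite_subset[OF _ finite_imageI[OF finite_gball]]
        by (metis le_trans)
    qed simp
    then show "card (X k) \<le> card (gball (3 * tol))" "finite (X k)" by auto
  qed
  have "{x \<in> carrier G. d x w \<le> r \<and> gromov_product G S x w \<one> \<le> tol} = (\<Union>k\<in>{..r}. X k)"
    by (auto simp: X_def)
  then have "card {x \<in> carrier G. d x w \<le> r \<and> gromov_product G S x w \<one> \<le> tol} \<le> (\<Sum>k\<in>{..r}. card (X k))"
    by (simp add: card_UN_le)
  also have "\<dots> \<le> (\<Sum>k\<in>{..r}. card (gball (3 * tol)))" by (intro sum_mono cX)
  finally show ?thesis by simp
qed

text \<open>
  \<open>Y\<close> is a large ball translated so that its median is the identity, and \<open>E x\<close> consists of the steps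
  \<open>y\<close> for which the Gromov product of \<open>x y\<close> and \<open>\<one>\<close> at \<open>x\<close> is at most \<open>tol\<close>.  The number \<open>m\<close> of sources
  is linear in the radius of the ball, with a slope independent of the radius; superlinear growth makes
  \<open>card Y\<close> larger than any fixed multiple of it.
\<close>

lemma branching_map:
  assumes "\<not> elementary_group G"
  shows "\<exists>Y E m. branching G Y E m"
proof -
  define c where "c = card (gball (3 * tol))"
  \<comment> \<open>The translated ball lies in the ball of radius \<open>3 R\<close>, whence \<open>m = (3 R + 1) c \<le> 4 R c\<close>.\<close>
  obtain R where R: "R \<ge> 1" "(24 * c + 1) * R \<le> card (gball R)"
    using superlinear_growth[OF assms] by blast
  define D where "D p = (\<Sum>y\<in>gball R. d p y)" for p
  obtain p where p: "p \<in> carrier G" "\<And>z. z \<in> carrier G \<Longrightarrow> D p \<le> D z"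
    using ex_has_least_nat[of "\<lambda>p. p \<in> carrier G" "\<one>" D] by blast
  have Bc: "gball R \<subseteq> carrier G" by (auto simp: gball_def)
  have one_B: "\<one> \<in> gball R" by (simp add: gball_def)
  \<comment> \<open>The median beats \<open>\<one>\<close>, whose mean distance to the ball is at most \<open>R\<close>.\<close>
  have "\<exists>y\<in>gball R. d p y \<le> R"
  proof (rule ccontr)
    assume "\<not> ?thesis"
    then have "(\<Sum>y\<in>gball R. R) < D p" unfolding D_def
      using one_B by (intro sum_strict_mono finite_gball) auto
    also have "D p \<le> D \<one>" by (rule p(2)) simp
    also have "\<dots> \<le> (\<Sum>y\<in>gball R. R)" unfolding D_def by (intro sum_mono) (auto simp: gball_def)
    finally show False by simp
  qed
  then obtain y0 where y0: "y0 \<in> carrier G" "len y0 \<le> R" "d p y0 \<le> R" by (auto simp: gball_def)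
  have lp: "len p \<le> 2 * R"
    using d_triangle[OF one_closed y0(1) p(1)] d_sym[OF p(1) y0(1)] y0 p(1) by simp
  define Y where "Y = (\<lambda>y. inv p \<otimes> y) ` gball R"
  define E where "E x = {y \<in> Y. gromov_product G S x (x \<otimes> y) \<one> \<le> tol}" for x
  have injp: "inj_on (\<lambda>y. inv p \<otimes> y) (gball R)" using p(1) by (auto simp: inj_on_def gball_def)
  have cardY: "card Y = card (gball R)" unfolding Y_def by (rule card_image[OF injp])
  have Yc: "Y \<subseteq> carrier G" using p(1) by (auto simp: Y_def gball_def)
  have Ylen: "len y \<le> 3 * R" if "y \<in> Y" for y
    using that lp p(1) len_mult[of "inv p"] by (fastforce simp: Y_def gball_def)
  have Ecard: "card Y \<le> 3 * card (E x)" if x: "x \<in> carrier G" for x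
  proof -
    have gp: "gromov_product G S x (x \<otimes> (inv p \<otimes> y)) \<one> = gromov_product G S p y (p \<otimes> inv x)"
      if y: "y \<in> gball R" for y
    proof -
      have yc: "y \<in> carrier G" using y Bc by blast
      have "gromov_product G S (p \<otimes> inv x \<otimes> x) (p \<otimes> inv x \<otimes> (x \<otimes> (inv p \<otimes> y))) (p \<otimes> inv x \<otimes> \<one>)
          = gromov_product G S x (x \<otimes> (inv p \<otimes> y)) \<one>"
        using x p(1) yc by (intro gp_translate) auto
      moreover have "p \<otimes> inv x \<otimes> x = p" using x p(1) by (simp add: m_assoc)
      moreover have "p \<otimes> inv x \<otimes> (x \<otimes> (inv p \<otimes> y)) = y"
      proof -
        show ?thesis using x p(1) yc by (simp add: m_assoc cancel_inv)
      qed
      ultimately show ?thesis using x p(1) by simp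
    qed
    have "E x = (\<lambda>y. inv p \<otimes> y) ` {y \<in> gball R. gromov_product G S p y (p \<otimes> inv x) \<le> tol}"
      using gp by (auto simp: E_def Y_def)
    then have "card (E x) = card {y \<in> gball R. gromov_product G S p y (p \<otimes> inv x) \<le> tol}"
      using card_image[OF inj_on_subset[OF injp]] by simp
    moreover have "card (gball R) \<le> 3 * card {y \<in> gball R. gromov_product G S p y (p \<otimes> inv x) \<le> tol}"
      by (rule median_sees_one_third[OF finite_gball Bc p(1)]) (use p x in \<open>auto simp: D_def\<close>)
    ultimately show ?thesis using cardY by simp
  qed
  have src: "finite {x \<in> carrier G. inv x \<otimes> w \<in> E x} \<and>
      card {x \<in> carrier G. inv x \<otimes> w \<in> E x} \<le> (3 * R + 1) * c" if w: "w \<in> carrier G" for w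
  proof -
    have wx: "x \<otimes> (inv x \<otimes> w) = w" if "x \<in> carrier G" for x
      using that w by (simp add: cancel_inv)
    have sub: "{x \<in> carrier G. inv x \<otimes> w \<in> E x}
        \<subseteq> {x \<in> carrier G. d x w \<le> 3 * R \<and> gromov_product G S x w \<one> \<le> tol}"
      using Ylen wx by (auto simp: E_def word_dist_def)
    have "{x \<in> carrier G. d x w \<le> 3 * R} \<subseteq> (\<lambda>g. w \<otimes> inv g) ` gball (3 * R)"
    proof
      fix x assume x: "x \<in> {x \<in> carrier G. d x w \<le> 3 * R}"
      then have "inv x \<otimes> w \<in> gball (3 * R)" using w by (auto simp: gball_def word_dist_def)
      moreover have "x = w \<otimes> inv (inv x \<otimes> w)"
        using x w by (simp add: inv_mult_group cancel_inv)
      ultimately show "x \<in> (\<lambda>g. w \<otimes> inv g) ` gball (3 * R)" by blast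
    qed
    then have "finite {x \<in> carrier G. d x w \<le> 3 * R}"
      using finite_gball finite_surj by blast
    then have fin: "finite {x \<in> carrier G. d x w \<le> 3 * R \<and> gromov_product G S x w \<one> \<le> tol}"
      by (rule finite_subset[rotated]) auto
    show ?thesis
      using finite_subset[OF sub fin] card_mono[OF fin sub] sources_bounded[OF w, of "3 * R"]
      unfolding c_def by linarith
  qed
  have "(3 * R + 1) * c \<le> (4 * R) * c" using R(1) by (intro mult_right_mono) auto
  moreover have "6 * ((4 * R) * c) < (24 * c + 1) * R" using R(1) by (simp add: algebra_simps)
  ultimately have "6 * ((3 * R + 1) * c) < (24 * c + 1) * R" by linarith
  then have "6 * ((3 * R + 1) * c) < card Y" using R(2) cardY by linarith
  moreover have "finite Y" by (simp add: Y_def finite_gball)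
  moreover have "E x \<subseteq> Y" for x by (auto simp: E_def)
  ultimately have "branching G Y E ((3 * R + 1) * c)"
    using Yc Ecard src by unfold_locales auto
  then show ?thesis by blast
qed

end

section \<open>Isoperimetric inequalities\<close>

lemma (in group) sum_translate_le:
  fixes f :: "'a \<Rightarrow> real"
  assumes F: "finite F" "F \<subseteq> carrier G" and f: "\<And>x. f x \<ge> 0" "\<And>x. x \<notin> F \<Longrightarrow> f x = 0"
    and y: "y \<in> carrier G" and F': "finite F'" "F' \<subseteq> carrier G"
  shows "(\<Sum>x\<in>F'. f (x \<otimes> y)) \<le> (\<Sum>x\<in>F. f x)"
proof -
  have inj: "inj_on (\<lambda>x. x \<otimes> y) F'" using F' y by (intro inj_onI) (auto simp: subset_iff)
  have "(\<Sum>x\<in>F'. f (x \<otimes> y)) = (\<Sum>x\<in>(\<lambda>x. x \<otimes> y) ` F'. f x)"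
    using sum.reindex[OF inj, of f] by (simp add: o_def)
  also have "\<dots> = (\<Sum>x\<in>(\<lambda>x. x \<otimes> y) ` F' \<inter> F. f x)"
    using F' f(2) by (intro sum.mono_neutral_right) auto
  also have "\<dots> \<le> (\<Sum>x\<in>F. f x)" using F f(1) by (intro sum_mono2) auto
  finally show ?thesis .
qed

context branching begin

text \<open>
  Transport the mass \<open>f x\<close> along the steps in \<open>E x\<close>.  At least a third of the \<open>card Y\<close> possible steps
  leave each point, but at most \<open>m\<close> arrive at each point; the difference must be paid for by
  the variation of \<open>f\<close>.
\<close>

lemma l1_expansion:
  fixes f :: "'a \<Rightarrow> real"
  assumes F: "finite F" "F \<subseteq> carrier G" and f: "\<And>x. f x \<ge> 0" "\<And>x. x \<notin> F \<Longrightarrow> f x = 0"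
  shows "card Y * (\<Sum>x\<in>F. f x) \<le> 6 * (\<Sum>x\<in>F. \<Sum>y\<in>Y. \<bar>f x - f (x \<otimes> y)\<bar>)"
proof -
  define P where "P = Sigma F E"
  define g where "g = (\<lambda>(x, y). x \<otimes> y)"
  have finE: "finite (E x)" if "x \<in> F" for x using E F Y that finite_subset by (metis subsetD)
  have finP: "finite P" unfolding P_def using F finE by (intro finite_SigmaI) auto
  have Pc: "x \<in> carrier G" "y \<in> E x" "y \<in> carrier G" "x \<in> F" if "(x, y) \<in> P" for x y
    using that F E Y by (auto simp: P_def subset_iff)
  have gP: "g ` P \<subseteq> carrier G" using Pc by (auto simp: g_def)
  have cnt: "card {p \<in> P. g p = w} \<le> m" if w: "w \<in> carrier G" for w
  proof -
    have "inj_on fst {p \<in> P. g p = w}"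
    proof (rule inj_onI)
      fix p q assume pq: "p \<in> {p \<in> P. g p = w}" "q \<in> {p \<in> P. g p = w}" "fst p = fst q"
      obtain x y x' y' where "p = (x, y)" "q = (x', y')" by (metis surj_pair)
      with pq show "p = q" using Pc by (auto simp: g_def)
    qed
    moreover have "fst ` {p \<in> P. g p = w} \<subseteq> {x \<in> carrier G. inv x \<otimes> w \<in> E x}"
    proof clarify
      fix x y assume xy: "(x, y) \<in> P" "w = g (x, y)"
      then have c: "x \<in> carrier G" "y \<in> E x" "y \<in> carrier G" using Pc by auto
      then have "inv x \<otimes> w = y" using xy by (simp add: g_def cancel_inv)
      then show "fst (x, y) \<in> carrier G \<and> inv (fst (x, y)) \<otimes> g (x, y) \<in> E (fst (x, y))" using c xy by simp
    qed
    ultimately show ?thesis using src[OF w] by (meson card_inj_on_le le_trans)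
  qed
  have incoming: "(\<Sum>x\<in>F. \<Sum>y\<in>E x. f (x \<otimes> y)) \<le> m * (\<Sum>x\<in>F. f x)"
  proof -
    have "(\<Sum>x\<in>F. \<Sum>y\<in>E x. f (x \<otimes> y)) = (\<Sum>p\<in>P. f (g p))"
      unfolding P_def g_def using F finE by (subst sum.Sigma) (auto simp: case_prod_beta)
    also have "\<dots> = (\<Sum>w\<in>g ` P. \<Sum>p\<in>{p \<in> P. g p = w}. f (g p))"
      by (rule sum.group[symmetric]) (use finP in auto)
    also have "\<dots> = (\<Sum>w\<in>g ` P. card {p \<in> P. g p = w} * f w)" by simp
    also have "\<dots> \<le> (\<Sum>w\<in>g ` P. m * f w)"
      using cnt gP f(1) by (intro sum_mono mult_right_mono) auto
    also have "\<dots> = m * (\<Sum>w\<in>g ` P. f w)" by (simp add: sum_distrib_left)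
    also have "(\<Sum>w\<in>g ` P. f w) = (\<Sum>w\<in>g ` P \<inter> F. f w)"
      using f(2) finP by (intro sum.mono_neutral_right) auto
    also have "\<dots> \<le> (\<Sum>x\<in>F. f x)" using F f(1) by (intro sum_mono2) auto
    finally show ?thesis by (simp add: mult_left_mono)
  qed
  have "card Y * (\<Sum>x\<in>F. f x) = (\<Sum>x\<in>F. card Y * f x)" by (rule sum_distrib_left)
  also have "\<dots> \<le> (\<Sum>x\<in>F. 3 * (card (E x) * f x))"
  proof (rule sum_mono)
    fix x assume "x \<in> F"
    then have "real (card Y) \<le> 3 * card (E x)" using E F by (metis of_nat_le_iff of_nat_mult of_nat_numeral subsetD)
    from mult_right_mono[OF this f(1)[of x]] show "card Y * f x \<le> 3 * (card (E x) * f x)" by simp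
  qed
  also have "\<dots> = 3 * (\<Sum>x\<in>F. \<Sum>y\<in>E x. f x)" by (simp add: sum_distrib_left)
  also have "(\<Sum>x\<in>F. \<Sum>y\<in>E x. f x) \<le> (\<Sum>x\<in>F. \<Sum>y\<in>E x. \<bar>f x - f (x \<otimes> y)\<bar> + f (x \<otimes> y))"
    by (intro sum_mono) auto
  also have "\<dots> = (\<Sum>x\<in>F. \<Sum>y\<in>E x. \<bar>f x - f (x \<otimes> y)\<bar>) + (\<Sum>x\<in>F. \<Sum>y\<in>E x. f (x \<otimes> y))"
    by (simp add: sum.distrib)
  also have "\<dots> \<le> (\<Sum>x\<in>F. \<Sum>y\<in>Y. \<bar>f x - f (x \<otimes> y)\<bar>) + m * (\<Sum>x\<in>F. f x)"
    using E F Y by (intro add_mono incoming sum_mono sum_mono2) (auto simp: subset_iff)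
  finally have 1: "card Y * (\<Sum>x\<in>F. f x) \<le> 3 * (\<Sum>x\<in>F. \<Sum>y\<in>Y. \<bar>f x - f (x \<otimes> y)\<bar>) + 3 * (m * (\<Sum>x\<in>F. f x))"
    by simp
  have "6 * (real m * (\<Sum>x\<in>F. f x)) \<le> card Y * (\<Sum>x\<in>F. f x)"
  proof -
    have "real (6 * m) \<le> real (card Y)" using Y(3) by linarith
    from mult_right_mono[OF this, of "\<Sum>x\<in>F. f x"] show ?thesis
      using f(1) by (simp add: sum_nonneg)
  qed
  with 1 show ?thesis by linarith
qed

text \<open>
  The previous inequality applied to \<open>f\<^sup>2\<close>.  Young's inequality for
  \<open>\<bar>a\<^sup>2 - b\<^sup>2\<bar> = \<bar>a - b\<bar> \<bar>a + b\<bar>\<close> is weighted so that the part with \<open>a\<^sup>2 + b\<^sup>2\<close> is absorbed by the left-hand side.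
\<close>

lemma l2_expansion:
  fixes f :: "'a \<Rightarrow> real"
  assumes F: "finite F" "F \<subseteq> carrier G" and f: "\<And>x. x \<notin> F \<Longrightarrow> f x = 0"
  shows "card Y * (\<Sum>x\<in>F. (f x)\<^sup>2) \<le> 144 * (\<Sum>x\<in>F. \<Sum>y\<in>Y. (f x - f (x \<otimes> y))\<^sup>2)"
proof -
  define N where "N = (\<Sum>x\<in>F. (f x)\<^sup>2)"
  define D where "D = (\<Sum>x\<in>F. \<Sum>y\<in>Y. (f x - f (x \<otimes> y))\<^sup>2)"
  have young: "\<bar>a\<^sup>2 - b\<^sup>2\<bar> \<le> 12 * (a - b)\<^sup>2 + (1 / 24) * (a\<^sup>2 + b\<^sup>2)" for a b :: real
  proof -
    have 0: "(24 * u - v)\<^sup>2 = 576 * u\<^sup>2 - 48 * (u * v) + v\<^sup>2" for u v :: real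
      by (simp add: power2_eq_square algebra_simps)
    have 1: "u * v \<le> 12 * u\<^sup>2 + (1 / 48) * v\<^sup>2" for u v :: real
      using zero_le_power2[of "24 * u - v"] unfolding 0 by linarith
    have 2: "(1 / 48) * (a + b)\<^sup>2 \<le> (1 / 24) * (a\<^sup>2 + b\<^sup>2)"
      using zero_le_power2[of "a - b"] by (simp add: power2_eq_square algebra_simps)
    have "\<bar>a\<^sup>2 - b\<^sup>2\<bar> = \<bar>a - b\<bar> * \<bar>a + b\<bar>" by (simp add: abs_mult[symmetric] power2_eq_square algebra_simps)
    also have "\<dots> \<le> 12 * (a - b)\<^sup>2 + (1 / 48) * (a + b)\<^sup>2"
      using 1[of "\<bar>a - b\<bar>" "\<bar>a + b\<bar>"] by simp
    also have "\<dots> \<le> 12 * (a - b)\<^sup>2 + (1 / 24) * (a\<^sup>2 + b\<^sup>2)"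
      by (rule add_left_mono[OF 2])
    finally show ?thesis .
  qed
  have tr: "(\<Sum>x\<in>F. \<Sum>y\<in>Y. (f (x \<otimes> y))\<^sup>2) \<le> card Y * N"
  proof -
    have "(\<Sum>x\<in>F. \<Sum>y\<in>Y. (f (x \<otimes> y))\<^sup>2) = (\<Sum>y\<in>Y. \<Sum>x\<in>F. (f (x \<otimes> y))\<^sup>2)" by (rule sum.swap)
    also have "\<dots> \<le> (\<Sum>y\<in>Y. N)"
      unfolding N_def using Y F f
      by (intro sum_mono sum_translate_le[where f = "\<lambda>x. (f x)\<^sup>2"]) auto
    finally show ?thesis by simp
  qed
  have "card Y * N \<le> 6 * (\<Sum>x\<in>F. \<Sum>y\<in>Y. \<bar>(f x)\<^sup>2 - (f (x \<otimes> y))\<^sup>2\<bar>)"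
    unfolding N_def by (rule l1_expansion[OF F]) (use f in auto)
  also have "\<dots> \<le> 6 * (\<Sum>x\<in>F. \<Sum>y\<in>Y. 12 * (f x - f (x \<otimes> y))\<^sup>2 + (1 / 24) * ((f x)\<^sup>2 + (f (x \<otimes> y))\<^sup>2))"
    by (intro mult_left_mono sum_mono young) auto
  also have "\<dots> = 72 * D + (1 / 4) * (card Y * N + (\<Sum>x\<in>F. \<Sum>y\<in>Y. (f (x \<otimes> y))\<^sup>2))"
    by (simp add: D_def N_def sum.distrib sum_distrib_left[symmetric]
        sum_divide_distrib[symmetric] algebra_simps)
  finally have *: "card Y * N \<le> 72 * D + (1 / 4) * (card Y * N + (\<Sum>x\<in>F. \<Sum>y\<in>Y. (f (x \<otimes> y))\<^sup>2))" .
  have "a \<le> 144 * b" if "a \<le> 72 * b + (1 / 4) * (a + x)" "x \<le> a" for a b x :: real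
  proof -
    have "(1 / 4) * (a + x) = a / 4 + x / 4" by (simp add: add_divide_distrib)
    with that show ?thesis by linarith
  qed
  from this[OF * tr] show ?thesis unfolding N_def D_def .
qed

end

section \<open>Convolution powers and positive drift\<close>

primrec conv_pow :: "('a, 'b) monoid_scheme \<Rightarrow> 'a pmf \<Rightarrow> nat \<Rightarrow> 'a pmf" where
  "conv_pow G \<kappa> 0 = return_pmf (one G)"
| "conv_pow G \<kappa> (Suc n) = bind_pmf (conv_pow G \<kappa> n) (\<lambda>x. map_pmf (\<lambda>g. x \<otimes>\<^bsub>G\<^esub> g) \<kappa>)"

text \<open>
  Non-amenability in quantitative form.  The constant \<open>144\<close> is the one produced by \<open>l2_expansion\<close>.
\<close>

definition expanding :: "('a, 'b) monoid_scheme \<Rightarrow> 'a set \<Rightarrow> bool" where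
  "expanding G Y \<longleftrightarrow> finite Y \<and> Y \<noteq> {} \<and> Y \<subseteq> carrier G \<and>
     (\<forall>F. \<forall>f :: 'a \<Rightarrow> real. finite F \<longrightarrow> F \<subseteq> carrier G \<longrightarrow> (\<forall>x. x \<notin> F \<longrightarrow> f x = 0) \<longrightarrow>
        card Y * (\<Sum>x\<in>F. (f x)\<^sup>2) \<le> 144 * (\<Sum>x\<in>F. \<Sum>y\<in>Y. (f x - f (x \<otimes>\<^bsub>G\<^esub> y))\<^sup>2))"

lemmas expandingD =
  expanding_def[THEN iffD1, THEN conjunct1]
  expanding_def[THEN iffD1, THEN conjunct2, THEN conjunct1]
  expanding_def[THEN iffD1, THEN conjunct2, THEN conjunct2, THEN conjunct1]
  expanding_def[THEN iffD1, THEN conjunct2, THEN conjunct2, THEN conjunct2, rule_format]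

lemma hyperbolic_expanding:
  fixes G :: "('a, 'b) monoid_scheme"
  assumes "hyperbolic_group G" "\<not> elementary_group G"
  shows "\<exists>Y. expanding G Y"
proof -
  from assms(1) obtain S \<delta> where *: "group G" "sym_generating_set G S" "\<delta> \<ge> 0"
    "\<And>w x y z. w\<in>carrier G \<Longrightarrow> x\<in>carrier G \<Longrightarrow> y\<in>carrier G \<Longrightarrow> z\<in>carrier G \<Longrightarrow>
       gromov_product G S w x z
            \<ge> min (gromov_product G S w x y) (gromov_product G S w y z) - \<delta>"
    unfolding hyperbolic_group_def by blast
  then interpret group G by simp
  interpret hyperbolic_word_metric G S \<delta>
    using * by unfold_locales auto
  from branching_map[OF assms(2)] obtain Y E m where "branching G Y E m" by blast
  then interpret B: branching G Y E m .
  have "expanding G Y"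
    unfolding expanding_def
  proof (intro conjI allI impI)
    show "finite Y" "Y \<noteq> {}" "Y \<subseteq> carrier G" using B.Y by auto
    show "card Y * (\<Sum>x\<in>F. (f x)\<^sup>2) \<le> 144 * (\<Sum>x\<in>F. \<Sum>y\<in>Y. (f x - f (x \<otimes>\<^bsub>G\<^esub> y))\<^sup>2)"
      if "finite F" "F \<subseteq> carrier G" "\<forall>x. x \<notin> F \<longrightarrow> f x = 0" for F and f :: "'a \<Rightarrow> real"
      by (rule B.l2_expansion) (use that in auto)
  qed
  then show ?thesis by blast
qed

lemma pmf_map_left_inverse:
  assumes "\<And>y. y \<in> set_pmf N \<Longrightarrow> g (f y) = y" "f (g x) = x"
  shows "pmf (map_pmf f N) x = pmf N (g x)"
proof (cases "g x \<in> set_pmf N")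
  case True
  have "inj_on f (set_pmf N)" using assms(1) by (rule inj_on_inverseI)
  from pmf_map_inj[OF this True] show ?thesis by (simp add: assms(2))
next
  case False
  then have "x \<notin> f ` set_pmf N" using assms(1) by auto
  then show ?thesis using False by (simp add: pmf_map_outside set_pmf_iff)
qed

lemma pmf_bind_ge:
  assumes "finite (set_pmf N)" shows "pmf N x * pmf (f x) i \<le> pmf (bind_pmf N f) i"
proof (cases "x \<in> set_pmf N")
  case True
  have "pmf (bind_pmf N f) i = (\<Sum>a\<in>set_pmf N. pmf (f a) i * pmf N a)"
    unfolding pmf_bind by (rule integral_measure_pmf_real[OF assms])
  moreover have "pmf (f x) i * pmf N x \<le> (\<Sum>a\<in>set_pmf N. pmf (f a) i * pmf N a)"
    using True assms by (intro member_le_sum) auto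
  ultimately show ?thesis by (simp add: mult.commute)
qed (simp add: set_pmf_iff)

text \<open>
  The left-hand side subtracted from the first term on the right is a variance, and two values of weight at least
  \<open>c\<close> contribute at least \<open>c/2\<close> times their squared difference to it.
\<close>

lemma weighted_variance_ge:
  fixes a k :: "'i \<Rightarrow> real"
  assumes T: "finite T" "(\<Sum>g\<in>T. k g) = 1" "\<And>g. g \<in> T \<Longrightarrow> k g \<ge> 0"
    and g: "g1 \<in> T" "g2 \<in> T" "c \<le> k g1" "c \<le> k g2" "c \<ge> 0"
  shows "(\<Sum>g\<in>T. k g * a g)\<^sup>2 \<le> (\<Sum>g\<in>T. k g * (a g)\<^sup>2) - c / 2 * (a g1 - a g2)\<^sup>2"
proof -
  define m where "m = (\<Sum>g\<in>T. k g * a g)"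
  have "(\<Sum>g\<in>T. k g * (a g - m)\<^sup>2) = (\<Sum>g\<in>T. k g * (a g)\<^sup>2 - 2 * m * (k g * a g) + m\<^sup>2 * k g)"
    by (intro sum.cong) (auto simp: power2_eq_square algebra_simps)
  also have "\<dots> = (\<Sum>g\<in>T. k g * (a g)\<^sup>2) - m\<^sup>2"
    using T(2) by (simp add: sum.distrib sum_subtractf sum_distrib_left[symmetric] m_def[symmetric] power2_eq_square)
  finally have var: "(\<Sum>g\<in>T. k g * (a g - m)\<^sup>2) = (\<Sum>g\<in>T. k g * (a g)\<^sup>2) - m\<^sup>2" .
  have "c / 2 * (a g1 - a g2)\<^sup>2 \<le> (\<Sum>g\<in>T. k g * (a g - m)\<^sup>2)"
  proof (cases "g1 = g2")
    case True
    then show ?thesis using T by (simp add: sum_nonneg)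
  next
    case False
    have "(a g1 - a g2)\<^sup>2 \<le> 2 * ((a g1 - m)\<^sup>2 + (a g2 - m)\<^sup>2)"
      using zero_le_power2[of "(a g1 - m) + (a g2 - m)"] by (simp add: power2_eq_square algebra_simps)
    then have "c / 2 * (a g1 - a g2)\<^sup>2 \<le> c / 2 * (2 * ((a g1 - m)\<^sup>2 + (a g2 - m)\<^sup>2))"
      using g by (intro mult_left_mono) auto
    also have "\<dots> = c * (a g1 - m)\<^sup>2 + c * (a g2 - m)\<^sup>2" by (simp add: algebra_simps)
    also have "\<dots> \<le> k g1 * (a g1 - m)\<^sup>2 + k g2 * (a g2 - m)\<^sup>2"
      using g by (intro add_mono mult_right_mono) auto
    also have "\<dots> = (\<Sum>g\<in>{g1, g2}. k g * (a g - m)\<^sup>2)" using False by simp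
    also have "\<dots> \<le> (\<Sum>g\<in>T. k g * (a g - m)\<^sup>2)" using T g by (intro sum_mono2) auto
    finally show ?thesis .
  qed
  with var show ?thesis unfolding m_def by linarith
qed

context group begin

lemma set_conv_pow: "set_pmf \<kappa> \<subseteq> carrier G \<Longrightarrow> set_pmf (conv_pow G \<kappa> n) \<subseteq> carrier G"
  by (induction n) auto

lemma finite_conv_pow: "finite (set_pmf \<kappa>) \<Longrightarrow> finite (set_pmf (conv_pow G \<kappa> n))"
  by (induction n) auto

lemma conv_pow_add:
  assumes \<kappa>: "set_pmf \<kappa> \<subseteq> carrier G"
  shows "conv_pow G \<kappa> (m + n) =
    bind_pmf (conv_pow G \<kappa> m) (\<lambda>x. map_pmf (\<lambda>y. x \<otimes> y) (conv_pow G \<kappa> n))"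
proof (induction n)
  case 0
  have "bind_pmf (conv_pow G \<kappa> m) (\<lambda>x. map_pmf (\<lambda>y. x \<otimes> y) (conv_pow G \<kappa> 0)) = bind_pmf (conv_pow G \<kappa> m) return_pmf"
    by (rule bind_pmf_cong) (auto intro!: r_one dest: subsetD[OF set_conv_pow[OF \<kappa>]])
  then show ?case by (simp add: bind_return_pmf')
next
  case (Suc n)
  have "conv_pow G \<kappa> (m + Suc n) = bind_pmf (conv_pow G \<kappa> m)
      (\<lambda>x. bind_pmf (conv_pow G \<kappa> n) (\<lambda>y. map_pmf (\<lambda>g. (x \<otimes> y) \<otimes> g) \<kappa>))"
    by (simp add: Suc bind_assoc_pmf bind_map_pmf)
  also have "\<dots> = bind_pmf (conv_pow G \<kappa> m)
      (\<lambda>x. bind_pmf (conv_pow G \<kappa> n) (\<lambda>y. map_pmf (\<lambda>g. x \<otimes> (y \<otimes> g)) \<kappa>))"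
    by (intro bind_pmf_cong map_pmf_cong refl m_assoc)
      (auto dest: subsetD[OF set_conv_pow[OF \<kappa>]] subsetD[OF \<kappa>])
  also have "\<dots> = bind_pmf (conv_pow G \<kappa> m) (\<lambda>x. map_pmf (\<lambda>y. x \<otimes> y) (conv_pow G \<kappa> (Suc n)))"
    by (simp add: map_bind_pmf map_pmf_comp)
  finally show ?case .
qed

lemma pmf_conv_pow_mult_le:
  assumes \<kappa>: "set_pmf \<kappa> \<subseteq> carrier G" "finite (set_pmf \<kappa>)" and x: "x \<in> carrier G" "y \<in> carrier G"
  shows "pmf (conv_pow G \<kappa> m) x * pmf (conv_pow G \<kappa> n) y \<le> pmf (conv_pow G \<kappa> (m + n)) (x \<otimes> y)"
proof -
  have "pmf (map_pmf (\<lambda>y. x \<otimes> y) (conv_pow G \<kappa> n)) (x \<otimes> y) = pmf (conv_pow G \<kappa> n) (inv x \<otimes> (x \<otimes> y))"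
    by (rule pmf_map_left_inverse) (use x subsetD[OF set_conv_pow[OF \<kappa>(1)]] in \<open>auto simp: cancel_inv\<close>)
  then have "pmf (conv_pow G \<kappa> n) y \<le> pmf (map_pmf (\<lambda>y. x \<otimes> y) (conv_pow G \<kappa> n)) (x \<otimes> y)"
    using x by (simp add: cancel_inv)
  then have "pmf (conv_pow G \<kappa> m) x * pmf (conv_pow G \<kappa> n) y
    \<le> pmf (conv_pow G \<kappa> m) x * pmf (map_pmf (\<lambda>y. x \<otimes> y) (conv_pow G \<kappa> n)) (x \<otimes> y)"
    by (intro mult_left_mono) auto
  also have "\<dots> \<le> pmf (conv_pow G \<kappa> (m + n)) (x \<otimes> y)"
    unfolding conv_pow_add[OF \<kappa>(1)] by (rule pmf_bind_ge[OF finite_conv_pow[OF \<kappa>(2)]])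
  finally show ?thesis .
qed

lemma word_prod_in_conv_pow:
  assumes "set_pmf \<kappa> \<subseteq> carrier G" "set ws \<subseteq> set_pmf \<kappa>"
  shows "word_prod G ws \<in> set_pmf (conv_pow G \<kappa> (length ws))"
  using assms(2)
proof (induction ws)
  case Nil
  then show ?case by (simp add: word_prod_def)
next
  case (Cons a ws)
  have "set_pmf (conv_pow G \<kappa> (1 + length ws)) = set_pmf (bind_pmf (conv_pow G \<kappa> 1) (\<lambda>x. map_pmf (\<lambda>y. x \<otimes> y) (conv_pow G \<kappa> (length ws))))"
    by (subst conv_pow_add[OF assms(1)]) simp
  moreover have "conv_pow G \<kappa> 1 = map_pmf (\<lambda>g. \<one> \<otimes> g) \<kappa>" by (simp add: bind_return_pmf)
  ultimately have "set_pmf (conv_pow G \<kappa> (1 + length ws))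
      = (\<Union>x\<in>set_pmf \<kappa>. (\<lambda>y. (\<one> \<otimes> x) \<otimes> y) ` set_pmf (conv_pow G \<kappa> (length ws)))" by simp
  moreover have "a \<in> set_pmf \<kappa>" "\<one> \<otimes> a = a" using Cons assms(1) by auto
  ultimately show ?case using Cons by (force simp: word_prod_def)
qed

lemma pmf_conv_pow_Suc:
  assumes \<kappa>: "set_pmf \<kappa> \<subseteq> carrier G" "finite (set_pmf \<kappa>)" and z: "z \<in> carrier G"
  shows "pmf (conv_pow G \<kappa> (Suc n)) z = (\<Sum>g\<in>set_pmf \<kappa>. pmf \<kappa> g * pmf (conv_pow G \<kappa> n) (z \<otimes> inv g))"
proof -
  let ?N = "conv_pow G \<kappa> n"
  have N: "set_pmf ?N \<subseteq> carrier G" by (rule set_conv_pow[OF \<kappa>(1)])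
  have tr: "pmf (map_pmf (\<lambda>x. x \<otimes> g) ?N) z = pmf ?N (z \<otimes> inv g)" if g: "g \<in> set_pmf \<kappa>" for g
    by (rule pmf_map_left_inverse) (use N z subsetD[OF \<kappa>(1) g] in \<open>auto simp: cancel_inv subset_iff\<close>)
  have "conv_pow G \<kappa> (Suc n) = bind_pmf \<kappa> (\<lambda>g. map_pmf (\<lambda>x. x \<otimes> g) ?N)"
    using bind_commute_pmf[of ?N \<kappa> "\<lambda>x g. return_pmf (x \<otimes> g)"] by (simp add: map_pmf_def)
  then have "pmf (conv_pow G \<kappa> (Suc n)) z = (\<Sum>g\<in>set_pmf \<kappa>. pmf (map_pmf (\<lambda>x. x \<otimes> g) ?N) z * pmf \<kappa> g)"
    unfolding pmf_bind by (simp only:) (subst pmf_bind, rule integral_measure_pmf_real[OF \<kappa>(2)], simp)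
  also have "\<dots> = (\<Sum>g\<in>set_pmf \<kappa>. pmf \<kappa> g * pmf ?N (z \<otimes> inv g))"
    by (intro sum.cong) (auto simp: tr)
  finally show ?thesis .
qed

text \<open>
  At each point the loss in Jensen's inequality is a variance.  It is bounded below by comparing the increment
  \<open>\<one>\<close> with the increment \<open>inv y\<close>, for each \<open>y\<close> in \<open>Y\<close>, and the sum over all points of these
  squared differences is controlled by expansion.
\<close>

lemma convolution_contracts_l2:
  assumes Y: "expanding G Y"
    and \<kappa>: "set_pmf \<kappa> \<subseteq> carrier G" "finite (set_pmf \<kappa>)"
    and c: "c > 0" "c \<le> pmf \<kappa> \<one>" "\<And>y. y \<in> Y \<Longrightarrow> c \<le> pmf \<kappa> (inv y)"
    and F: "finite F" "F \<subseteq> carrier G" "\<And>x. x \<notin> F \<Longrightarrow> f x = (0::real)"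
    and F': "finite F'" "F \<subseteq> F'" "F' \<subseteq> carrier G"
  shows "(\<Sum>x\<in>F'. (\<Sum>g\<in>set_pmf \<kappa>. pmf \<kappa> g * f (x \<otimes> inv g))\<^sup>2) \<le> (1 - c / 288) * (\<Sum>x\<in>F. (f x)\<^sup>2)"
proof -
  define T where "T = set_pmf \<kappa>"
  define N where "N = (\<Sum>x\<in>F. (f x)\<^sup>2)"
  define A where "A x = (\<Sum>g\<in>T. pmf \<kappa> g * f (x \<otimes> inv g))" for x
  define B where "B x = (\<Sum>g\<in>T. pmf \<kappa> g * (f (x \<otimes> inv g))\<^sup>2)" for x
  have Y': "finite Y" "Y \<noteq> {}" "Y \<subseteq> carrier G"
    "card Y * N \<le> 144 * (\<Sum>x\<in>F. \<Sum>y\<in>Y. (f x - f (x \<otimes> y))\<^sup>2)"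
    using expandingD[OF Y] F unfolding N_def by simp_all
  have T1: "\<one> \<in> T" "\<And>y. y \<in> Y \<Longrightarrow> inv y \<in> T"
    unfolding T_def using c by (metis pmf_positive_iff less_le_trans)+
  have sumT: "(\<Sum>g\<in>T. pmf \<kappa> g) = 1" unfolding T_def using \<kappa>(2) by (rule sum_pmf_eq_1) simp
  have pt: "(A x)\<^sup>2 \<le> B x - c / 2 * (f x - f (x \<otimes> y))\<^sup>2" if x: "x \<in> carrier G" and y: "y \<in> Y" for x y
  proof -
    have "y \<in> carrier G" using y Y' by blast
    then show ?thesis
      using weighted_variance_ge[of T "pmf \<kappa>" \<one> "inv y" c "\<lambda>g. f (x \<otimes> inv g)"] \<kappa> sumT T1 c x y
      unfolding A_def B_def by (simp add: T_def)
  qed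
  have "card Y * (\<Sum>x\<in>F'. (A x)\<^sup>2) = (\<Sum>x\<in>F'. \<Sum>y\<in>Y. (A x)\<^sup>2)" by (simp add: sum_distrib_left)
  also have "\<dots> \<le> (\<Sum>x\<in>F'. \<Sum>y\<in>Y. B x - c / 2 * (f x - f (x \<otimes> y))\<^sup>2)"
    using F' by (intro sum_mono pt) auto
  also have "\<dots> = card Y * (\<Sum>x\<in>F'. B x) - c / 2 * (\<Sum>x\<in>F'. \<Sum>y\<in>Y. (f x - f (x \<otimes> y))\<^sup>2)"
    by (simp add: sum_subtractf sum_distrib_left)
  also have "\<dots> \<le> card Y * N - c / 2 * (card Y * N / 144)"
  proof (intro diff_mono mult_left_mono)
    have "(\<Sum>x\<in>F'. B x) = (\<Sum>g\<in>T. pmf \<kappa> g * (\<Sum>x\<in>F'. (f (x \<otimes> inv g))\<^sup>2))"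
      unfolding B_def by (subst sum.swap) (simp add: sum_distrib_left)
    also have "\<dots> \<le> (\<Sum>g\<in>T. pmf \<kappa> g * N)"
      unfolding N_def using \<kappa> F F'
      by (intro sum_mono mult_left_mono sum_translate_le[where f = "\<lambda>x. (f x)\<^sup>2"]) (auto simp: T_def)
    also have "\<dots> = N" using sumT by (simp add: sum_distrib_right[symmetric])
    finally show "(\<Sum>x\<in>F'. B x) \<le> N" .
    have "card Y * N / 144 \<le> (\<Sum>x\<in>F. \<Sum>y\<in>Y. (f x - f (x \<otimes> y))\<^sup>2)" using Y'(4) by simp
    also have "\<dots> \<le> (\<Sum>x\<in>F'. \<Sum>y\<in>Y. (f x - f (x \<otimes> y))\<^sup>2)"
      using F' by (intro sum_mono2) (auto simp: sum_nonneg)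
    finally show "card Y * N / 144 \<le> (\<Sum>x\<in>F'. \<Sum>y\<in>Y. (f x - f (x \<otimes> y))\<^sup>2)" .
  qed (use c in auto)
  also have "\<dots> = card Y * ((1 - c / 288) * N)" by (simp add: algebra_simps)
  finally have "card Y * (\<Sum>x\<in>F'. (A x)\<^sup>2) \<le> card Y * ((1 - c / 288) * N)" .
  moreover have "0 < real (card Y)" using Y' by (simp add: card_gt_0_iff)
  ultimately show ?thesis unfolding A_def N_def T_def by (simp only: mult_le_cancel_left_pos)
qed

lemma conv_pow_decay:
  assumes Y: "expanding G Y"
    and \<kappa>: "set_pmf \<kappa> \<subseteq> carrier G" "finite (set_pmf \<kappa>)"
    and pos: "\<one> \<in> set_pmf \<kappa>" "\<And>y. y \<in> Y \<Longrightarrow> inv y \<in> set_pmf \<kappa>"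
  shows "\<exists>\<rho>. 0 \<le> \<rho> \<and> \<rho> < 1 \<and> (\<forall>n x. pmf (conv_pow G \<kappa> n) x \<le> \<rho> ^ n)"
proof -
  have Yf: "finite Y" by (rule expandingD(1)[OF Y])
  define c where "c = Min (insert (pmf \<kappa> \<one>) ((\<lambda>y. pmf \<kappa> (inv y)) ` Y))"
  have "c \<in> insert (pmf \<kappa> \<one>) ((\<lambda>y. pmf \<kappa> (inv y)) ` Y)" unfolding c_def using Yf by (intro Min_in) auto
  then have c0: "c > 0" "c \<le> 1" using pos by (auto simp: pmf_positive_iff pmf_le_1)
  have c1: "c \<le> pmf \<kappa> \<one>" "\<And>y. y \<in> Y \<Longrightarrow> c \<le> pmf \<kappa> (inv y)" unfolding c_def using Yf by auto
  define q where "q = 1 - c / 288"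
  have q: "0 \<le> q" "q < 1" using c0 by (auto simp: q_def)
  have l2: "(\<Sum>x\<in>set_pmf (conv_pow G \<kappa> n). (pmf (conv_pow G \<kappa> n) x)\<^sup>2) \<le> q ^ n" for n
  proof (induction n)
    case (Suc n)
    let ?F = "set_pmf (conv_pow G \<kappa> n)" and ?F' = "set_pmf (conv_pow G \<kappa> (Suc n))"
    have sub: "?F \<subseteq> ?F'"
    proof
      fix x assume x: "x \<in> ?F"
      then have "x = x \<otimes> \<one>" using set_conv_pow[OF \<kappa>(1), of n] by auto
      then show "x \<in> ?F'" using x pos(1) by auto
    qed
    have "(\<Sum>x\<in>?F'. (pmf (conv_pow G \<kappa> (Suc n)) x)\<^sup>2)
      = (\<Sum>x\<in>?F'. (\<Sum>g\<in>set_pmf \<kappa>. pmf \<kappa> g * pmf (conv_pow G \<kappa> n) (x \<otimes> inv g))\<^sup>2)"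
      using set_conv_pow[OF \<kappa>(1), of "Suc n"]
      by (intro sum.cong refl arg_cong[where f = "\<lambda>t. t\<^sup>2"] pmf_conv_pow_Suc[OF \<kappa>]) blast
    also have "\<dots> \<le> (1 - c / 288) * (\<Sum>x\<in>?F. (pmf (conv_pow G \<kappa> n) x)\<^sup>2)"
      by (rule convolution_contracts_l2[OF Y \<kappa> c0(1) c1])
        (use finite_conv_pow[OF \<kappa>(2)] set_conv_pow[OF \<kappa>(1)] sub in \<open>auto simp: set_pmf_iff simp del: conv_pow.simps\<close>)
    also have "\<dots> \<le> q * q ^ n" unfolding q_def[symmetric] using Suc q by (intro mult_left_mono) auto
    finally show ?case by simp
  qed simp
  have "pmf (conv_pow G \<kappa> n) x \<le> sqrt q ^ n" for n x
  proof (cases "x \<in> set_pmf (conv_pow G \<kappa> n)")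
    case True
    have "(pmf (conv_pow G \<kappa> n) x)\<^sup>2 \<le> (\<Sum>x\<in>set_pmf (conv_pow G \<kappa> n). (pmf (conv_pow G \<kappa> n) x)\<^sup>2)"
      using True finite_conv_pow[OF \<kappa>(2)] by (intro member_le_sum) auto
    also have "\<dots> \<le> q ^ n" by (rule l2)
    finally have "pmf (conv_pow G \<kappa> n) x \<le> sqrt (q ^ n)" by (intro real_le_rsqrt)
    then show ?thesis by (simp add: real_sqrt_power)
  qed (use q in \<open>simp add: set_pmf_iff\<close>)
  then show ?thesis using q by (intro exI[of _ "sqrt q"]) auto
qed

end

context word_metric begin

abbreviation mean_len :: "'a pmf \<Rightarrow> nat \<Rightarrow> real" where
  "mean_len \<kappa> n \<equiv> measure_pmf.expectation (conv_pow G \<kappa> n) (\<lambda>x. real (len x))"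

text \<open>
  A ball of radius \<open>r\<close> has at most exponentially many points in \<open>r\<close>; if each has mass at most
  \<open>\<rho> ^ (J * r)\<close> with \<open>J\<close> large, the ball carries at most half of the mass.
\<close>

lemma expectation_len_linear:
  assumes \<kappa>: "set_pmf \<kappa> \<subseteq> carrier G" "finite (set_pmf \<kappa>)"
    and \<rho>: "0 \<le> \<rho>" "\<rho> < 1" "\<And>n x. pmf (conv_pow G \<kappa> n) x \<le> \<rho> ^ n"
  shows "\<exists>J. \<forall>r\<ge>1. real r / 2 \<le> mean_len \<kappa> (J * r)"
proof -
  define D where "D = Suc (card S)"
  have "(\<lambda>J. real D * \<rho> ^ J) \<longlonglongrightarrow> real D * 0"
    by (intro tendsto_mult tendsto_const LIMSEQ_power_zero) (use \<rho> in simp)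
  then have "\<forall>\<^sub>F J in sequentially. real D * \<rho> ^ J < 1 / 2" by (rule order_tendstoD) simp
  then obtain J where J: "real D * \<rho> ^ J < 1 / 2" by (auto simp: eventually_sequentially)
  have "real r / 2 \<le> mean_len \<kappa> (J * r)" if r: "r \<ge> 1" for r
  proof -
    let ?p = "conv_pow G \<kappa> (J * r)"
    have "measure_pmf.prob ?p (gball r) = (\<Sum>x\<in>gball r. pmf ?p x)"
      by (rule measure_measure_pmf_finite[OF finite_gball])
    also have "\<dots> \<le> (\<Sum>x\<in>gball r. \<rho> ^ (J * r))" by (intro sum_mono \<rho>)
    also have "\<dots> = real (card (gball r)) * (\<rho> ^ J) ^ r" by (simp add: power_mult)
    also have "\<dots> \<le> real (D ^ r) * (\<rho> ^ J) ^ r"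
      using card_gball_le[of r] \<rho>(1) unfolding D_def by (intro mult_right_mono) (simp_all only: of_nat_le_iff zero_le_power)
    also have "\<dots> = (real D * \<rho> ^ J) ^ r" by (simp add: power_mult_distrib)
    also have "\<dots> \<le> (1 / 2) ^ r" using J \<rho>(1) by (intro power_mono) auto
    also have "\<dots> \<le> (1 / 2) ^ 1" using r by (intro power_decreasing) auto
    finally have half: "measure_pmf.prob ?p (gball r) \<le> 1 / 2" by simp
    have fin: "finite (set_pmf ?p)" by (rule finite_conv_pow[OF \<kappa>(2)])
    have "real r * (1 - measure_pmf.prob ?p (gball r)) = measure_pmf.expectation ?p (\<lambda>x. real r * indicator (- gball r) x)"
      by (simp add: measure_pmf.prob_compl[symmetric] Compl_eq_Diff_UNIV[symmetric])
    also have "\<dots> \<le> measure_pmf.expectation ?p (\<lambda>x. real (len x))"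
      using set_conv_pow[OF \<kappa>(1), of "J * r"]
      by (intro integral_mono_AE integrable_measure_pmf_finite[OF fin])
         (auto simp: AE_measure_pmf_iff indicator_def gball_def)
    finally have "real r * (1 - measure_pmf.prob ?p (gball r)) \<le> measure_pmf.expectation ?p (\<lambda>x. real (len x))" .
    moreover have "real r * (1 / 2) \<le> real r * (1 - measure_pmf.prob ?p (gball r))"
      using half by (intro mult_left_mono) auto
    ultimately show ?thesis by simp
  qed
  then show ?thesis by blast
qed

text \<open>
  The law \<open>\<mu>\<close> itself may miss the identity and the inverses of \<open>Y\<close>, so decay is obtained for the average
  \<open>\<kappa>\<close> of the first \<open>L + 1\<close> convolution powers, with \<open>L\<close> so large that \<open>\<kappa>\<close> charges all these elements.
  The \<open>n\<close>-th convolution power of \<open>\<kappa>\<close> is a mixture of powers of \<open>\<mu>\<close> of order at most \<open>n L\<close>, so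
  linear escape for \<open>\<kappa>\<close> excludes sublinear mean length for \<open>\<mu>\<close>.
\<close>

lemma drift_not_sublinear:
  assumes Y: "expanding G Y" and \<mu>: "finite (set_pmf \<mu>)" "admissible G \<mu>"
  shows "\<exists>\<eta>>0::real. \<forall>C::real. \<exists>n. mean_len \<mu> n > \<eta> * n + C"
proof (rule ccontr)
  assume "\<not> ?thesis"
  then have sub: "\<exists>C. \<forall>n. mean_len \<mu> n \<le> \<eta> * n + C"
    if "\<eta> > 0" for \<eta> :: real using that by (meson not_less)
  have \<mu>c: "set_pmf \<mu> \<subseteq> carrier G" using \<mu> by (simp add: admissible_def)
  have Yc: "finite Y" "Y \<subseteq> carrier G" using expandingD[OF Y] by simp_all
  have "\<exists>n. x \<in> set_pmf (conv_pow G \<mu> n)" if "x \<in> carrier G" for x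
    using \<mu>(2) that word_prod_in_conv_pow[OF \<mu>c] unfolding admissible_def by metis
  then obtain t where t: "\<And>x. x \<in> carrier G \<Longrightarrow> x \<in> set_pmf (conv_pow G \<mu> (t x))" by metis
  define L where "L = Suc (\<Sum>y\<in>Y. t (inv y))"
  define \<kappa> where "\<kappa> = bind_pmf (pmf_of_set {..L}) (conv_pow G \<mu>)"
  have set\<kappa>: "set_pmf \<kappa> = (\<Union>i\<in>{..L}. set_pmf (conv_pow G \<mu> i))"
    unfolding \<kappa>_def by (simp add: set_pmf_of_set)
  have \<kappa>: "set_pmf \<kappa> \<subseteq> carrier G" "finite (set_pmf \<kappa>)"
    unfolding set\<kappa> using set_conv_pow[OF \<mu>c] finite_conv_pow[OF \<mu>(1)] by auto
  have one: "\<one> \<in> set_pmf \<kappa>" unfolding set\<kappa> by (intro UN_I[of 0]) auto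
  have invY: "inv y \<in> set_pmf \<kappa>" if "y \<in> Y" for y
  proof -
    have "t (inv y) \<le> L" unfolding L_def using that Yc by (intro le_SucI member_le_sum) auto
    then show ?thesis unfolding set\<kappa> using t[of "inv y"] that Yc by (intro UN_I[of "t (inv y)"]) auto
  qed
  from conv_pow_decay[OF Y \<kappa> one invY] obtain \<rho> where
    \<rho>: "0 \<le> \<rho>" "\<rho> < 1" "\<And>n x. pmf (conv_pow G \<kappa> n) x \<le> \<rho> ^ n" by blast
  from expectation_len_linear[OF \<kappa> \<rho>] obtain J where
    J: "\<And>r. r \<ge> 1 \<Longrightarrow> real r / 2 \<le> mean_len \<kappa> (J * r)" by blast
  \<comment> \<open>\<open>W\<close> is the law of a sum of \<open>n\<close> independent uniform times in \<open>{..L}\<close>.\<close>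
  have mix: "\<exists>W. set_pmf W \<subseteq> {..n * L} \<and> conv_pow G \<kappa> n = bind_pmf W (conv_pow G \<mu>)" for n
  proof (induction n)
    case 0
    then show ?case by (intro exI[of _ "return_pmf 0"]) (auto simp: bind_return_pmf)
  next
    case (Suc n)
    then obtain W where W: "set_pmf W \<subseteq> {..n * L}" "conv_pow G \<kappa> n = bind_pmf W (conv_pow G \<mu>)" by blast
    define V where "V = bind_pmf W (\<lambda>i. map_pmf (\<lambda>j. i + j) (pmf_of_set {..L}))"
    have "conv_pow G \<kappa> (Suc n) = bind_pmf (bind_pmf W (conv_pow G \<mu>)) (\<lambda>x. map_pmf (\<lambda>g. x \<otimes> g) \<kappa>)"
      using W(2) by simp
    also have "\<dots> = bind_pmf W (\<lambda>i. bind_pmf (conv_pow G \<mu> i)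
        (\<lambda>x. bind_pmf (pmf_of_set {..L}) (\<lambda>j. map_pmf (\<lambda>g. x \<otimes> g) (conv_pow G \<mu> j))))"
      by (simp add: \<kappa>_def bind_assoc_pmf map_bind_pmf)
    also have "\<dots> = bind_pmf W (\<lambda>i. bind_pmf (pmf_of_set {..L}) (\<lambda>j. conv_pow G \<mu> (i + j)))"
      unfolding conv_pow_add[OF \<mu>c] by (subst bind_commute_pmf) (rule refl)
    also have "\<dots> = bind_pmf V (conv_pow G \<mu>)"
      by (simp add: V_def bind_assoc_pmf bind_map_pmf)
    finally have "conv_pow G \<kappa> (Suc n) = bind_pmf V (conv_pow G \<mu>)" .
    moreover have "set_pmf V \<subseteq> {..Suc n * L}"
      using W(1) by (fastforce simp: V_def set_pmf_of_set)
    ultimately show ?case by blast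
  qed
  define \<eta> where "\<eta> = 1 / (4 * (real J + 1) * L)"
  have L0: "L > 0" by (simp add: L_def)
  have \<eta>: "\<eta> > 0" using L0 by (simp add: \<eta>_def)
  from sub[OF \<eta>] obtain C where
    C: "\<And>n. mean_len \<mu> n \<le> \<eta> * n + C" by blast
  have "real r / 4 \<le> C" if r: "r \<ge> 1" for r
  proof -
    obtain W where W: "set_pmf W \<subseteq> {..J * r * L}" "conv_pow G \<kappa> (J * r) = bind_pmf W (conv_pow G \<mu>)"
      using mix by blast
    have finW: "finite (set_pmf W)" using W(1) finite_subset by blast
    have "real r / 2 \<le> measure_pmf.expectation (bind_pmf W (conv_pow G \<mu>)) (\<lambda>x. real (len x))"
      using J[OF r] W(2) by simp
    also have "\<dots> = (\<Sum>i\<in>set_pmf W. pmf W i *\<^sub>R mean_len \<mu> i)"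
      using finite_conv_pow[OF \<mu>(1)] by (intro pmf_expectation_bind finW) auto
    also have "\<dots> \<le> (\<Sum>i\<in>set_pmf W. pmf W i * (\<eta> * (J * r * L) + C))"
    proof (rule sum_mono)
      fix i assume "i \<in> set_pmf W"
      then have "real i \<le> real (J * r * L)" using W(1) by (simp only: of_nat_le_iff) auto
      then have "\<eta> * real i \<le> \<eta> * (real J * real r * real L)" using \<eta> by (intro mult_left_mono) auto
      then have "mean_len \<mu> i \<le> \<eta> * (J * r * L) + C"
        using C[of i] by simp
      then show "pmf W i *\<^sub>R mean_len \<mu> i \<le> pmf W i * (\<eta> * (J * r * L) + C)"
        by (simp add: mult_left_mono)
    qed
    also have "\<dots> = \<eta> * (J * r * L) + C"
      using sum_pmf_eq_1[OF finW] by (simp add: sum_distrib_right[symmetric])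
    finally have "real r / 2 \<le> \<eta> * (J * r * L) + C" .
    moreover have "real J * real r * real L \<le> (real J + 1) * r * L" by (simp add: algebra_simps)
    then have "\<eta> * (J * r * L) \<le> \<eta> * ((real J + 1) * r * L)"
      using \<eta> by (intro mult_left_mono) auto
    moreover have "\<eta> * ((real J + 1) * r * L) = real r / 4"
    proof -
      have "1 / (4 * j * m) * (j * s * m) = s / 4" if "j > 0" "m > 0" for j m s :: real
        using that by (simp add: field_simps)
      from this[of "real J + 1" "real L" "real r"] show ?thesis using L0 by (simp add: \<eta>_def)
    qed
    ultimately show ?thesis by linarith
  qed
  moreover obtain r :: nat where r: "4 * \<bar>C\<bar> + 1 < real r" using reals_Archimedean2 by blast
  moreover from r have "r \<ge> 1" by linarith
  ultimately have "real r / 4 \<le> C" by blast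
  with r show False by linarith
qed

end

section \<open>The subadditive ergodic theorem for bounded processes\<close>

text \<open>
  Ergodicity is required for strictly invariant sets; \<open>subinvariant_trivial\<close> extends it to sets that
  are only mapped into themselves.
\<close>

locale ergodic_system = prob_space M for M :: "'a measure" +
  fixes T :: "'a \<Rightarrow> 'a"
  assumes T_meas [measurable]: "T \<in> M \<rightarrow>\<^sub>M M"
    and T_pres: "distr M M T = M"
    and ergodic: "A \<in> sets M \<Longrightarrow> T -` A \<inter> space M = A \<Longrightarrow> prob A = 0 \<or> prob A = 1"
begin

lemma funpow_meas [measurable]: "T ^^ n \<in> M \<rightarrow>\<^sub>M M"
  by (induction n) (auto simp: id_def intro: measurable_compose[OF _ T_meas])

lemma funpow_pres: "distr M M (T ^^ n) = M"
proof (induction n)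
  case 0
  have "distr M M (\<lambda>x. x) = M" by (rule distr_id2) simp
  then show ?case by (simp add: id_def)
next
  case (Suc n)
  have "distr M M (T ^^ Suc n) = distr (distr M M (T ^^ n)) M T"
    by (subst distr_distr) auto
  then show ?case using Suc T_pres by (simp add: o_def)
qed

lemma funpow_space: "\<omega> \<in> space M \<Longrightarrow> (T ^^ n) \<omega> \<in> space M"
  using measurable_space[OF funpow_meas] .

lemma integral_funpow:
  fixes h :: "'a \<Rightarrow> real"
  assumes [measurable]: "h \<in> borel_measurable M"
  shows "(\<integral>\<omega>. h ((T ^^ n) \<omega>) \<partial>M) = (\<integral>\<omega>. h \<omega> \<partial>M)"
  using integral_distr[OF funpow_meas assms, of n] by (simp add: funpow_pres)

lemma subinvariant_trivial:
  assumes A: "A \<in> sets M" and sub: "\<And>\<omega>. \<omega> \<in> A \<Longrightarrow> T \<omega> \<in> A"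
  shows "prob A = 0 \<or> prob A = 1"
proof -
  define B where "B n = (T ^^ n) -` A \<inter> space M" for n
  have B_meas [measurable]: "B n \<in> sets M" for n
    unfolding B_def using A by (rule measurable_sets[OF funpow_meas])
  have probB: "prob (B n) = prob A" for n
    using measure_distr[OF funpow_meas A, of n] by (simp add: funpow_pres B_def)
  have incB: "incseq B"
    using sub by (intro incseq_SucI) (auto simp: B_def)
  define U where "U = (\<Union>n. B n)"
  have U_meas: "U \<in> sets M" unfolding U_def by auto
  have "(\<lambda>n. prob (B n)) \<longlonglongrightarrow> prob U"
    unfolding U_def by (rule finite_Lim_measure_incseq) (auto simp: incB)
  then have "prob U = prob A" using probB by (simp add: LIMSEQ_const_iff)
  moreover have "T -` U \<inter> space M = U"
  proof -
    have "T -` U \<inter> space M = (\<Union>n. B (Suc n))"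
      using measurable_space[OF T_meas] by (auto simp: U_def B_def funpow_swap1)
    also have "\<dots> = U"
      using incseq_SucD[OF incB] unfolding U_def by blast
    finally show ?thesis .
  qed
  ultimately show ?thesis using ergodic[OF U_meas] by simp
qed

text \<open>
  Cut \<open>{..<n}\<close> greedily into blocks.  At a point of \<open>G\<close> take a block of length at most \<open>K\<close> on
  which \<open>f\<close> grows at rate at most \<open>a\<close>; at any other point advance by a single step, at cost \<open>C\<close>.  The last
  incomplete block costs at most \<open>C K\<close>.
\<close>

lemma covering_bound:
  fixes f :: "nat \<Rightarrow> 'a \<Rightarrow> real" and C a :: real
  assumes bd: "\<And>n \<omega>. \<omega> \<in> space M \<Longrightarrow> f n \<omega> \<le> C * n"
    and subadd: "\<And>m n \<omega>. \<omega> \<in> space M \<Longrightarrow> f (m + n) \<omega> \<le> f m \<omega> + f n ((T ^^ m) \<omega>)"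
    and C: "C \<ge> 0" and a: "a \<ge> 0" and K: "K \<ge> 1"
    and G: "\<And>\<omega>. \<omega> \<in> space M \<Longrightarrow> \<omega> \<in> G \<Longrightarrow> \<exists>k\<in>{1..K}. f k \<omega> \<le> a * k"
  shows "\<omega> \<in> space M \<Longrightarrow> f n \<omega> \<le> a * n + C * (\<Sum>i<n. indicator (- G) ((T ^^ i) \<omega>)) + C * K"
proof (induction n arbitrary: \<omega> rule: less_induct)
  case (less n)
  let ?b = "\<lambda>i \<omega>. indicator (- G) ((T ^^ i) \<omega>) :: real"
  have sh: "(\<Sum>i<n - k. ?b i ((T ^^ k) \<omega>)) = (\<Sum>i=k..<n. ?b i \<omega>)" if "k \<le> n" for k
  proof -
    have "(\<Sum>i<n - k. ?b i ((T ^^ k) \<omega>)) = (\<Sum>i<n - k. ?b (i + k) \<omega>)" by (simp add: funpow_add)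
    also have "\<dots> = (\<Sum>i=0+k..<n - k + k. ?b i \<omega>)"
      unfolding sum.shift_bounds_nat_ivl by (simp add: atLeast0LessThan)
    finally show ?thesis using that by simp
  qed
  show ?case
  proof (cases "n \<le> K")
    case True
    have "f n \<omega> \<le> C * K" using bd[OF less.prems, of n] True C by (meson mult_left_mono of_nat_le_iff order_trans)
    moreover have "0 \<le> a * n" "0 \<le> C * (\<Sum>i<n. ?b i \<omega>)" using a C by (auto intro!: mult_nonneg_nonneg sum_nonneg)
    ultimately show ?thesis by linarith
  next
    case nK: False
    have step: "f n \<omega> \<le> f k \<omega> + (a * (real n - real k) + C * (\<Sum>i=k..<n. ?b i \<omega>) + C * K)"
      if k: "1 \<le> k" "k \<le> K" for k
    proof -
      have "f n \<omega> \<le> f k \<omega> + f (n - k) ((T ^^ k) \<omega>)"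
        using subadd[OF less.prems, of k "n - k"] k nK by simp
      also have "f (n - k) ((T ^^ k) \<omega>) \<le> a * real (n - k) + C * (\<Sum>i<n - k. ?b i ((T ^^ k) \<omega>)) + C * K"
        using k nK by (intro less.IH funpow_space less.prems) auto
      also have "\<dots> = a * (real n - real k) + C * (\<Sum>i=k..<n. ?b i \<omega>) + C * K"
        using k nK sh[of k] by (simp add: of_nat_diff)
      finally show ?thesis by simp
    qed
    show ?thesis
    proof (cases "\<omega> \<in> G")
      case True
      then obtain k where k: "1 \<le> k" "k \<le> K" "f k \<omega> \<le> a * k" using G[OF less.prems] by auto
      have "(\<Sum>i=k..<n. ?b i \<omega>) \<le> (\<Sum>i<n. ?b i \<omega>)" by (intro sum_mono2) auto
      then have "C * (\<Sum>i=k..<n. ?b i \<omega>) \<le> C * (\<Sum>i<n. ?b i \<omega>)" using C by (rule mult_left_mono)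
      with step[OF k(1,2)] k(3) show ?thesis by (simp add: algebra_simps)
    next
      case False
      have "(\<Sum>i<n. ?b i \<omega>) = ?b 0 \<omega> + (\<Sum>i=1..<n. ?b i \<omega>)"
        using nK by (simp add: atLeast0LessThan[symmetric] sum.atLeast_Suc_lessThan)
      then have "C * (\<Sum>i<n. ?b i \<omega>) = C + C * (\<Sum>i=1..<n. ?b i \<omega>)"
        using False by (simp add: algebra_simps)
      moreover have "f 1 \<omega> \<le> C" using bd[OF less.prems, of 1] by simp
      ultimately show ?thesis using step[of 1] K a by (simp add: algebra_simps)
    qed
  qed
qed

text \<open>
  The set \<open>U a\<close> where the lower limit of \<open>f n / n\<close> is at least \<open>a\<close> is mapped into itself by
  subadditivity, hence trivial.  If \<open>U L\<close> had probability \<open>0\<close>, so would \<open>U a\<close> for some \<open>a < L\<close>, and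
  almost every point would start a block of rate at most \<open>a\<close>.  Integrating the covering bound, where
  blocks of bounded length suffice outside a set of probability \<open>\<epsilon>\<close>, contradicts that the means of
  \<open>f n\<close> are at least \<open>L n\<close>.
\<close>

lemma subadditive_liminf:
  fixes f :: "nat \<Rightarrow> 'a \<Rightarrow> real" and C L :: real
  assumes meas [measurable]: "\<And>n. f n \<in> borel_measurable M"
    and pos: "\<And>n \<omega>. \<omega> \<in> space M \<Longrightarrow> 0 \<le> f n \<omega>"
    and bd: "\<And>n \<omega>. \<omega> \<in> space M \<Longrightarrow> f n \<omega> \<le> C * n"
    and subadd: "\<And>m n \<omega>. \<omega> \<in> space M \<Longrightarrow> f (m + n) \<omega> \<le> f m \<omega> + f n ((T ^^ m) \<omega>)"
    and L: "\<And>n. L * n \<le> (\<integral>\<omega>. f n \<omega> \<partial>M)"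
  shows "AE \<omega> in M. \<forall>y<L. \<forall>\<^sub>F n in sequentially. y < f n \<omega> / n"
proof -
  have C: "C \<ge> 0"
  proof -
    obtain \<omega> where "\<omega> \<in> space M" using not_empty by blast
    from pos[OF this, of 1] bd[OF this, of 1] show ?thesis by simp
  qed
  define U where "U a = {\<omega> \<in> space M. \<forall>k::nat. \<forall>\<^sub>F n in sequentially. a - 1 / Suc k < f n \<omega> / n}" for a :: real
  have U_meas [measurable]: "U a \<in> sets M" for a unfolding U_def eventually_sequentially by measurable
  have U_iff: "\<omega> \<in> U a \<longleftrightarrow> (\<forall>y<a. \<forall>\<^sub>F n in sequentially. y < f n \<omega> / n)" if "\<omega> \<in> space M" for \<omega> and a :: real
  proof
    assume u: "\<omega> \<in> U a"
    show "\<forall>y<a. \<forall>\<^sub>F n in sequentially. y < f n \<omega> / n"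
    proof (intro allI impI)
      fix y assume "y < a"
      then obtain k where "1 / real (Suc k) < a - y" using reals_Archimedean[of "a - y"] by (auto simp: inverse_eq_divide)
      moreover have "\<forall>\<^sub>F n in sequentially. a - 1 / Suc k < f n \<omega> / n" using u by (auto simp: U_def)
      ultimately show "\<forall>\<^sub>F n in sequentially. y < f n \<omega> / n" by (auto elim: eventually_mono)
    qed
  qed (use that in \<open>auto simp: U_def\<close>)
  have U01: "prob (U a) = 0 \<or> prob (U a) = 1" for a
  proof (rule subinvariant_trivial)
    fix \<omega> assume u: "\<omega> \<in> U a"
    then have sp: "\<omega> \<in> space M" by (simp add: U_def)
    then have spT: "T \<omega> \<in> space M" using measurable_space[OF T_meas] by blast
    have "\<forall>\<^sub>F n in sequentially. y < f n (T \<omega>) / n" if ya: "y < a" for y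
    proof -
      obtain z where z: "y < z" "z < a" using dense[OF ya] by blast
      have "\<forall>\<^sub>F n in sequentially. z < f n \<omega> / n" using u z(2) U_iff[OF sp] by blast
      then have ev1: "\<forall>\<^sub>F n in sequentially. z < f (Suc n) \<omega> / Suc n" by (subst eventually_sequentially_Suc[of "\<lambda>n. z < f n \<omega> / n"])
      have "(\<lambda>n. C / Suc n) \<longlonglongrightarrow> 0"
        using LIMSEQ_Suc[OF lim_const_over_n[of C]] by simp
      then have ev2: "\<forall>\<^sub>F n in sequentially. C / Suc n < z - y" using z by (intro order_tendstoD(2)[of _ 0]) auto
      from ev1 ev2 eventually_gt_at_top[of 0] show ?thesis
      proof eventually_elim
        case (elim n)
        have "f (Suc n) \<omega> \<le> f 1 \<omega> + f n (T \<omega>)" using subadd[OF sp, of 1 n] by simp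
        also have "f 1 \<omega> \<le> C" using bd[OF sp, of 1] by simp
        finally have "f (Suc n) \<omega> / Suc n \<le> C / Suc n + f n (T \<omega>) / Suc n"
          by (simp add: divide_right_mono flip: add_divide_distrib)
        moreover have "f n (T \<omega>) / Suc n \<le> f n (T \<omega>) / n"
          using pos[OF spT, of n] elim by (intro divide_left_mono) auto
        ultimately show ?case using elim by linarith
      qed
    qed
    then show "T \<omega> \<in> U a" using U_iff[OF spT] by blast
  qed simp
  have "prob (U L) = 1"
  proof (rule ccontr)
    assume UL: "prob (U L) \<noteq> 1"
    have "\<exists>a<L. prob (U a) = 0"
    proof (rule ccontr)
      assume "\<not> ?thesis"
      then have "prob (U (L - 1 / Suc k)) = 1" for k using U01 by (metis diff_less_eq less_add_same_cancel1 of_nat_0_less_iff zero_less_Suc zero_less_divide_1_iff)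
      then have "AE \<omega> in M. \<omega> \<in> U (L - 1 / Suc k)" for k
        by (subst prob_eq_1[symmetric]) auto
      then have "AE \<omega> in M. \<forall>k. \<omega> \<in> U (L - 1 / Suc k)" by (simp add: AE_all_countable)
      then have "AE \<omega> in M. \<omega> \<in> U L"
      proof (rule AE_mp, intro AE_I2 impI)
        fix \<omega> assume sp: "\<omega> \<in> space M" and u: "\<forall>k. \<omega> \<in> U (L - 1 / Suc k)"
        show "\<omega> \<in> U L" unfolding U_iff[OF sp]
        proof (intro allI impI)
          fix y assume "y < L"
          then obtain k where "1 / real (Suc k) < L - y" using reals_Archimedean[of "L - y"] by (auto simp: inverse_eq_divide)
          then have "y < L - 1 / Suc k" by linarith
          then show "\<forall>\<^sub>F n in sequentially. y < f n \<omega> / n" using u U_iff[OF sp] by blast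
        qed
      qed
      then have "prob (U L) = 1" by (subst prob_eq_1) auto
      with UL show False by simp
    qed
    then obtain a where a: "a < L" "prob (U a) = 0" by blast
    define G where "G K = {\<omega> \<in> space M. \<exists>k\<in>{1..K}. f k \<omega> \<le> a * k}" for K :: nat
    have G_meas [measurable]: "G K \<in> sets M" for K unfolding G_def by measurable
    have "AE \<omega> in M. \<omega> \<notin> U a" using a(2) by (subst prob_eq_0[symmetric]) auto
    then have AEG: "AE \<omega> in M. \<omega> \<in> (\<Union>K. G K)"
    proof (rule AE_mp, intro AE_I2 impI)
      fix \<omega> assume sp: "\<omega> \<in> space M" and "\<omega> \<notin> U a"
      then obtain y where y: "y < a" "\<not> (\<forall>\<^sub>F n in sequentially. y < f n \<omega> / n)" using U_iff[OF sp] by blast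
      then obtain n where n: "n \<ge> 1" "f n \<omega> / n \<le> y" unfolding eventually_sequentially by (metis not_less)
      then have "f n \<omega> \<le> y * n" by (simp add: field_simps)
      also have "\<dots> \<le> a * n" using y by (intro mult_right_mono) auto
      finally show "\<omega> \<in> (\<Union>K. G K)" using n sp by (auto simp: G_def intro!: exI[of _ n] bexI[of _ n])
    qed
    have incG: "incseq G" by (intro incseq_SucI) (auto simp: G_def)
    have "(\<lambda>K. prob (G K)) \<longlonglongrightarrow> prob (\<Union>K. G K)"
      by (rule finite_Lim_measure_incseq) (auto simp: incG)
    moreover have "prob (\<Union>K. G K) = 1" using AEG by (subst prob_eq_1) auto
    ultimately have limG: "(\<lambda>K. prob (G K)) \<longlonglongrightarrow> 1" by simp
    have a0: "a \<ge> 0"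
    proof -
      have "\<forall>\<^sub>F K in sequentially. 0 < prob (G K)" using limG by (rule order_tendstoD) simp
      then obtain K where "0 < prob (G K)" by (auto simp: eventually_sequentially)
      then have "G K \<noteq> {}" by auto
      then obtain \<omega> k where "\<omega> \<in> space M" "k \<ge> 1" "f k \<omega> \<le> a * k" by (auto simp: G_def)
      then have "0 \<le> a * real k" using pos[of \<omega> k] by linarith
      then show ?thesis using \<open>k \<ge> 1\<close> by (simp add: zero_le_mult_iff)
    qed
    \<comment> \<open>Then \<open>C \<epsilon> \<le> (L - a) / 2\<close>, so that the rate \<open>a + C \<epsilon>\<close> stays below \<open>L\<close>.\<close>
    define \<epsilon> where "\<epsilon> = (L - a) / (2 * (C + 1))"
    have \<epsilon>: "\<epsilon> > 0" using a C by (simp add: \<epsilon>_def)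
    have "\<forall>\<^sub>F K in sequentially. 1 - \<epsilon> < prob (G K) \<and> K \<ge> 1"
      using order_tendstoD(1)[OF limG, of "1 - \<epsilon>"] \<epsilon> eventually_ge_at_top[of 1] by (auto intro: eventually_conj)
    then obtain K where K: "1 - \<epsilon> < prob (G K)" "K \<ge> 1" by (auto simp: eventually_sequentially)
    have main: "L * n \<le> a * n + C * (n * \<epsilon>) + C * K" for n :: nat
    proof -
      have ind: "(\<integral>\<omega>. indicat_real (- G K) ((T ^^ i) \<omega>) \<partial>M) \<le> \<epsilon>" for i
      proof -
        have "(\<integral>\<omega>. indicat_real (- G K) ((T ^^ i) \<omega>) \<partial>M) = (\<integral>\<omega>. indicat_real (space M - G K) ((T ^^ i) \<omega>) \<partial>M)"
          by (intro Bochner_Integration.integral_cong) (auto simp: indicator_def funpow_space)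
        also have "\<dots> = (\<integral>\<omega>. indicat_real (space M - G K) \<omega> \<partial>M)" by (intro integral_funpow) measurable
        also have "\<dots> = 1 - prob (G K)" by (simp add: prob_compl)
        finally show ?thesis using K by simp
      qed
      have indm [measurable]: "(\<lambda>\<omega>. indicat_real (- G K) ((T ^^ i) \<omega>) :: real) \<in> borel_measurable M" for i
      proof -
        have "(\<lambda>\<omega>. indicat_real (space M - G K) ((T ^^ i) \<omega>) :: real) \<in> borel_measurable M" by measurable
        then show ?thesis
          by (rule measurable_cong[THEN iffD1, rotated]) (auto simp: indicator_def funpow_space)
      qed
      have int: "integrable M (\<lambda>\<omega>. indicat_real (- G K) ((T ^^ i) \<omega>) :: real)" for i
        by (rule integrable_const_bound[where B = 1]) auto
      have "L * n \<le> (\<integral>\<omega>. f n \<omega> \<partial>M)" by (rule L)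
      also have "\<dots> \<le> (\<integral>\<omega>. a * n + C * (\<Sum>i<n. indicat_real (- G K) ((T ^^ i) \<omega>)) + C * K \<partial>M)"
      proof (rule integral_mono)
        show "integrable M (f n)"
          by (rule integrable_const_bound[where B = "C * n"]) (auto intro!: AE_I2 simp: pos bd)
        show "integrable M (\<lambda>\<omega>. a * n + C * (\<Sum>i<n. indicat_real (- G K) ((T ^^ i) \<omega>)) + C * K)"
          by (intro Bochner_Integration.integrable_add integrable_mult_right Bochner_Integration.integrable_sum int) auto
        show "f n \<omega> \<le> a * n + C * (\<Sum>i<n. indicat_real (- G K) ((T ^^ i) \<omega>)) + C * K" if "\<omega> \<in> space M" for \<omega>
          by (rule covering_bound[OF bd subadd C a0 K(2) _ that]) (auto simp: G_def)
      qed
      also have "\<dots> = a * n + C * (\<Sum>i<n. \<integral>\<omega>. indicat_real (- G K) ((T ^^ i) \<omega>) \<partial>M) + C * K"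
        using int by (simp add: prob_space)
      also have "\<dots> \<le> a * n + C * (\<Sum>i<n. \<epsilon>) + C * K"
        by (intro add_mono mult_left_mono sum_mono ind C order_refl)
      finally show ?thesis by simp
    qed
    have "C * \<epsilon> \<le> (C + 1) * \<epsilon>" using \<epsilon> by simp
    also have "\<dots> = (L - a) / 2" using C by (simp add: \<epsilon>_def field_simps)
    finally have Ce: "C * \<epsilon> \<le> (L - a) / 2" .
    have "(L - a) / 2 * n \<le> C * K" for n :: nat
    proof -
      have "(L - a) * n \<le> (C * \<epsilon>) * n + C * K" using main[of n] by (simp add: algebra_simps)
      moreover have "(C * \<epsilon>) * n \<le> (L - a) / 2 * n" using Ce by (intro mult_right_mono) auto
      ultimately show ?thesis by (simp add: field_simps)
    qed
    moreover obtain n :: nat where "C * K < n * ((L - a) / 2)"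
      using ex_less_of_nat_mult[of "(L - a) / 2" "C * K"] a by auto
    ultimately show False by (metis mult.commute not_less)
  qed
  then have "AE \<omega> in M. \<omega> \<in> U L" by (subst prob_eq_1[symmetric]) auto
  then show ?thesis by (rule AE_mp) (auto intro!: AE_I2 simp: U_iff)
qed

end

text \<open>
  Kingman's theorem for bounded increments.  The limit is the infimum \<open>L\<close> of \<open>e n / n\<close>, \<open>e n\<close> being
  the mean of \<open>f n\<close>.  For the upper bound, \<open>f n\<close> is at most a sum of \<open>f m\<close> over consecutive blocks of
  length \<open>m\<close>; such a sum is additive under \<open>T ^^ m\<close>, and the preceding lemma for the complementary additive process
  \<open>h\<close> bounds it from above.  This is why all iterates of \<open>T\<close> are assumed ergodic.
\<close>

lemma subadditive_ergodic:
  fixes f :: "nat \<Rightarrow> 'a \<Rightarrow> real" and C :: real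
  assumes T: "\<And>m. m \<ge> 1 \<Longrightarrow> ergodic_system M (T ^^ m)"
    and meas [measurable]: "\<And>n. f n \<in> borel_measurable M"
    and pos: "\<And>n \<omega>. \<omega> \<in> space M \<Longrightarrow> 0 \<le> f n \<omega>"
    and bd: "\<And>n \<omega>. \<omega> \<in> space M \<Longrightarrow> f n \<omega> \<le> C * n"
    and subadd: "\<And>m n \<omega>. \<omega> \<in> space M \<Longrightarrow> f (m + n) \<omega> \<le> f m \<omega> + f n ((T ^^ m) \<omega>)"
  shows "\<exists>L. (AE \<omega> in M. (\<lambda>n. f n \<omega> / n) \<longlonglongrightarrow> L) \<and> (\<lambda>n. (\<integral>\<omega>. f n \<omega> \<partial>M) / n) \<longlonglongrightarrow> L"
proof -
  interpret ergodic_system M T using T[of 1] by simp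
  have C: "C \<ge> 0"
  proof -
    obtain \<omega> where "\<omega> \<in> space M" using not_empty by blast
    from pos[OF this, of 1] bd[OF this, of 1] show ?thesis by simp
  qed
  have int: "integrable M (f n)" for n
    by (rule integrable_const_bound[where B = "C * n"]) (auto intro!: AE_I2 simp: pos bd)
  define e where "e n = (\<integral>\<omega>. f n \<omega> \<partial>M)" for n
  have e0: "e n \<ge> 0" for n unfolding e_def by (intro integral_nonneg_AE) (auto simp: pos)
  define L where "L = (INF n\<in>{1..}. e n / n)"
  have bdd: "bdd_below ((\<lambda>n. e n / n) ` {1..})" by (rule bdd_belowI[where m = 0]) (auto simp: e0)
  have Le: "L * n \<le> e n" for n :: nat
  proof (cases "n = 0")
    case False
    then have "L \<le> e n / n" unfolding L_def by (intro cINF_lower bdd) auto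
    then show ?thesis using False by (simp add: field_simps)
  qed (simp add: e0)
  have lower: "AE \<omega> in M. \<forall>y<L. \<forall>\<^sub>F n in sequentially. y < f n \<omega> / n"
    by (rule subadditive_liminf[OF meas pos bd subadd]) (use Le in \<open>auto simp: e_def\<close>)
  have upper: "AE \<omega> in M. \<forall>y>e m / m. \<forall>\<^sub>F n in sequentially. f n \<omega> / n < y" if m: "m \<ge> 1" for m
  proof -
    interpret Tm: ergodic_system M "T ^^ m" using T[OF m] .
    define S where "S k \<omega> = (\<Sum>j<k. f m (((T ^^ m) ^^ j) \<omega>))" for k \<omega>
    define h where "h k \<omega> = C * m * k - S k \<omega>" for k :: nat and \<omega>
    have S_meas [measurable]: "S k \<in> borel_measurable M" for k unfolding S_def by measurable
    have "AE \<omega> in M. \<forall>y<C * m - e m. \<forall>\<^sub>F n in sequentially. y < h n \<omega> / n"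
    proof (rule Tm.subadditive_liminf)
      show "h n \<in> borel_measurable M" for n unfolding h_def by measurable
      show "0 \<le> h n \<omega>" if "\<omega> \<in> space M" for n \<omega>
      proof -
        have "S n \<omega> \<le> (\<Sum>j<n. C * m)" unfolding S_def using bd Tm.funpow_space[OF that] by (intro sum_mono) auto
        then show ?thesis by (simp add: h_def algebra_simps)
      qed
      show "h n \<omega> \<le> (C * m) * n" if "\<omega> \<in> space M" for n \<omega>
        using pos Tm.funpow_space[OF that] by (auto simp: h_def S_def intro!: sum_nonneg)
      show "h (k + n) \<omega> \<le> h k \<omega> + h n (((T ^^ m) ^^ k) \<omega>)" if "\<omega> \<in> space M" for k n \<omega>
      proof -
        have "S n (((T ^^ m) ^^ k) \<omega>) = (\<Sum>j<n. f m (((T ^^ m) ^^ (k + j)) \<omega>))"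
          unfolding S_def by (simp add: funpow_add add.commute[of k])
        moreover have "S (k + n) \<omega> = S k \<omega> + (\<Sum>j<n. f m (((T ^^ m) ^^ (k + j)) \<omega>))"
          unfolding S_def by (induction n) auto
        ultimately show ?thesis by (simp add: h_def algebra_simps)
      qed
      show "(C * m - e m) * n \<le> (\<integral>\<omega>. h n \<omega> \<partial>M)" for n
      proof -
        have i: "integrable M (\<lambda>\<omega>. f m (((T ^^ m) ^^ j) \<omega>))" for j
          by (rule integrable_const_bound[where B = "C * m"]) (auto intro!: AE_I2 simp: pos bd Tm.funpow_space)
        have "(\<integral>\<omega>. S n \<omega> \<partial>M) = (\<Sum>j<n. e m)"
          unfolding S_def using i Tm.integral_funpow[OF meas] by (simp add: e_def)
        moreover have "integrable M (S n)" unfolding S_def using i by auto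
        ultimately show ?thesis by (simp add: h_def prob_space algebra_simps)
      qed
    qed
    then show ?thesis
    proof (rule AE_mp, intro AE_I2 impI allI)
      fix \<omega> y assume sp: "\<omega> \<in> space M" and ev: "\<forall>y<C * m - e m. \<forall>\<^sub>F n in sequentially. y < h n \<omega> / n"
        and y: "e m / m < y"
      have m0: "real m > 0" using m by simp
      obtain z where z: "e m / m < z" "z < y" using dense[OF y] by blast
      have z0: "z > 0" using z(1) e0[of m] m0 by (smt (verit) divide_nonneg_pos)
      have "C * m - z * m < C * m - e m" using z m0 by (simp add: field_simps)
      then have "\<forall>\<^sub>F k in sequentially. C * m - z * m < h k \<omega> / k" using ev by blast
      then have ev1: "\<forall>\<^sub>F n in sequentially. C * m - z * m < h (n div m) \<omega> / (n div m)"
      proof -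
        assume "\<forall>\<^sub>F k in sequentially. C * m - z * m < h k \<omega> / k"
        then obtain N where N: "\<And>k. k \<ge> N \<Longrightarrow> C * m - z * m < h k \<omega> / k"
          by (auto simp: eventually_sequentially)
        have "n div m \<ge> N" if "n \<ge> N * m" for n
          using div_le_mono[OF that, of m] m by simp
        then show ?thesis using N unfolding eventually_sequentially by blast
      qed
      have "(\<lambda>n. (C * m) / real n) \<longlonglongrightarrow> 0" by (rule lim_const_over_n)
      then have ev2: "\<forall>\<^sub>F n in sequentially. (C * m) / real n < y - z" using z by (intro order_tendstoD(2)[of _ 0]) auto
      show "\<forall>\<^sub>F n in sequentially. f n \<omega> / n < y"
        using ev1 ev2 eventually_ge_at_top[of m]
      proof eventually_elim
        case (elim n)
        define k where "k = n div m"
        have k0: "k > 0" using elim m unfolding k_def by (simp add: div_greater_zero_iff)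
        have n0: "real n > 0" using elim m by simp
        have blocks: "f (j * m) \<omega> \<le> S j \<omega>" for j
        proof (induction j)
          case 0
          then show ?case using bd[OF sp, of 0] by (simp add: S_def)
        next
          case (Suc j)
          have "f (j * m + m) \<omega> \<le> f (j * m) \<omega> + f m ((T ^^ (j * m)) \<omega>)" by (rule subadd[OF sp])
          also have "(T ^^ (j * m)) \<omega> = ((T ^^ m) ^^ j) \<omega>" by (simp add: funpow_mult mult.commute)
          finally show ?case using Suc by (simp add: S_def add.commute)
        qed
        have "f n \<omega> \<le> f (k * m) \<omega> + f (n mod m) ((T ^^ (k * m)) \<omega>)"
          using subadd[OF sp, of "k * m" "n mod m"] by (simp add: k_def)
        also have "f (n mod m) ((T ^^ (k * m)) \<omega>) \<le> C * real (n mod m)" using bd[OF funpow_space[OF sp]] .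
        also have "\<dots> \<le> C * m" using C m by (intro mult_left_mono) auto
        also have "f (k * m) \<omega> \<le> S k \<omega>" by (rule blocks)
        also have "S k \<omega> \<le> z * m * k" using elim(1) k0 by (simp add: k_def[symmetric] h_def field_simps)
        also have "z * m * k = z * real (m * k)" by simp
        also have "\<dots> \<le> z * real n" using z0 unfolding k_def by (intro mult_left_mono) (simp_all only: of_nat_le_iff times_div_less_eq_dividend)
        finally have "f n \<omega> \<le> z * n + C * m" by simp
        then have "f n \<omega> / n \<le> z + C * m / n" using n0 by (simp add: field_simps)
        then show ?case using elim(2) by linarith
      qed
    qed
  qed
  have "AE \<omega> in M. \<forall>m\<in>{1..}. \<forall>y>e m / m. \<forall>\<^sub>F n in sequentially. f n \<omega> / n < y"
    by (subst AE_ball_countable) (use upper in auto)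
  with lower have conv: "AE \<omega> in M. (\<lambda>n. f n \<omega> / n) \<longlonglongrightarrow> L"
  proof eventually_elim
    case (elim \<omega>)
    show ?case
    proof (rule order_tendstoI)
      fix y assume "y < L" then show "\<forall>\<^sub>F n in sequentially. y < f n \<omega> / n" using elim by blast
    next
      fix y assume "L < y"
      then obtain m where "m \<ge> 1" "e m / m < y" unfolding L_def using cINF_less_iff[OF _ bdd] by auto
      then show "\<forall>\<^sub>F n in sequentially. f n \<omega> / n < y" using elim by auto
    qed
  qed
  have "(\<lambda>n. \<integral>\<omega>. f n \<omega> / n \<partial>M) \<longlonglongrightarrow> (\<integral>\<omega>. L \<partial>M)"
  proof (rule integral_dominated_convergence[where w = "\<lambda>_. C"])
    show "AE \<omega> in M. norm (f n \<omega> / real n) \<le> C" for n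
    proof (rule AE_I2)
      fix \<omega> assume sp: "\<omega> \<in> space M"
      show "norm (f n \<omega> / real n) \<le> C"
        using pos[OF sp, of n] bd[OF sp, of n] C by (cases "n = 0") (auto simp: field_simps)
    qed
  qed (use conv in auto)
  then have "(\<lambda>n. e n / n) \<longlonglongrightarrow> L" by (simp add: e_def prob_space)
  with conv show ?thesis unfolding e_def by blast
qed

section \<open>Independent increments\<close>

definition shift_seq :: "(nat \<Rightarrow> 'c) \<Rightarrow> nat \<Rightarrow> 'c" where
  "shift_seq \<omega> = (\<lambda>i. \<omega> (Suc i))"

lemma shift_seq_funpow: "(shift_seq ^^ m) \<omega> = (\<lambda>i. \<omega> (i + m))"
  by (induction m) (auto simp: shift_seq_def fun_eq_iff)

text \<open>
  A set invariant under the \<open>m\<close>-fold shift is its own preimage under the \<open>m n\<close>-fold shift, hence depends on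
  coordinates from \<open>n\<close> on only, for every \<open>n\<close>.  So it is a tail event, and Kolmogorov's
  zero-one law applies.
\<close>

lemma shift_ergodic:
  assumes M: "prob_space M" and m: "m \<ge> 1"
  shows "ergodic_system (\<Pi>\<^sub>M i\<in>(UNIV::nat set). M) (shift_seq ^^ m)"
proof -
  let ?P = "\<Pi>\<^sub>M i\<in>(UNIV::nat set). M"
  interpret P: prob_space ?P by (rule prob_space_PiM) (rule M)
  have sh: "shift_seq ^^ k = (\<lambda>\<omega> i. \<omega> (i + k))" for k :: nat
    by (simp add: fun_eq_iff shift_seq_funpow)
  have sh_meas: "(shift_seq ^^ k) \<in> ?P \<rightarrow>\<^sub>M ?P" for k
    unfolding sh by (rule measurable_PiM_single') (auto simp: space_PiM PiE_iff)
  have pres: "distr ?P ?P (shift_seq ^^ k) = ?P" for k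
    using distr_PiM_reindex[of UNIV "\<lambda>_. M" "\<lambda>i. i + k" UNIV] M
    unfolding sh by (simp add: restrict_def)
  have indep: "P.indep_vars (\<lambda>_. M) (\<lambda>i \<omega>. \<omega> i) UNIV"
  proof (subst P.indep_vars_iff_distr_eq_PiM')
    show "distr ?P ?P (\<lambda>x. \<lambda>i\<in>UNIV. x i) = Pi\<^sub>M UNIV (\<lambda>i. distr ?P M (\<lambda>\<omega>. \<omega> i))"
    proof -
      have "distr ?P M (\<lambda>\<omega>. \<omega> i) = M" for i using distr_PiM_component[of UNIV "\<lambda>_. M" i] M by simp
      then show ?thesis by (simp add: restrict_def distr_id2)
    qed
  qed auto
  let ?A = "\<lambda>i. {(\<lambda>\<omega>. \<omega> i) -` B \<inter> space ?P |B. B \<in> sets M}"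
  show ?thesis
  proof (unfold_locales)
    show "(shift_seq ^^ m) \<in> ?P \<rightarrow>\<^sub>M ?P" by (rule sh_meas)
    show "distr ?P ?P (shift_seq ^^ m) = ?P" by (rule pres)
    fix A assume A: "A \<in> sets ?P" and inv: "(shift_seq ^^ m) -` A \<inter> space ?P = A"
    have invk: "(shift_seq ^^ (m * k)) -` A \<inter> space ?P = A" for k
    proof (induction k)
      case 0
      then show ?case using sets.sets_into_space[OF A] by auto
    next
      case (Suc k)
      have "(shift_seq ^^ (m * Suc k)) -` A \<inter> space ?P
        = (shift_seq ^^ m) -` ((shift_seq ^^ (m * k)) -` A \<inter> space ?P) \<inter> space ?P"
        using measurable_space[OF sh_meas[of m]]
        by (auto simp: funpow_add add.commute[of m])
      then show ?case using Suc inv by simp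
    qed
    show "P.prob A = 0 \<or> P.prob A = 1"
    proof (rule P.kolmogorov_0_1_law[of ?A])
      show "sigma_algebra (space ?P) (?A i)" for i
      proof -
        have "?A i = sets (vimage_algebra (space ?P) (\<lambda>\<omega>. \<omega> i) M)"
          by (rule sets_vimage_algebra2[symmetric]) (auto simp: space_PiM PiE_iff)
        then show ?thesis using sets.sigma_algebra_axioms[of "vimage_algebra (space ?P) (\<lambda>\<omega>. \<omega> i) M"] by simp
      qed
      show "P.indep_sets ?A UNIV"
        using indep unfolding P.indep_vars_def2 by simp
      show "A \<in> P.tail_events ?A"
        unfolding P.tail_events_def
      proof (rule INT_I)
        fix n :: nat
        let ?N = "sigma (space ?P) (\<Union> (?A ` {n..}))"
        have sub: "\<Union> (?A ` {n..}) \<subseteq> Pow (space ?P)" by auto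
        have "(shift_seq ^^ (m * n)) \<in> ?N \<rightarrow>\<^sub>M ?P"
          unfolding sh
        proof (rule measurable_PiM_single')
          fix i :: nat
          show "(\<lambda>\<omega>. \<omega> (i + m * n)) \<in> ?N \<rightarrow>\<^sub>M M"
          proof (rule measurableI)
            show "x (i + m * n) \<in> space M" if "x \<in> space ?N" for x
              using that sub by (auto simp: space_PiM PiE_iff)
            show "(\<lambda>\<omega>. \<omega> (i + m * n)) -` B \<inter> space ?N \<in> sets ?N" if "B \<in> sets M" for B
            proof -
              have "n \<le> i + m * n" using m by (simp add: trans_le_add2)
              then have "(\<lambda>\<omega>. \<omega> (i + m * n)) -` B \<inter> space ?P \<in> \<Union> (?A ` {n..})" using that by blast
              then show ?thesis using sub by (auto intro: sigma_sets.Basic)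
            qed
          qed
        qed (use sub in \<open>auto simp: space_PiM PiE_iff\<close>)
        from measurable_sets[OF this A] have "A \<in> sets ?N" using invk[of n] sub by simp
        then show "A \<in> sigma_sets (space ?P) (\<Union> (?A ` {n..}))" using sub by simp
      qed
    qed
  qed
qed

locale finite_walk = word_metric G S for G :: "('a, 'b) monoid_scheme" (structure) and S +
  fixes \<mu> :: "'a pmf"
  assumes fin\<mu>: "finite (set_pmf \<mu>)" and \<mu>_carrier: "set_pmf \<mu> \<subseteq> carrier G"
begin

abbreviation u :: "nat \<Rightarrow> 'a \<Rightarrow> real" where "u n \<equiv> pmf (conv_pow G \<mu> n)"

definition step_space where "step_space = restrict_space (measure_pmf \<mu>) (carrier G)"
definition incr_space where "incr_space = (\<Pi>\<^sub>M i\<in>(UNIV::nat set). step_space)"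

lemma countable_carrier: "countable (carrier G)"
proof -
  have "carrier G = (\<Union>n. gball n)" by (auto simp: gball_def)
  then show ?thesis using finite_gball by (metis countable_UN countable_finite countableI_type)
qed

lemma space_step_space: "space step_space = carrier G" and sets_step_space: "sets step_space = Pow (carrier G)"
  by (auto simp: step_space_def space_restrict_space sets_restrict_space)

lemma prob_step_space: "prob_space step_space"
  unfolding step_space_def
  by (rule prob_space_restrict_space) (auto intro!: measure_pmf.emeasure_eq_1_AE simp: AE_measure_pmf_iff subsetD[OF \<mu>_carrier])

lemma prob_incr_space: "prob_space incr_space"
  unfolding incr_space_def by (rule prob_space_PiM) (rule prob_step_space)

lemma space_incr_space: "space incr_space = {\<omega>. \<forall>i. \<omega> i \<in> carrier G}"
  by (auto simp: incr_space_def space_PiM space_step_space PiE_iff)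

lemma step_space_count: "measurable N step_space = measurable N (count_space (carrier G))"
  by (rule measurable_cong_sets) (auto simp: sets_step_space)

lemma measurable_mult_carrier:
  assumes "f \<in> N \<rightarrow>\<^sub>M count_space (carrier G)" "g \<in> N \<rightarrow>\<^sub>M count_space (carrier G)"
  shows "(\<lambda>x. f x \<otimes> g x) \<in> N \<rightarrow>\<^sub>M count_space (carrier G)"
proof -
  have "(\<lambda>(a, b). a \<otimes> b) \<in> count_space (carrier G) \<Otimes>\<^sub>M count_space (carrier G) \<rightarrow>\<^sub>M count_space (carrier G)"
    by (subst pair_measure_countable) (auto simp: countable_carrier)
  from measurable_compose[OF measurable_Pair[OF assms] this] show ?thesis by simp
qed

lemma walk_0 [simp]: "walk G \<omega> 0 = \<one>"
  by (simp add: walk_def)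

lemma walk_closed: "(\<And>i. \<omega> i \<in> carrier G) \<Longrightarrow> walk G \<omega> n \<in> carrier G"
  unfolding walk_def by (rule word_prod_closed) auto

lemma walk_add:
  assumes "\<And>i. \<omega> i \<in> carrier G"
  shows "walk G \<omega> (m + n) = walk G \<omega> m \<otimes> walk G (\<lambda>i. \<omega> (i + m)) n"
proof -
  have "map \<omega> [m..<m + n] = map (\<lambda>i. \<omega> (i + m)) [0..<n]"
    by (rule nth_equalityI) (auto simp: add.commute)
  then have "map \<omega> [0..<m + n] = map \<omega> [0..<m] @ map (\<lambda>i. \<omega> (i + m)) [0..<n]"
    using upt_add_eq_append[of 0 m n] by simp
  then show ?thesis unfolding walk_def using assms by (simp add: word_prod_append image_subset_iff)
qed

lemma walk_Suc: "(\<And>i. \<omega> i \<in> carrier G) \<Longrightarrow> walk G \<omega> (Suc n) = walk G \<omega> n \<otimes> \<omega> n"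
  using walk_add[of \<omega> n 1] by (simp add: walk_def)

lemma walk_component_measurable: "(\<lambda>\<omega>. walk G \<omega> n) \<in> incr_space \<rightarrow>\<^sub>M count_space (carrier G)"
proof (induction n)
  case 0
  then show ?case by simp
next
  case (Suc n)
  have "(\<lambda>\<omega>. \<omega> n) \<in> incr_space \<rightarrow>\<^sub>M step_space" unfolding incr_space_def by (rule measurable_component_singleton) simp
  then have "(\<lambda>\<omega>. \<omega> n) \<in> incr_space \<rightarrow>\<^sub>M count_space (carrier G)" using step_space_count by metis
  from measurable_mult_carrier[OF Suc this]
  show ?case by (rule measurable_cong[THEN iffD1, rotated]) (auto simp: walk_Suc space_incr_space)
qed

lemma pmf_map_left_mult:
  assumes "s \<in> carrier G" "x \<in> carrier G" "set_pmf N \<subseteq> carrier G"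
  shows "pmf (map_pmf (\<lambda>y. s \<otimes> y) N) x = pmf N (inv s \<otimes> x)"
  by (rule pmf_map_left_inverse) (use assms in \<open>auto simp: cancel_inv subset_iff\<close>)

lemma conv_pow_1: "conv_pow G \<mu> 1 = \<mu>"
proof -
  have "conv_pow G \<mu> 1 = map_pmf (\<lambda>g. \<one> \<otimes> g) \<mu>" by (simp add: bind_return_pmf)
  also have "\<dots> = \<mu>" by (rule map_pmf_idI) (use \<mu>_carrier in auto)
  finally show ?thesis .
qed

text \<open>
  The induction splits off the first increment rather than the last, because the sequence space decomposes as
  (first coordinate, shifted sequence).
\<close>

lemma emeasure_walk_eq:
  assumes "x \<in> carrier G"
  shows "emeasure incr_space {\<omega> \<in> space incr_space. walk G \<omega> n = x} = ennreal (u n x)"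
  using assms
proof (induction n arbitrary: x)
  case 0
  interpret prob_space incr_space by (rule prob_incr_space)
  show ?case using emeasure_space_1 by (cases "x = \<one>") (auto simp: pmf_return)
next
  case (Suc n)
  interpret step_space: prob_space step_space by (rule prob_step_space)
  interpret P: prob_space incr_space by (rule prob_incr_space)
  interpret sq: sequence_space step_space ..
  have incr_def: "incr_space = Pi\<^sub>M UNIV (\<lambda>i. step_space)" by (simp add: incr_space_def)
  let ?X = "{\<omega> \<in> space incr_space. walk G \<omega> (Suc n) = x}"
  have X: "?X \<in> sets incr_space"
    using measurable_sets[OF walk_component_measurable[of "Suc n"], of "{x}"] Suc.prems
    by (simp add: vimage_def Int_def conj_commute)
  let ?t = "\<lambda>s. map_pmf (\<lambda>y. s \<otimes> y) (conv_pow G \<mu> n)"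
  let ?c = "\<lambda>(s, \<omega>). case_nat s \<omega>"
  have c_meas: "?c \<in> step_space \<Otimes>\<^sub>M incr_space \<rightarrow>\<^sub>M incr_space" unfolding incr_def by measurable
  have it: "distr (step_space \<Otimes>\<^sub>M incr_space) incr_space ?c = incr_space" unfolding incr_def by (rule sq.PiM_iter)
  have "emeasure incr_space ?X = emeasure (distr (step_space \<Otimes>\<^sub>M incr_space) incr_space ?c) ?X" by (simp only: it)
  also have "\<dots> = emeasure (step_space \<Otimes>\<^sub>M incr_space) (?c -` ?X \<inter> space (step_space \<Otimes>\<^sub>M incr_space))"
    by (rule emeasure_distr[OF c_meas X])
  also have "\<dots> = (\<integral>\<^sup>+ s. emeasure incr_space (Pair s -` (?c -` ?X \<inter> space (step_space \<Otimes>\<^sub>M incr_space))) \<partial>step_space)"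
    by (rule P.emeasure_pair_measure_alt) (rule measurable_sets[OF c_meas X])
  also have "\<dots> = (\<integral>\<^sup>+ s. ennreal (pmf (?t s) x) \<partial>step_space)"
  proof (rule nn_integral_cong)
    fix s assume "s \<in> space step_space"
    then have s: "s \<in> carrier G" by (simp add: space_step_space)
    have w: "walk G (case_nat s \<omega>) (Suc n) = s \<otimes> walk G \<omega> n" if "\<omega> \<in> space incr_space" for \<omega>
    proof -
      have "walk G (case_nat s \<omega>) (1 + n) = walk G (case_nat s \<omega>) 1 \<otimes> walk G (\<lambda>i. case_nat s \<omega> (i + 1)) n"
        using that s by (intro walk_add) (auto simp: space_incr_space split: nat.split)
      then show ?thesis using s by (simp add: walk_def)
    qed
    have wc: "walk G \<omega> n \<in> carrier G" if "\<omega> \<in> space incr_space" for \<omega>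
      using that by (intro walk_closed) (auto simp: space_incr_space)
    have "Pair s -` (?c -` ?X \<inter> space (step_space \<Otimes>\<^sub>M incr_space)) = {\<omega> \<in> space incr_space. walk G \<omega> n = inv s \<otimes> x}"
    proof (rule Set.set_eqI)
      fix \<omega>
      have "\<omega> \<in> Pair s -` (?c -` ?X \<inter> space (step_space \<Otimes>\<^sub>M incr_space)) \<longleftrightarrow> \<omega> \<in> space incr_space \<and> s \<otimes> walk G \<omega> n = x"
        using w[of \<omega>] s by (auto simp: space_pair_measure space_step_space space_incr_space split: nat.split)
      also have "\<dots> \<longleftrightarrow> \<omega> \<in> space incr_space \<and> walk G \<omega> n = inv s \<otimes> x"
        using s Suc.prems wc[of \<omega>] by (auto simp: cancel_inv)
      finally show "\<omega> \<in> Pair s -` (?c -` ?X \<inter> space (step_space \<Otimes>\<^sub>M incr_space)) \<longleftrightarrow> \<omega> \<in> {\<omega> \<in> space incr_space. walk G \<omega> n = inv s \<otimes> x}"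
        by simp
    qed
    then show "emeasure incr_space (Pair s -` (?c -` ?X \<inter> space (step_space \<Otimes>\<^sub>M incr_space))) = ennreal (pmf (?t s) x)"
      using Suc.IH[of "inv s \<otimes> x"] Suc.prems s pmf_map_left_mult[OF s Suc.prems set_conv_pow[OF \<mu>_carrier]] by simp
  qed
  also have "\<dots> = (\<integral>\<^sup>+ s. ennreal (pmf (?t s) x) * indicator (carrier G) s \<partial>measure_pmf \<mu>)"
    unfolding step_space_def by (rule nn_integral_restrict_space) simp
  also have "\<dots> = (\<integral>\<^sup>+ s. ennreal (pmf (?t s) x) \<partial>measure_pmf \<mu>)"
    by (rule nn_integral_cong_AE) (use \<mu>_carrier in \<open>auto simp: AE_measure_pmf_iff indicator_def\<close>)
  also have "\<dots> = ennreal (pmf (bind_pmf \<mu> (\<lambda>s. ?t s)) x)"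
    by (rule ennreal_pmf_bind[symmetric])
  also have "bind_pmf \<mu> (\<lambda>s. ?t s) = conv_pow G \<mu> (1 + n)"
    unfolding conv_pow_add[OF \<mu>_carrier] conv_pow_1 ..
  finally show ?case by simp
qed

lemma distr_walk_component:
  "distr incr_space (count_space UNIV) (\<lambda>\<omega>. walk G \<omega> n) = measure_pmf (conv_pow G \<mu> n)"
proof -
  interpret P: prob_space incr_space by (rule prob_incr_space)
  have meas: "(\<lambda>\<omega>. walk G \<omega> n) \<in> incr_space \<rightarrow>\<^sub>M count_space UNIV"
    by (rule measurable_compose[OF walk_component_measurable]) simp
  show ?thesis
  proof (rule measure_eqI_countable_AE[where \<Omega> = "carrier G"])
    show "AE x in distr incr_space (count_space UNIV) (\<lambda>\<omega>. walk G \<omega> n). x \<in> carrier G"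
      by (subst AE_distr_iff[OF meas]) (auto intro!: AE_I2 walk_closed simp: space_incr_space)
    show "AE x in measure_pmf (conv_pow G \<mu> n). x \<in> carrier G"
      using set_conv_pow[OF \<mu>_carrier] by (auto simp: AE_measure_pmf_iff)
    show "emeasure (distr incr_space (count_space UNIV) (\<lambda>\<omega>. walk G \<omega> n)) {x} = emeasure (measure_pmf (conv_pow G \<mu> n)) {x}"
      if "x \<in> carrier G" for x
      using emeasure_walk_eq[OF that, of n]
      by (subst emeasure_distr[OF meas]) (auto simp: emeasure_pmf_single vimage_def Int_def conj_commute)
  qed (auto simp: countable_carrier)
qed

lemma walk_measurable: "walk G \<in> incr_space \<rightarrow>\<^sub>M (\<Pi>\<^sub>M i\<in>(UNIV::nat set). count_space (carrier G))"
proof (rule measurable_PiM_single')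
  show "(\<lambda>\<omega>. walk G \<omega> i) \<in> incr_space \<rightarrow>\<^sub>M count_space (carrier G)" for i by (rule walk_component_measurable)
qed (auto simp: space_incr_space intro!: walk_closed)

section \<open>Length and information along the walk\<close>

text \<open>
  Outside this event, which has probability one, the information \<open>- ln (u n x)\<close> need not be
  subadditive, as \<open>ln 0 = 0\<close>.
\<close>

definition supported :: "nat \<Rightarrow> (nat \<Rightarrow> 'a) \<Rightarrow> bool" where
  "supported n \<omega> \<longleftrightarrow> (\<forall>i<n. \<omega> i \<in> set_pmf \<mu>)"

lemma AE_supported: "AE \<omega> in incr_space. \<forall>n. supported n \<omega>"
proof -
  have "AE x in step_space. x \<in> set_pmf \<mu>"
    unfolding step_space_def by (subst AE_restrict_space_iff) (auto simp: AE_measure_pmf_iff)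
  then have "AE \<omega> in incr_space. \<omega> i \<in> set_pmf \<mu>" for i
    unfolding incr_space_def by (rule AE_PiM_component[rotated 2]) (auto intro: prob_step_space)
  then have "AE \<omega> in incr_space. \<forall>i. \<omega> i \<in> set_pmf \<mu>" by (simp add: AE_all_countable)
  then show ?thesis by (rule AE_mp) (auto intro!: AE_I2 simp: supported_def)
qed

lemma supported_walk:
  assumes "supported n \<omega>" shows "walk G \<omega> n \<in> set_pmf (conv_pow G \<mu> n)"
  using word_prod_in_conv_pow[OF \<mu>_carrier, of "map \<omega> [0..<n]"] assms
  by (auto simp: walk_def supported_def image_subset_iff)

text \<open>
  Setting the functional to \<open>0\<close> on unsupported increments keeps it nonnegative and subadditive everywhere,
  and changes it on a null set only.
\<close>

lemma subadditive_functional_converges: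
  fixes \<Phi> :: "nat \<Rightarrow> 'a \<Rightarrow> real"
  assumes zero: "\<Phi> 0 \<one> = 0"
    and pos: "\<And>n x. x \<in> set_pmf (conv_pow G \<mu> n) \<Longrightarrow> 0 \<le> \<Phi> n x"
    and sub: "\<And>m n x y. x \<in> set_pmf (conv_pow G \<mu> m) \<Longrightarrow> y \<in> set_pmf (conv_pow G \<mu> n) \<Longrightarrow>
       \<Phi> (m + n) (x \<otimes> y) \<le> \<Phi> m x + \<Phi> n y"
  shows "\<exists>L. (AE \<omega> in incr_space. (\<lambda>n. \<Phi> n (walk G \<omega> n) / n) \<longlonglongrightarrow> L) \<and>
    (\<lambda>n. measure_pmf.expectation (conv_pow G \<mu> n) (\<Phi> n) / n) \<longlonglongrightarrow> L"
proof -
  interpret P: prob_space incr_space by (rule prob_incr_space)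
  define f where "f n \<omega> = (if supported n \<omega> then \<Phi> n (walk G \<omega> n) else 0)" for n \<omega>
  define C where "C = (\<Sum>x\<in>set_pmf \<mu>. \<Phi> 1 x)"
  have pos1: "0 \<le> \<Phi> 1 x" if "x \<in> set_pmf \<mu>" for x
    using pos[of x 1] that unfolding conv_pow_1 .
  have \<Phi>1: "\<Phi> 1 x \<le> C" if "x \<in> set_pmf \<mu>" for x
    unfolding C_def using that fin\<mu> pos1 by (intro member_le_sum) auto
  have f_pos: "0 \<le> f n \<omega>" for n \<omega> using pos supported_walk by (auto simp: f_def)
  have f_sub: "f (m + n) \<omega> \<le> f m \<omega> + f n ((shift_seq ^^ m) \<omega>)" if "\<omega> \<in> space incr_space" for m n \<omega>
  proof (cases "supported (m + n) \<omega>")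
    case True
    then have g: "supported m \<omega>" "supported n ((shift_seq ^^ m) \<omega>)" by (auto simp: supported_def shift_seq_funpow)
    have "walk G \<omega> (m + n) = walk G \<omega> m \<otimes> walk G ((shift_seq ^^ m) \<omega>) n"
      unfolding shift_seq_funpow using that by (intro walk_add) (auto simp: space_incr_space)
    then show ?thesis using sub[OF supported_walk[OF g(1)] supported_walk[OF g(2)]] True g by (simp add: f_def)
  qed (use f_pos in \<open>auto simp: f_def add_nonneg_nonneg\<close>)
  have f1: "f 1 \<omega> \<le> C" if "\<omega> \<in> space incr_space" for \<omega>
  proof -
    have "C \<ge> 0" unfolding C_def using pos1 by (intro sum_nonneg) auto
    moreover have "walk G \<omega> 1 = \<omega> 0" using that by (auto simp: walk_def space_incr_space)
    ultimately show ?thesis using \<Phi>1[of "\<omega> 0"] by (auto simp: f_def supported_def)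
  qed
  have shsp: "(shift_seq ^^ m) \<omega> \<in> space incr_space" if "\<omega> \<in> space incr_space" for m \<omega>
    using that by (auto simp: space_incr_space shift_seq_funpow)
  have f_bd: "f n \<omega> \<le> C * n" if "\<omega> \<in> space incr_space" for n \<omega>
  proof (induction n)
    case 0
    then show ?case using zero by (simp add: f_def)
  next
    case (Suc n)
    have "f (n + 1) \<omega> \<le> f n \<omega> + f 1 ((shift_seq ^^ n) \<omega>)" by (rule f_sub[OF that])
    then show ?case using Suc f1[OF shsp[OF that], of n] by (simp add: algebra_simps)
  qed
  have f_meas: "f n \<in> borel_measurable incr_space" for n
  proof -
    have comp: "(\<lambda>\<omega>. \<omega> i) \<in> incr_space \<rightarrow>\<^sub>M count_space (carrier G)" for i
    proof -
      have "(\<lambda>\<omega>. \<omega> i) \<in> incr_space \<rightarrow>\<^sub>M step_space" unfolding incr_space_def by (rule measurable_component_singleton) simp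
      then show ?thesis using step_space_count by metis
    qed
    have "Measurable.pred incr_space (\<lambda>\<omega>. \<omega> i \<in> set_pmf \<mu>)" for i
      by (rule measurable_compose[OF comp]) simp
    then have "Measurable.pred incr_space (supported n)" unfolding supported_def by measurable
    moreover have "(\<lambda>\<omega>. \<Phi> n (walk G \<omega> n)) \<in> borel_measurable incr_space"
      by (rule measurable_compose[OF walk_component_measurable]) simp
    ultimately show ?thesis unfolding f_def by measurable
  qed
  have erg: "ergodic_system incr_space (shift_seq ^^ m)" if "m \<ge> 1" for m
    unfolding incr_space_def by (rule shift_ergodic[OF prob_step_space that])
  from subadditive_ergodic[of incr_space shift_seq f C, OF erg f_meas f_pos f_bd f_sub]
  obtain L where L: "AE \<omega> in incr_space. (\<lambda>n. f n \<omega> / n) \<longlonglongrightarrow> L" "(\<lambda>n. (\<integral>\<omega>. f n \<omega> \<partial>incr_space) / n) \<longlonglongrightarrow> L"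
    by auto
  have "AE \<omega> in incr_space. (\<lambda>n. \<Phi> n (walk G \<omega> n) / n) \<longlonglongrightarrow> L"
    using L(1) AE_supported by eventually_elim (simp add: f_def)
  moreover have "(\<integral>\<omega>. f n \<omega> \<partial>incr_space) = measure_pmf.expectation (conv_pow G \<mu> n) (\<Phi> n)" for n
  proof -
    have wm: "(\<lambda>\<omega>. walk G \<omega> n) \<in> incr_space \<rightarrow>\<^sub>M count_space UNIV"
      by (rule measurable_compose[OF walk_component_measurable]) simp
    have "(\<integral>\<omega>. f n \<omega> \<partial>incr_space) = (\<integral>\<omega>. \<Phi> n (walk G \<omega> n) \<partial>incr_space)"
    proof (rule integral_cong_AE[OF f_meas])
      show "(\<lambda>\<omega>. \<Phi> n (walk G \<omega> n)) \<in> borel_measurable incr_space"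
        by (rule measurable_compose[OF wm]) simp
      show "AE \<omega> in incr_space. f n \<omega> = \<Phi> n (walk G \<omega> n)"
        using AE_supported by eventually_elim (simp add: f_def)
    qed
    also have "\<dots> = (\<integral>x. \<Phi> n x \<partial>distr incr_space (count_space UNIV) (\<lambda>\<omega>. walk G \<omega> n))"
      by (rule integral_distr[symmetric, OF wm]) simp
    finally show ?thesis by (simp add: distr_walk_component)
  qed
  ultimately show ?thesis using L(2) by auto
qed

lemma word_length_converges:
  "\<exists>L. (AE \<omega> in incr_space. (\<lambda>n. real (len (walk G \<omega> n)) / n) \<longlonglongrightarrow> L) \<and>
    (\<lambda>n. mean_len \<mu> n / n) \<longlonglongrightarrow> L"
proof (rule subadditive_functional_converges)
  fix m n x y
  assume "x \<in> set_pmf (conv_pow G \<mu> m)" "y \<in> set_pmf (conv_pow G \<mu> n)"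
  then have "x \<in> carrier G" "y \<in> carrier G" using set_conv_pow[OF \<mu>_carrier] by blast+
  from len_mult[OF this] show "real (len (x \<otimes> y)) \<le> real (len x) + real (len y)" by linarith
qed auto

text \<open>
  The Shannon-McMillan-Breiman theorem for random walks on groups: going to \<open>x\<close> in \<open>m\<close> steps and
  on to \<open>x \<otimes> y\<close> in \<open>n\<close> further steps is one way of reaching \<open>x \<otimes> y\<close> in \<open>m + n\<close> steps.
\<close>

lemma information_converges:
  "\<exists>L. (AE \<omega> in incr_space. (\<lambda>n. - ln (u n (walk G \<omega> n)) / n) \<longlonglongrightarrow> L) \<and>
    (\<lambda>n. measure_pmf.expectation (conv_pow G \<mu> n) (\<lambda>x. - ln (u n x)) / n) \<longlonglongrightarrow> L"
proof (rule subadditive_functional_converges)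
  show "- ln (u 0 \<one>) = 0" by (simp add: pmf_return)
  show "0 \<le> - ln (u n x)" if "x \<in> set_pmf (conv_pow G \<mu> n)" for n x
    using that by (simp add: pmf_positive_iff pmf_le_1)
  show "- ln (u (m + n) (x \<otimes> y)) \<le> - ln (u m x) + - ln (u n y)"
    if xy: "x \<in> set_pmf (conv_pow G \<mu> m)" "y \<in> set_pmf (conv_pow G \<mu> n)" for m n x y
  proof -
    have c: "x \<in> carrier G" "y \<in> carrier G" using xy set_conv_pow[OF \<mu>_carrier] by blast+
    have p: "0 < u m x" "0 < u n y" using xy by (auto simp: pmf_positive_iff)
    then have "ln (u m x * u n y) \<le> ln (u (m + n) (x \<otimes> y))"
      using pmf_conv_pow_mult_le[OF \<mu>_carrier fin\<mu> c, of m n] by (intro ln_mono) (auto intro: less_le_trans[OF mult_pos_pos])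
    then show ?thesis using p by (simp add: ln_mult)
  qed
qed

end

section \<open>Likelihood ratios and hitting times\<close>

lemma emeasure_le_of_atoms:
  assumes "countable B" "\<And>x. x \<in> B \<Longrightarrow> {x} \<in> sets N1" "\<And>x. x \<in> B \<Longrightarrow> {x} \<in> sets N2"
    and "\<And>x. x \<in> B \<Longrightarrow> emeasure N1 {x} \<le> c * emeasure N2 {x}"
  shows "emeasure N1 B \<le> c * emeasure N2 B"
proof -
  have "emeasure N1 B = (\<integral>\<^sup>+ x. emeasure N1 {x} \<partial>count_space B)"
    by (rule emeasure_countable_singleton) (use assms in auto)
  also have "\<dots> \<le> (\<integral>\<^sup>+ x. c * emeasure N2 {x} \<partial>count_space B)"
    by (rule nn_integral_mono) (use assms in auto)
  also have "\<dots> = c * (\<integral>\<^sup>+ x. emeasure N2 {x} \<partial>count_space B)"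
    by (rule nn_integral_cmult) simp
  also have "(\<integral>\<^sup>+ x. emeasure N2 {x} \<partial>count_space B) = emeasure N2 B"
    by (rule emeasure_countable_singleton[symmetric]) (use assms in auto)
  finally show ?thesis .
qed

text \<open>
  Under \<open>N1\<close>, the likelihood ratio \<open>N1 / N2\<close> is at most \<open>c\<close> with probability at most \<open>c\<close>.
\<close>

lemma prob_le_of_atoms:
  assumes "prob_space N1" "prob_space N2"
    and "countable B" "\<And>x. x \<in> B \<Longrightarrow> {x} \<in> sets N1" "\<And>x. x \<in> B \<Longrightarrow> {x} \<in> sets N2"
    and c: "c \<ge> 0" and le: "\<And>x. x \<in> B \<Longrightarrow> measure N1 {x} \<le> c * measure N2 {x}"
  shows "measure N1 B \<le> c"
proof -
  interpret N1: prob_space N1 by fact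
  interpret N2: prob_space N2 by fact
  have "emeasure N1 B \<le> ennreal c * emeasure N2 B"
  proof (rule emeasure_le_of_atoms[OF assms(3-5)])
    fix x assume "x \<in> B"
    from le[OF this] c show "emeasure N1 {x} \<le> ennreal c * emeasure N2 {x}"
      by (simp add: N1.emeasure_eq_measure N2.emeasure_eq_measure ennreal_mult[symmetric] ennreal_leI)
  qed
  also have "\<dots> \<le> ennreal c * 1" by (intro mult_left_mono N2.emeasure_le_1) auto
  finally show ?thesis using c by (simp add: N1.emeasure_eq_measure)
qed

lemma (in prob_space) prob_tendsto_1_of_eventually:
  assumes E: "\<And>n::nat. E n \<in> sets M" and ev: "AE x in M. \<forall>\<^sub>F n in sequentially. x \<in> E n"
  shows "(\<lambda>n. prob (E n)) \<longlonglongrightarrow> 1"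
proof -
  have "(\<lambda>n. \<integral>x. indicat_real (E n) x \<partial>M) \<longlonglongrightarrow> (\<integral>x. 1 \<partial>M)"
  proof (rule integral_dominated_convergence[where w = "\<lambda>_. 1"])
    show "AE x in M. (\<lambda>n. indicat_real (E n) x) \<longlonglongrightarrow> 1"
      using ev
    proof eventually_elim
      case (elim x)
      then show ?case by (intro tendsto_eventually) (auto elim: eventually_mono)
    qed
  qed (use E in auto)
  then show ?thesis using E by (simp add: prob_space)
qed

lemma sets_tendsto:
  fixes g :: "nat \<Rightarrow> 'x \<Rightarrow> real"
  assumes [measurable]: "\<And>n. g n \<in> borel_measurable M"
  shows "{x \<in> space M. (\<lambda>n. g n x) \<longlonglongrightarrow> L} \<in> sets M"
proof -
  have "(\<lambda>n. g n x) \<longlonglongrightarrow> L \<longleftrightarrow> (\<forall>k::nat. \<exists>N. \<forall>n\<ge>N. \<bar>g n x - L\<bar> < 1 / Suc k)" for x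
  proof
    assume r: "\<forall>k::nat. \<exists>N. \<forall>n\<ge>N. \<bar>g n x - L\<bar> < 1 / Suc k"
    show "(\<lambda>n. g n x) \<longlonglongrightarrow> L"
    proof (rule LIMSEQ_I)
      fix e :: real assume "e > 0"
      then obtain k where "1 / real (Suc k) < e" using reals_Archimedean[of e] by (auto simp: inverse_eq_divide)
      with r show "\<exists>N. \<forall>n\<ge>N. norm (g n x - L) < e" by (metis less_trans real_norm_def)
    qed
  next
    assume "(\<lambda>n. g n x) \<longlonglongrightarrow> L"
    from LIMSEQ_D[OF this] show "\<forall>k::nat. \<exists>N. \<forall>n\<ge>N. \<bar>g n x - L\<bar> < 1 / Suc k" by simp
  qed
  then show ?thesis by simp measurable
qed

text \<open>
  \<open>\<tau> n / n\<close> is the quotient of \<open>L (\<tau> n) / n\<close>, which tends to \<open>1\<close>, and \<open>L (\<tau> n) / \<tau> n\<close>, which tends to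
  \<open>l\<close> because \<open>\<tau> n\<close> tends to infinity.
\<close>

lemma hitting_time_asymptotics:
  fixes L \<tau> :: "nat \<Rightarrow> nat" and l :: real
  assumes C: "\<And>k. L k \<le> C * k" and r: "\<And>n. n \<le> L (\<tau> n) + r" "\<And>n. L (\<tau> n) \<le> n + r"
    and l: "(\<lambda>k. real (L k) / k) \<longlonglongrightarrow> l" "l > 0"
  shows "filterlim \<tau> at_top sequentially" "(\<lambda>n. real (\<tau> n) / n) \<longlonglongrightarrow> 1 / l"
proof -
  show lim: "filterlim \<tau> at_top sequentially"
    unfolding filterlim_at_top
  proof
    fix Z
    show "\<forall>\<^sub>F n in sequentially. Z \<le> \<tau> n"
      using eventually_gt_at_top[of "C * Z + r"]
    proof eventually_elim
      case (elim n)
      show ?case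
      proof (rule ccontr)
        assume "\<not> Z \<le> \<tau> n"
        then have "C * \<tau> n \<le> C * Z" by simp
        then show False using C[of "\<tau> n"] r(1)[of n] elim by linarith
      qed
    qed
  qed
  have 1: "(\<lambda>n. real (L (\<tau> n)) / \<tau> n) \<longlonglongrightarrow> l" by (rule filterlim_compose[OF l(1) lim])
  have 2: "(\<lambda>n. real (L (\<tau> n)) / n) \<longlonglongrightarrow> 1"
  proof (rule tendsto_sandwich)
    show "(\<lambda>n. 1 - real r / real n) \<longlonglongrightarrow> 1" using tendsto_diff[OF tendsto_const lim_const_over_n[of "real r"]] by simp
    show "(\<lambda>n. 1 + real r / real n) \<longlonglongrightarrow> 1" using tendsto_add[OF tendsto_const lim_const_over_n[of "real r"]] by simp
    show "\<forall>\<^sub>F n in sequentially. 1 - real r / real n \<le> real (L (\<tau> n)) / n"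
      using eventually_gt_at_top[of 0]
    proof eventually_elim
      case (elim n)
      have "real n \<le> real (L (\<tau> n)) + r" using r(1)[of n] by linarith
      then have "real n / real n \<le> (real (L (\<tau> n)) + r) / real n" by (rule divide_right_mono) simp
      then show ?case using elim by (simp add: add_divide_distrib)
    qed
    show "\<forall>\<^sub>F n in sequentially. real (L (\<tau> n)) / n \<le> 1 + real r / real n"
      using eventually_gt_at_top[of 0]
    proof eventually_elim
      case (elim n)
      have "real (L (\<tau> n)) \<le> real n + r" using r(2)[of n] by linarith
      then have "real (L (\<tau> n)) / real n \<le> (real n + r) / real n" by (rule divide_right_mono) simp
      then show ?case using elim by (simp add: add_divide_distrib)
    qed
  qed
  have "(\<lambda>n. (real (L (\<tau> n)) / n) / (real (L (\<tau> n)) / \<tau> n)) \<longlonglongrightarrow> 1 / l"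
    by (rule tendsto_divide[OF 2 1]) (use l in simp)
  moreover have "\<forall>\<^sub>F n in sequentially. (real (L (\<tau> n)) / n) / (real (L (\<tau> n)) / \<tau> n) = real (\<tau> n) / n"
    using eventually_gt_at_top[of r]
  proof eventually_elim
    case (elim n)
    then have "L (\<tau> n) \<noteq> 0" using r(1)[of n] by linarith
    then show ?case by simp
  qed
  ultimately show "(\<lambda>n. real (\<tau> n) / n) \<longlonglongrightarrow> 1 / l" by (rule Lim_transform_eventually)
qed

section \<open>The law of the walk on path space\<close>

context finite_walk begin

abbreviation W where "W \<equiv> walk_measure G \<mu>"

lemma W_eq: "W = distr incr_space (\<Pi>\<^sub>M i\<in>(UNIV::nat set). count_space (carrier G)) (walk G)"
  by (simp add: walk_measure_def incr_space_def step_space_def)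

lemma prob_W: "prob_space W"
  unfolding W_eq by (rule prob_space.prob_space_distr[OF prob_incr_space walk_measurable])

lemma space_W: "space W = {p. \<forall>i. p i \<in> carrier G}"
  by (auto simp: W_eq space_PiM PiE_iff)

lemma W_component [measurable]: "(\<lambda>p. p n) \<in> W \<rightarrow>\<^sub>M count_space (carrier G)"
  unfolding W_eq measurable_distr_eq1 by (rule measurable_component_singleton) simp

lemma W_law: "distr W (count_space UNIV) (\<lambda>p. p n) = measure_pmf (conv_pow G \<mu> n)"
proof -
  have "(\<lambda>p. p n) \<in> (\<Pi>\<^sub>M i\<in>(UNIV::nat set). count_space (carrier G)) \<rightarrow>\<^sub>M count_space UNIV"
    by (rule measurable_compose[OF measurable_component_singleton]) auto
  from distr_distr[OF this walk_measurable] show ?thesis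
    unfolding W_eq by (simp add: o_def distr_walk_component)
qed

lemma W_prob:
  "measure W {p \<in> space W. p n \<in> B} = measure_pmf.prob (conv_pow G \<mu> n) B"
proof -
  have m: "(\<lambda>p. p n) \<in> W \<rightarrow>\<^sub>M count_space UNIV"
    by (rule measurable_compose[OF W_component]) simp
  show ?thesis unfolding W_law[symmetric]
    by (subst measure_distr[OF m]) (auto simp: vimage_def Int_def conj_commute)
qed

lemma walk_law_eq: "walk_law G \<mu> n x = u n x"
  using W_prob[of n "{x}"] by (simp add: walk_law_def measure_pmf_single)

lemma u_outside: "x \<notin> carrier G \<Longrightarrow> u n x = 0"
  using set_conv_pow[OF \<mu>_carrier, of n] by (auto simp: set_pmf_iff)

lemma AE_W_supp: "AE p in W. \<forall>n. p n \<in> set_pmf (conv_pow G \<mu> n)"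
proof -
  have "AE p in W. p n \<in> set_pmf (conv_pow G \<mu> n)" for n
  proof -
    have m: "(\<lambda>p. p n) \<in> W \<rightarrow>\<^sub>M count_space UNIV"
      by (rule measurable_compose[OF W_component]) simp
    have "AE x in distr W (count_space UNIV) (\<lambda>p. p n). x \<in> set_pmf (conv_pow G \<mu> n)"
      unfolding W_law by (simp add: AE_measure_pmf_iff)
    from AE_distrD[OF m this] show ?thesis .
  qed
  then show ?thesis by (simp add: AE_all_countable)
qed

lemma AE_W_tendsto:
  fixes \<Phi> :: "nat \<Rightarrow> 'a \<Rightarrow> real"
  assumes "AE \<omega> in incr_space. (\<lambda>n. \<Phi> n (walk G \<omega> n) / n) \<longlonglongrightarrow> L"
  shows "AE p in W. (\<lambda>n. \<Phi> n (p n) / n) \<longlonglongrightarrow> L"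
proof -
  let ?N = "\<Pi>\<^sub>M i\<in>(UNIV::nat set). count_space (carrier G)"
  have "{p \<in> space ?N. (\<lambda>n. \<Phi> n (p n) / n) \<longlonglongrightarrow> L} \<in> sets ?N"
  proof (rule sets_tendsto)
    show "(\<lambda>p. \<Phi> n (p n) / real n) \<in> borel_measurable ?N" for n
      by (rule measurable_compose[OF measurable_component_singleton]) auto
  qed
  then show ?thesis unfolding W_eq by (subst AE_distr_iff[OF walk_measurable]) (use assms in auto)
qed

text \<open>
  Besides the almost sure limit, this identifies \<open>walk_drift\<close>, a \<open>lim\<close> of sums over the carrier, with the limit of
  the means; \<open>entropy_converges\<close> does the same for \<open>walk_entropy\<close>.
\<close>

lemma drift_converges:
  "(\<lambda>n. mean_len \<mu> n / n) \<longlonglongrightarrow> walk_drift G S \<mu>"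
  "AE p in W. (\<lambda>n. real (len (p n)) / n) \<longlonglongrightarrow> walk_drift G S \<mu>"
proof -
  from word_length_converges obtain L where
    L: "AE \<omega> in incr_space. (\<lambda>n. real (len (walk G \<omega> n)) / n) \<longlonglongrightarrow> L"
      "(\<lambda>n. mean_len \<mu> n / n) \<longlonglongrightarrow> L" by blast
  have "(\<Sum>\<^sub>\<infinity>x\<in>carrier G. real (len x) * walk_law G \<mu> n x) = mean_len \<mu> n" for n
  proof -
    have "(\<Sum>\<^sub>\<infinity>x\<in>carrier G. real (len x) * walk_law G \<mu> n x) = (\<Sum>\<^sub>\<infinity>x\<in>set_pmf (conv_pow G \<mu> n). real (len x) * u n x)"
      by (intro infsum_cong_neutral) (auto simp: walk_law_eq set_pmf_iff u_outside)
    also have "\<dots> = (\<Sum>x\<in>set_pmf (conv_pow G \<mu> n). real (len x) * u n x)"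
      by (rule infsum_finite) (rule finite_conv_pow[OF fin\<mu>])
    also have "\<dots> = mean_len \<mu> n"
      by (rule integral_measure_pmf_real[symmetric]) (auto intro: finite_conv_pow[OF fin\<mu>])
    finally show ?thesis .
  qed
  then have "walk_drift G S \<mu> = lim (\<lambda>n. mean_len \<mu> n / n)"
    by (simp add: walk_drift_def)
  then have "walk_drift G S \<mu> = L" using limI[OF L(2)] by simp
  then show "(\<lambda>n. mean_len \<mu> n / n) \<longlonglongrightarrow> walk_drift G S \<mu>"
    "AE p in W. (\<lambda>n. real (len (p n)) / n) \<longlonglongrightarrow> walk_drift G S \<mu>"
    using L AE_W_tendsto[of "\<lambda>_ x. real (len x)"] by auto
qed

lemma entropy_converges:
  "AE p in W. (\<lambda>n. - ln (u n (p n)) / n) \<longlonglongrightarrow> walk_entropy G \<mu>"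
proof -
  from information_converges obtain L where
    L: "AE \<omega> in incr_space. (\<lambda>n. - ln (u n (walk G \<omega> n)) / n) \<longlonglongrightarrow> L"
      "(\<lambda>n. measure_pmf.expectation (conv_pow G \<mu> n) (\<lambda>x. - ln (u n x)) / n) \<longlonglongrightarrow> L" by blast
  have "- (\<Sum>\<^sub>\<infinity>x\<in>carrier G. walk_law G \<mu> n x * ln (walk_law G \<mu> n x)) = measure_pmf.expectation (conv_pow G \<mu> n) (\<lambda>x. - ln (u n x))" for n
  proof -
    have "(\<Sum>\<^sub>\<infinity>x\<in>carrier G. walk_law G \<mu> n x * ln (walk_law G \<mu> n x)) = (\<Sum>\<^sub>\<infinity>x\<in>set_pmf (conv_pow G \<mu> n). u n x * ln (u n x))"
      by (intro infsum_cong_neutral) (auto simp: walk_law_eq set_pmf_iff u_outside)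
    also have "\<dots> = (\<Sum>x\<in>set_pmf (conv_pow G \<mu> n). u n x * ln (u n x))"
      by (rule infsum_finite) (rule finite_conv_pow[OF fin\<mu>])
    also have "\<dots> = - (\<Sum>x\<in>set_pmf (conv_pow G \<mu> n). - ln (u n x) * u n x)"
      by (simp add: sum_negf[symmetric] mult.commute)
    also have "(\<Sum>x\<in>set_pmf (conv_pow G \<mu> n). - ln (u n x) * u n x) = measure_pmf.expectation (conv_pow G \<mu> n) (\<lambda>x. - ln (u n x))"
      by (rule integral_measure_pmf_real[symmetric]) (auto intro: finite_conv_pow[OF fin\<mu>])
    finally show ?thesis by simp
  qed
  then have "- (1 / real n) * (\<Sum>\<^sub>\<infinity>x\<in>carrier G. walk_law G \<mu> n x * ln (walk_law G \<mu> n x))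
     = measure_pmf.expectation (conv_pow G \<mu> n) (\<lambda>x. - ln (u n x)) / n" for n
    by (metis divide_inverse inverse_eq_divide minus_mult_commute mult.commute)
  then have "walk_entropy G \<mu> = lim (\<lambda>n. measure_pmf.expectation (conv_pow G \<mu> n) (\<lambda>x. - ln (u n x)) / n)"
    unfolding walk_entropy_def by (simp only:)
  then have "walk_entropy G \<mu> = L" using limI[OF L(2)] by simp
  then show ?thesis using L(1) AE_W_tendsto[of "\<lambda>n x. - ln (u n x)"] by auto
qed

lemma drift_positive:
  assumes Y: "expanding G Y" and adm: "admissible G \<mu>"
  shows "walk_drift G S \<mu> > 0"
proof (rule ccontr)
  assume neg: "\<not> ?thesis"
  define e where "e n = mean_len \<mu> n" for n
  from drift_not_sublinear[OF Y fin\<mu> adm] obtain \<eta> :: real where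
    \<eta>: "\<eta> > 0" "\<And>C::real. \<exists>n. e n > \<eta> * n + C" unfolding e_def by blast
  have "\<forall>\<^sub>F n in sequentially. e n / n < \<eta>"
    using order_tendstoD(2)[OF drift_converges(1), of \<eta>] neg \<eta>(1) unfolding e_def by linarith
  then obtain N where N: "\<And>n. n \<ge> N \<Longrightarrow> e n / n < \<eta>" by (auto simp: eventually_sequentially)
  have e0: "e n \<ge> 0" for n unfolding e_def by (intro integral_nonneg_AE) auto
  have "e n \<le> \<eta> * n + (\<Sum>k\<le>N. e k)" for n
  proof (cases "n \<le> N")
    case True
    then have "e n \<le> (\<Sum>k\<le>N. e k)" using e0 by (intro member_le_sum) auto
    then show ?thesis using \<eta>(1) by (simp add: add_increasing)
  next
    case False
    then have "e n \<le> \<eta> * n" using N[of n] by (simp add: field_simps)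
    moreover have "0 \<le> (\<Sum>k\<le>N. e k)" using e0 by (simp add: sum_nonneg)
    ultimately show ?thesis by linarith
  qed
  with \<eta>(2)[of "\<Sum>k\<le>N. e k"] show False by (auto simp: not_less[symmetric])
qed

section \<open>Hitting distributions of annuli\<close>

abbreviation ann where "ann \<equiv> annulus G S \<mu>"
abbreviation \<tau> where "\<tau> \<equiv> hitting_time G S \<mu>"
abbreviation \<nu> where "\<nu> \<equiv> hitting_measure G S \<mu>"
abbreviation Z where "Z n p \<equiv> p (\<tau> n p)"
abbreviation mass where "mass n p \<equiv> measure (\<nu> n) {Z n p}"
abbreviation typical_set where
  "typical_set H a n \<equiv> {x \<in> ann n. exp (- real n * (H + a)) \<le> measure (\<nu> n) {x} \<and>
     measure (\<nu> n) {x} \<le> exp (- real n * (H - a))}"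

lemma ann_carrier: "ann n \<subseteq> carrier G"
  by (auto simp: annulus_def)

lemma ann_len:
  assumes "x \<in> ann n"
  shows "n \<le> len x + support_diameter G S \<mu>" "len x \<le> n + support_diameter G S \<mu>"
proof -
  from assms obtain y where y: "x \<in> carrier G" "y \<in> carrier G" "len y = n" "d x y \<le> support_diameter G S \<mu>"
    by (auto simp: annulus_def sphere_in_group_def)
  have "len y \<le> len x + d x y" using d_triangle[OF one_closed y(1,2)] y by simp
  then show "n \<le> len x + support_diameter G S \<mu>" using y by linarith
  have "len x \<le> len y + d y x" using d_triangle[OF one_closed y(2,1)] y by simp
  then show "len x \<le> n + support_diameter G S \<mu>" using y d_sym[OF y(1,2)] by linarith
qed

lemma finite_ann: "finite (ann n)"
  by (rule finite_subset[OF _ finite_gball[of "n + support_diameter G S \<mu>"]])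
    (use ann_len subsetD[OF ann_carrier] in \<open>auto simp: gball_def\<close>)

lemma hitting_time_measurable [measurable]: "\<tau> n \<in> W \<rightarrow>\<^sub>M count_space UNIV"
proof -
  have "Measurable.pred W (\<lambda>p. p k \<in> ann n)" for k
    by (rule measurable_compose[OF W_component]) simp
  then show ?thesis unfolding hitting_time_def by (rule measurable_Least)
qed

lemma Z_measurable [measurable]: "Z n \<in> W \<rightarrow>\<^sub>M count_space (carrier G)"
  by (rule measurable_compose_countable[OF W_component hitting_time_measurable])

lemma prob_\<nu>: "prob_space (\<nu> n)"
  unfolding hitting_measure_def by (rule prob_space.prob_space_distr[OF prob_W Z_measurable])

lemma sets_\<nu>: "sets (\<nu> n) = Pow (carrier G)" and space_\<nu>: "space (\<nu> n) = carrier G"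
  by (simp_all add: hitting_measure_def)

lemma \<nu>_eq: "B \<subseteq> carrier G \<Longrightarrow> measure (\<nu> n) B = measure W {p \<in> space W. Z n p \<in> B}"
  unfolding hitting_measure_def
  by (subst measure_distr[OF Z_measurable]) (auto simp: vimage_def Int_def conj_commute)

text \<open>
  On \<open>\<tau> n p = k\<close> the point \<open>Z n p\<close> equals \<open>p k\<close>.  If the first inequality fails there, \<open>Z n p\<close>, a sample of
  \<open>\<nu> n\<close>, lies in the set \<open>X1 n k\<close> of small likelihood ratio; if the second fails, \<open>p k\<close>, a sample of
  \<open>u k\<close>, lies in the corresponding set \<open>X2 n k\<close>.  Each of these at most \<open>2 (a n + 1)\<close> events has
  probability at most \<open>(q q) ^ n\<close>.  The factor is written as a square so that one \<open>q ^ n\<close> can absorb the number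
  of events and the other is summable.
\<close>

lemma hitting_mass_comparable:
  fixes a :: nat and q :: real
  assumes q: "0 < q" "q < 1"
  shows "AE p in W. \<forall>\<^sub>F n in sequentially. \<tau> n p \<le> a * n \<longrightarrow>
     (q * q) ^ n * u (\<tau> n p) (Z n p) \<le> mass n p \<and>
     (q * q) ^ n * mass n p \<le> u (\<tau> n p) (Z n p)"
proof -
  interpret W: prob_space W by (rule prob_W)
  define c where "c n = (q * q) ^ n" for n
  have c0: "c n \<ge> 0" for n using q by (simp add: c_def)
  define X1 where "X1 n k = {x \<in> carrier G. measure (\<nu> n) {x} < c n * u k x}" for n k
  define X2 where "X2 n k = {x \<in> carrier G. u k x < c n * measure (\<nu> n) {x}}" for n k
  define B where "B n = (\<Union>k\<le>a * n. {p \<in> space W. Z n p \<in> X1 n k} \<union> {p \<in> space W. p k \<in> X2 n k})" for n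
  have m1 [measurable]: "{p \<in> space W. Z n p \<in> X1 n k} \<in> sets W" for n k
    using measurable_sets[OF Z_measurable[of n], of "X1 n k"] by (auto simp: X1_def vimage_def Int_def conj_commute)
  have m2 [measurable]: "{p \<in> space W. p k \<in> X2 n k} \<in> sets W" for n k
    using measurable_sets[OF W_component[of k], of "X2 n k"] by (auto simp: X2_def vimage_def Int_def conj_commute)
  have B_meas: "B n \<in> sets W" for n unfolding B_def by measurable
  have cnt: "countable X" if "X \<subseteq> carrier G" for X using that countable_carrier countable_subset by blast
  have p1: "W.prob {p \<in> space W. Z n p \<in> X1 n k} \<le> c n" for n k
  proof -
    have sub: "X1 n k \<subseteq> carrier G" by (auto simp: X1_def)
    have "measure (\<nu> n) (X1 n k) \<le> c n"
      by (rule prob_le_of_atoms[OF prob_\<nu> measure_pmf.prob_space_axioms[of "conv_pow G \<mu> k"] cnt[OF sub]])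
        (use c0 in \<open>auto simp: X1_def sets_\<nu> measure_pmf_single intro: less_imp_le\<close>)
    then show ?thesis by (simp add: \<nu>_eq[OF sub])
  qed
  have p2: "W.prob {p \<in> space W. p k \<in> X2 n k} \<le> c n" for n k
  proof -
    have sub: "X2 n k \<subseteq> carrier G" by (auto simp: X2_def)
    have "measure_pmf.prob (conv_pow G \<mu> k) (X2 n k) \<le> c n"
      by (rule prob_le_of_atoms[OF measure_pmf.prob_space_axioms[of "conv_pow G \<mu> k"] prob_\<nu>[of n] cnt[OF sub]])
        (use c0 in \<open>auto simp: X2_def sets_\<nu> measure_pmf_single intro: less_imp_le\<close>)
    then show ?thesis by (simp add: W_prob)
  qed
  have pB: "W.prob (B n) \<le> (real a * n + 1) * (2 * c n)" for n
  proof -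
    have "W.prob (B n) \<le> (\<Sum>k\<le>a * n. W.prob ({p \<in> space W. Z n p \<in> X1 n k} \<union> {p \<in> space W. p k \<in> X2 n k}))"
      unfolding B_def by (rule W.finite_measure_subadditive_finite) auto
    also have "\<dots> \<le> (\<Sum>k\<le>a * n. c n + c n)"
      by (intro sum_mono order_trans[OF measure_Un_le[OF m1 m2]] add_mono p1 p2)
    finally show ?thesis by (simp add: algebra_simps)
  qed
  have "summable (\<lambda>n. W.prob (B n))"
  proof (rule summable_comparison_test_ev)
    have "(\<lambda>n. of_nat n * q ^ n) \<longlonglongrightarrow> 0" using q by (intro powser_times_n_limit_0) auto
    then have "\<forall>\<^sub>F n in sequentially. real n * q ^ n < 1" by (rule order_tendstoD) simp
    then show "\<forall>\<^sub>F n in sequentially. norm (W.prob (B n)) \<le> (2 * (real a + 1)) * q ^ n"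
      using eventually_ge_at_top[of 1]
    proof eventually_elim
      case (elim n)
      have "real a * n + 1 \<le> (real a + 1) * n" using elim by (simp add: algebra_simps)
      then have "(real a * n + 1) * (2 * c n) \<le> ((real a + 1) * n) * (2 * c n)"
        using c0 by (intro mult_right_mono) auto
      also have "\<dots> = (2 * (real a + 1)) * ((n * q ^ n) * q ^ n)"
        by (simp add: c_def power_mult_distrib algebra_simps)
      also have "\<dots> \<le> (2 * (real a + 1)) * (1 * q ^ n)"
        using elim q by (intro mult_left_mono mult_right_mono) auto
      finally show ?case using pB[of n] by simp
    qed
    show "summable (\<lambda>n. (2 * (real a + 1)) * q ^ n)"
      using q by (intro summable_mult summable_geometric) auto
  qed
  then have "AE p in W. \<forall>\<^sub>F n in sequentially. p \<in> space W - B n"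
    by (intro borel_cantelli_AE1 B_meas) (auto simp: W.emeasure_eq_measure)
  then show ?thesis
  proof eventually_elim
    case (elim p)
    then show ?case
    proof eventually_elim
      case (elim n)
      show ?case
      proof
        assume "\<tau> n p \<le> a * n"
        then have "Z n p \<notin> X1 n (\<tau> n p)" "Z n p \<notin> X2 n (\<tau> n p)" using elim by (auto simp: B_def)
        moreover have "Z n p \<in> carrier G" using elim by (simp add: space_W)
        ultimately show "(q * q) ^ n * u (\<tau> n p) (Z n p) \<le> mass n p \<and>
          (q * q) ^ n * mass n p \<le> u (\<tau> n p) (Z n p)"
          by (auto simp: X1_def X2_def c_def not_less)
      qed
    qed
  qed
qed

lemma len_conv_pow_le: "\<exists>C. \<forall>n. \<forall>x\<in>set_pmf (conv_pow G \<mu> n). len x \<le> C * n"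
proof -
  define C where "C = (\<Sum>x\<in>set_pmf \<mu>. len x)"
  have "len x \<le> C * n" if "x \<in> set_pmf (conv_pow G \<mu> n)" for n x
    using that
  proof (induction n arbitrary: x)
    case (Suc n)
    then obtain y g where yg: "y \<in> set_pmf (conv_pow G \<mu> n)" "g \<in> set_pmf \<mu>" "x = y \<otimes> g" by auto
    then have "len x \<le> len y + len g" using set_conv_pow[OF \<mu>_carrier, of n] \<mu>_carrier by (auto intro!: len_mult)
    moreover have "len g \<le> C" unfolding C_def using yg fin\<mu> by (intro member_le_sum) auto
    ultimately show ?case using Suc.IH[OF yg(1)] by simp
  qed simp
  then show ?thesis by blast
qed

text \<open>
  Positivity of the atoms is recorded because \<open>ln 0 = 0\<close>: the limit alone would not exclude that the mass at
  \<open>Z n p\<close> vanishes.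
\<close>

lemma hitting_information:
  assumes tau: "\<And>n. AE p in W. \<exists>k. p k \<in> ann n"
    and l: "walk_drift G S \<mu> > 0"
  shows "AE p in W. (\<forall>n. Z n p \<in> ann n) \<and> (\<forall>\<^sub>F n in sequentially. 0 < mass n p) \<and>
     (\<lambda>n. - (1 / real n) * ln (mass n p)) \<longlonglongrightarrow> walk_entropy G \<mu> / walk_drift G S \<mu>"
proof -
  define l where "l = walk_drift G S \<mu>"
  define h where "h = walk_entropy G \<mu>"
  have l0: "l > 0" using l by (simp add: l_def)
  \<comment> \<open>Eventually \<open>\<tau> n p \<le> a n\<close>, as \<open>\<tau> n p / n\<close> tends to \<open>1 / l\<close>.\<close>
  obtain a :: nat where a: "1 / l < real a" using reals_Archimedean2 by blast
  \<comment> \<open>Chosen so that the comparison factor is \<open>exp (- n / (j + 1))\<close>.\<close>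
  define q where "q j = exp (- (1 / (2 * real (Suc j))))" for j
  have qq: "(q j * q j) ^ n = exp (- (real n / Suc j))" for j n
    by (simp add: q_def exp_add[symmetric] exp_of_nat_mult[symmetric] field_simps)
  obtain C where C: "\<And>n x. x \<in> set_pmf (conv_pow G \<mu> n) \<Longrightarrow> len x \<le> C * n" using len_conv_pow_le by blast
  have "AE p in W. \<forall>n. \<exists>k. p k \<in> ann n" using tau by (simp add: AE_all_countable)
  moreover have "AE p in W. \<forall>j. \<forall>\<^sub>F n in sequentially. \<tau> n p \<le> a * n \<longrightarrow>
     (q j * q j) ^ n * u (\<tau> n p) (Z n p) \<le> mass n p \<and>
     (q j * q j) ^ n * mass n p \<le> u (\<tau> n p) (Z n p)"
    unfolding AE_all_countable by (intro allI hitting_mass_comparable) (auto simp: q_def)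
  ultimately show ?thesis
    using AE_W_supp drift_converges(2) entropy_converges
    unfolding l_def[symmetric] h_def[symmetric]
  proof eventually_elim
    case (elim p)
    have ann: "Z n p \<in> ann n" for n
      unfolding hitting_time_def by (rule LeastI_ex) (use elim in blast)
    have lim: "filterlim (\<lambda>n. \<tau> n p) at_top sequentially" and ratio: "(\<lambda>n. real (\<tau> n p) / n) \<longlonglongrightarrow> 1 / l"
      using hitting_time_asymptotics[of "\<lambda>k. len (p k)" C "\<lambda>n. \<tau> n p" "support_diameter G S \<mu>" l]
        C elim(3) ann_len[OF ann] elim(4) l0 by auto
    have upos: "0 < u (\<tau> n p) (Z n p)" for n using elim(3) by (simp add: pmf_positive_iff)
    have ev_a: "\<forall>\<^sub>F n in sequentially. \<tau> n p \<le> a * n"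
      using order_tendstoD(2)[OF ratio a] eventually_gt_at_top[of 0]
    proof eventually_elim
      case (elim n)
      then have "real (\<tau> n p) < real (a * n)" by (simp add: field_simps)
      then show ?case by linarith
    qed
    have ev_j: "\<forall>\<^sub>F n in sequentially. 0 < mass n p \<and>
      \<bar>- (1 / real n) * ln (mass n p) - - (1 / real n) * ln (u (\<tau> n p) (Z n p))\<bar> \<le> 1 / Suc j" for j
      using elim(2)[rule_format, of j] ev_a eventually_gt_at_top[of 0]
    proof eventually_elim
      case (elim n)
      let ?v = "mass n p" and ?u = "u (\<tau> n p) (Z n p)"
      have le: "exp (- (real n / Suc j)) * ?u \<le> ?v" "exp (- (real n / Suc j)) * ?v \<le> ?u"
        using elim unfolding qq by auto
      have v: "0 < ?v" using le(1) upos[of n] by (meson exp_gt_zero less_le_trans mult_pos_pos)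
      have "ln (exp (- (real n / Suc j)) * ?u) \<le> ln ?v" using le(1) upos[of n] by (intro ln_mono) auto
      then have 1: "ln ?u - ln ?v \<le> real n / Suc j" using upos[of n] by (simp add: ln_mult)
      have "ln (exp (- (real n / Suc j)) * ?v) \<le> ln ?u" using le(2) v by (intro ln_mono) auto
      then have 2: "ln ?v - ln ?u \<le> real n / Suc j" using v by (simp add: ln_mult)
      have "\<bar>ln ?u - ln ?v\<bar> / real n \<le> (real n / Suc j) / real n"
        using 1 2 by (intro divide_right_mono) auto
      moreover have "- (1 / real n) * ln ?v - - (1 / real n) * ln ?u = (ln ?u - ln ?v) / real n"
        by (simp add: diff_divide_distrib)
      ultimately show ?case using v elim by simp
    qed
    have s: "(\<lambda>n. - (1 / real n) * ln (u (\<tau> n p) (Z n p))) \<longlonglongrightarrow> h * (1 / l)"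
    proof (rule Lim_transform_eventually)
      show "(\<lambda>n. (- ln (u (\<tau> n p) (p (\<tau> n p))) / \<tau> n p) * (real (\<tau> n p) / n)) \<longlonglongrightarrow> h * (1 / l)"
        by (intro tendsto_mult ratio filterlim_compose[OF elim(5) lim])
      have "\<forall>\<^sub>F n in sequentially. 0 < \<tau> n p"
        using lim eventually_gt_at_top[of 0] by (rule filterlim_iff[THEN iffD1, rule_format])
      then show "\<forall>\<^sub>F n in sequentially. (- ln (u (\<tau> n p) (p (\<tau> n p))) / \<tau> n p) * (real (\<tau> n p) / n)
         = - (1 / real n) * ln (u (\<tau> n p) (Z n p))"
        by eventually_elim simp
    qed
    have "(\<lambda>n. - (1 / real n) * ln (mass n p) - - (1 / real n) * ln (u (\<tau> n p) (Z n p))) \<longlonglongrightarrow> 0"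
    proof (rule tendstoI)
      fix e :: real assume "e > 0"
      then obtain j where j: "1 / real (Suc j) < e" using reals_Archimedean[of e] by (auto simp: inverse_eq_divide)
      show "\<forall>\<^sub>F n in sequentially. dist (- (1 / real n) * ln (mass n p) - - (1 / real n) * ln (u (\<tau> n p) (Z n p))) 0 < e"
        using ev_j[of j]
      proof eventually_elim
        case (elim n)
        then show ?case using j unfolding dist_real_def by linarith
      qed
    qed
    from tendsto_add[OF this s]
    have "(\<lambda>n. - (1 / real n) * ln (mass n p)) \<longlonglongrightarrow> h / l" by simp
    moreover have "\<forall>\<^sub>F n in sequentially. 0 < mass n p"
      using ev_j[of 0] by (auto elim: eventually_mono)
    ultimately show ?case using ann by blast
  qed
qed

lemma typical_set_probability:
  fixes H :: real
  assumes inf: "AE p in W. (\<forall>n. Z n p \<in> ann n) \<and> (\<forall>\<^sub>F n in sequentially. 0 < mass n p) \<and>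
     (\<lambda>n. - (1 / real n) * ln (mass n p)) \<longlonglongrightarrow> H"
    and a: "a > 0"
  shows "(\<lambda>n. measure (\<nu> n) (typical_set H a n)) \<longlonglongrightarrow> 1"
proof -
  interpret W: prob_space W by (rule prob_W)
  define T where "T n = typical_set H a n" for n
  have T: "T n \<subseteq> carrier G" for n using ann_carrier by (auto simp: T_def)
  have "(\<lambda>n. W.prob {p \<in> space W. Z n p \<in> T n}) \<longlonglongrightarrow> 1"
  proof (rule W.prob_tendsto_1_of_eventually)
    show "{p \<in> space W. Z n p \<in> T n} \<in> sets W" for n
      using measurable_sets[OF Z_measurable[of n], of "T n"] T by (auto simp: vimage_def Int_def conj_commute)
    show "AE p in W. \<forall>\<^sub>F n in sequentially. p \<in> {p \<in> space W. Z n p \<in> T n}"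
      using inf AE_space
    proof eventually_elim
      case (elim p)
      then have lim: "(\<lambda>n. - (1 / real n) * ln (mass n p)) \<longlonglongrightarrow> H" by blast
      have "\<forall>\<^sub>F n in sequentially. 0 < mass n p" using elim by blast
      moreover have "\<forall>\<^sub>F n in sequentially. - (1 / real n) * ln (mass n p) < H + a"
        by (rule order_tendstoD(2)[OF lim]) (use a in simp)
      moreover have "\<forall>\<^sub>F n in sequentially. H - a < - (1 / real n) * ln (mass n p)"
        by (rule order_tendstoD(1)[OF lim]) (use a in simp)
      ultimately show ?case using eventually_gt_at_top[of 0]
      proof eventually_elim
        case (elim n)
        let ?v = "mass n p"
        have n: "real n > 0" using elim by simp
        have "- ln ?v \<le> real n * (H + a)" "real n * (H - a) \<le> - ln ?v"
          using elim(2,3) n by (simp_all add: field_simps)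
        then have "- real n * (H + a) \<le> ln ?v" "ln ?v \<le> - real n * (H - a)" by (simp_all add: algebra_simps)
        then have "exp (- real n * (H + a)) \<le> ?v" "?v \<le> exp (- real n * (H - a))"
          using elim(1) by (simp_all only: ln_ge_iff ln_le_cancel_iff exp_le_cancel_iff) (metis exp_le_cancel_iff exp_ln)+
        moreover have "Z n p \<in> ann n" "p \<in> space W" using \<open>(\<forall>n. Z n p \<in> ann n) \<and> _\<close> \<open>p \<in> space W\<close> by blast+
        ultimately show ?case by (simp add: T_def)
      qed
    qed
  qed
  then show ?thesis unfolding T_def[symmetric] \<nu>_eq[OF T] .
qed

text \<open>
  The typical atoms, of mass between \<open>exp (- n (H + \<epsilon>))\<close> and \<open>exp (- n (H - \<epsilon>))\<close>, carry almost all the mass.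
  They are at most \<open>exp (n (H + \<epsilon>))\<close> in number and eventually suffice for mass \<open>a\<close>.  Conversely,
  a set of mass \<open>a\<close> eventually carries mass at least \<open>a / 2\<close> on typical atoms, which takes
  \<open>(a / 2) exp (n (H - \<epsilon>))\<close> of them.
\<close>

lemma min_points_growth:
  fixes H a :: real
  assumes typical: "\<And>\<epsilon>. \<epsilon> > 0 \<Longrightarrow> (\<lambda>n. measure (\<nu> n) (typical_set H \<epsilon> n)) \<longlonglongrightarrow> 1"
    and a: "0 < a" "a < 1"
  shows "(\<lambda>n. 1 / real n * ln (real (min_points G S \<mu> n a))) \<longlonglongrightarrow> H"
proof -
  define K where "K n = min_points G S \<mu> n a" for n
  define T where "T \<epsilon> n = typical_set H \<epsilon> n" for \<epsilon> n
  have T: "T \<epsilon> n \<subseteq> carrier G" "finite (T \<epsilon> n)" for \<epsilon> n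
    using ann_carrier finite_subset[OF _ finite_ann[of n]] by (auto simp: T_def)
  have atoms: "measure (\<nu> n) B = (\<Sum>x\<in>B. measure (\<nu> n) {x})" if "finite B" "B \<subseteq> carrier G" for n B
  proof -
    interpret prob_space "\<nu> n" by (rule prob_\<nu>)
    show ?thesis by (rule finite_measure_eq_sum_singleton) (use that in \<open>auto simp: sets_\<nu>\<close>)
  qed
  have main: "\<forall>\<^sub>F n in sequentially. \<bar>1 / real n * ln (real (K n)) - H\<bar> < 2 * \<epsilon>" if \<epsilon>: "\<epsilon> > 0" for \<epsilon>
  proof -
    have lim: "(\<lambda>n. measure (\<nu> n) (T \<epsilon> n)) \<longlonglongrightarrow> 1" unfolding T_def by (rule typical[OF \<epsilon>])
    have "(\<lambda>n. ln (a / 2) / real n) \<longlonglongrightarrow> 0" by (rule lim_const_over_n)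
    then have "\<forall>\<^sub>F n in sequentially. - \<epsilon> < ln (a / 2) / real n" by (rule order_tendstoD) (use \<epsilon> in simp)
    moreover have "\<forall>\<^sub>F n in sequentially. a < measure (\<nu> n) (T \<epsilon> n)"
      by (rule order_tendstoD(1)[OF lim]) (use a in simp)
    moreover have "\<forall>\<^sub>F n in sequentially. 1 - a / 2 < measure (\<nu> n) (T \<epsilon> n)"
      by (rule order_tendstoD(1)[OF lim]) (use a in simp)
    ultimately show ?thesis using eventually_gt_at_top[of 0]
    proof eventually_elim
      case (elim n)
      interpret N: prob_space "\<nu> n" by (rule prob_\<nu>)
      have n: "real n > 0" using elim by simp
      have ex: "\<exists>k. \<exists>A\<subseteq>carrier G. finite A \<and> card A = k \<and> measure (\<nu> n) A \<ge> a"
        using elim(2) T[of \<epsilon> n] by (intro exI[of _ "card (T \<epsilon> n)"] exI[of _ "T \<epsilon> n"]) auto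
      from LeastI_ex[OF ex] obtain A where A: "A \<subseteq> carrier G" "finite A" "card A = K n" "measure (\<nu> n) A \<ge> a"
        unfolding K_def min_points_def by blast
      have "K n \<le> card (T \<epsilon> n)"
        unfolding K_def min_points_def using elim(2) T[of \<epsilon> n] by (intro Least_le) (auto intro!: exI[of _ "T \<epsilon> n"])
      moreover have "card (T \<epsilon> n) * exp (- real n * (H + \<epsilon>)) \<le> 1"
      proof -
        have "card (T \<epsilon> n) * exp (- real n * (H + \<epsilon>)) = (\<Sum>x\<in>T \<epsilon> n. exp (- real n * (H + \<epsilon>)))" by simp
        also have "\<dots> \<le> (\<Sum>x\<in>T \<epsilon> n. measure (\<nu> n) {x})" by (rule sum_mono) (auto simp: T_def)
        also have "\<dots> = measure (\<nu> n) (T \<epsilon> n)" using atoms[OF T(2,1)] by simp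
        also have "\<dots> \<le> 1" by (rule N.prob_le_1)
        finally show ?thesis .
      qed
      ultimately have "real (K n) * exp (- real n * (H + \<epsilon>)) \<le> 1"
        by (smt (verit) exp_ge_zero mult_right_mono of_nat_mono)
      then have up: "real (K n) \<le> exp (real n * (H + \<epsilon>))"
        using mult_right_mono[of "real (K n) * exp (- real n * (H + \<epsilon>))" 1 "exp (real n * (H + \<epsilon>))"]
        by (simp add: mult.assoc mult_exp_exp)
      have low: "a / 2 * exp (real n * (H - \<epsilon>)) \<le> real (K n)"
      proof -
        have "measure (\<nu> n) A \<le> measure (\<nu> n) (A \<inter> T \<epsilon> n) + measure (\<nu> n) (space (\<nu> n) - T \<epsilon> n)"
          using A T by (intro order_trans[OF N.finite_measure_mono measure_Un_le])
            (auto simp: sets_\<nu> space_\<nu>)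
        also have "measure (\<nu> n) (space (\<nu> n) - T \<epsilon> n) = 1 - measure (\<nu> n) (T \<epsilon> n)"
          by (rule N.prob_compl) (use T in \<open>simp add: sets_\<nu>\<close>)
        finally have "a / 2 \<le> measure (\<nu> n) (A \<inter> T \<epsilon> n)" using A(4) elim(3) by linarith
        also have "\<dots> = (\<Sum>x\<in>A \<inter> T \<epsilon> n. measure (\<nu> n) {x})" by (rule atoms) (use A in auto)
        also have "\<dots> \<le> (\<Sum>x\<in>A \<inter> T \<epsilon> n. exp (- real n * (H - \<epsilon>)))" by (rule sum_mono) (auto simp: T_def)
        also have "\<dots> = card (A \<inter> T \<epsilon> n) * exp (- real n * (H - \<epsilon>))" by simp
        also have "\<dots> \<le> real (K n) * exp (- real n * (H - \<epsilon>))"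
          using A card_mono[of A "A \<inter> T \<epsilon> n"] by (intro mult_right_mono) auto
        finally have "a / 2 * exp (real n * (H - \<epsilon>))
            \<le> real (K n) * exp (- real n * (H - \<epsilon>)) * exp (real n * (H - \<epsilon>))"
          by (rule mult_right_mono) simp
        then show ?thesis by (simp add: mult.assoc mult_exp_exp)
      qed
      have pos: "0 < a / 2 * exp (real n * (H - \<epsilon>))" using a by simp
      then have K0: "0 < real (K n)" using low by linarith
      have "ln (real (K n)) \<le> real n * (H + \<epsilon>)"
        using up K0 by (metis exp_gt_zero ln_exp ln_le_cancel_iff)
      then have 1: "ln (real (K n)) / real n \<le> H + \<epsilon>" using n by (simp add: field_simps)
      have "ln (a / 2 * exp (real n * (H - \<epsilon>))) \<le> ln (real (K n))" using low pos K0 by (simp only: ln_le_cancel_iff)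
      moreover have "ln (a / 2 * exp (real n * (H - \<epsilon>))) = ln (a / 2) + ln (exp (real n * (H - \<epsilon>)))"
        by (rule ln_mult_pos) (use a in auto)
      ultimately have "ln (a / 2) + real n * (H - \<epsilon>) \<le> ln (real (K n))" by (simp only: ln_exp)
      then have "(ln (a / 2) + real n * (H - \<epsilon>)) / real n \<le> ln (real (K n)) / real n" using n by (intro divide_right_mono) auto
      then have 2: "ln (a / 2) / real n + (H - \<epsilon>) \<le> ln (real (K n)) / real n" using n by (simp add: add_divide_distrib)
      show ?case using 1 2 elim(1) \<epsilon> by (simp add: abs_less_iff)
    qed
  qed
  show ?thesis unfolding K_def[symmetric]
  proof (rule tendstoI)
    fix e :: real assume "e > 0"
    then have "\<forall>\<^sub>F n in sequentially. \<bar>1 / real n * ln (real (K n)) - H\<bar> < 2 * (e / 2)" by (intro main) simp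
    then show "\<forall>\<^sub>F n in sequentially. dist (1 / real n * ln (real (K n))) H < e" by (simp add: dist_real_def)
  qed
qed

end

theorem theorem6p1:
  fixes G :: "('a, 'b) monoid_scheme" and S :: "'a set" and \<mu> :: "'a pmf" and hhat :: real
  assumes "hyperbolic_group G" and "\<not> elementary_group G"
    and "sym_generating_set G S"
    and "finite (set_pmf \<mu>)" and "admissible G \<mu>"
    and tau_finite: "\<And>n. AE p in walk_measure G \<mu>. \<exists>k. p k \<in> annulus G S \<mu> n"
    and hhat: "hhat = walk_entropy G \<mu> / walk_drift G S \<mu>"
  shows "(AE p in walk_measure G \<mu>.
            (\<lambda>n. - (1 / real n) *
                 ln (measure (hitting_measure G S \<mu> n) {p (hitting_time G S \<mu> n p)}))
              \<longlonglongrightarrow> hhat)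
    \<and> (\<forall>a>0. (\<lambda>n. measure (hitting_measure G S \<mu> n)
            {x \<in> annulus G S \<mu> n.
               exp (- real n * (hhat + a)) \<le> measure (hitting_measure G S \<mu> n) {x} \<and>
               measure (hitting_measure G S \<mu> n) {x} \<le> exp (- real n * (hhat - a))})
            \<longlonglongrightarrow> 1)
    \<and> (\<forall>a. 0 < a \<and> a < 1 \<longrightarrow>
          (\<lambda>n. 1 / real n * ln (real (min_points G S \<mu> n a))) \<longlonglongrightarrow> hhat)"
proof -
  interpret group G using assms(1) by (simp add: hyperbolic_group_def)
  interpret finite_walk G S \<mu>
    by unfold_locales (use assms(3-5) in \<open>auto simp: admissible_def\<close>)
  obtain Y where Y: "expanding G Y" using hyperbolic_expanding[OF assms(1,2)] by blast
  have "walk_drift G S \<mu> > 0" by (rule drift_positive[OF Y assms(5)])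
  from hitting_information[OF tau_finite this]
  have inf: "AE p in W. (\<forall>n. Z n p \<in> ann n) \<and> (\<forall>\<^sub>F n in sequentially. 0 < mass n p) \<and>
     (\<lambda>n. - (1 / real n) * ln (mass n p)) \<longlonglongrightarrow> hhat" unfolding hhat .
  note typical = typical_set_probability[OF inf]
  show ?thesis
  proof (intro conjI allI impI)
    show "AE p in W. (\<lambda>n. - (1 / real n) * ln (mass n p)) \<longlonglongrightarrow> hhat"
      using inf by (rule AE_mp) (auto intro!: AE_I2)
  qed (use typical min_points_growth[OF typical] in blast)+
qed

end
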